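(* Let $d \geq 1$, let $\infty > q > p > 1$, and let $s > 0$ be given by $e^{2s} = \frac{q-1}{p-1}$. Suppose $u : (0,\infty)\times\mathbb{R}^d \to (0,\infty)$ is such that $$u(t,\cdot)^{1/p},\quad \partial_t(u(t,\cdot)^{1/p}),\quad \nabla(u(t,\cdot)^{1/p}),\quad u(t,\cdot)^{-1/p}|\nabla(u(t,\cdot)^{1/p})|^2 \quad\text{and}\quad \Delta(u(t,\cdot)^{1/p})$$ are of polynomial growth locally uniformly in time $t>0$, and satisfies $$\partial_t u \geq L u,$$ where $L = \Delta - x\cdot\nabla$ acts in the spatial variable. Let $\widetilde{u} : (0,\infty)\times\mathbb{R}^d \to (0,\infty)$ be given by $$\widetilde{u}(t,x)^{1/q} = e^{sL}(u(t,\cdot)^{1/p})(x).$$ Then $$\widetilde{u}(t,\cdot)^{1/q},\quad \partial_t(\widetilde{u}(t,\cdot)^{1/q}),\quad \nabla(\widetilde{u}(t,\cdot)^{1/q}),\quad \widetilde{u}(t,\cdot)^{-1/q}|\nabla(\widetilde{u}(t,\cdot)^{1/q})|^2 \quad\text{and}\quad \Delta(\widetilde{u}(t,\cdot)^{1/q})$$ are of polynomial growth locally uniformly in time $t>0$, and $$\partial_t \widetilde{u} \geq L\widetilde{u}.$$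
   Context: $\gamma$ denotes the standard gaussian probability measure on $\mathbb{R}^d$, $\mathrm{d}\gamma(y) = e^{-\frac12|y|^2}\frac{\mathrm{d}y}{(2\pi)^{d/2}}$. The Ornstein--Uhlenbeck semigroup $(e^{sL})_{s\geq 0}$ is defined by $$e^{sL}f(x) = \int_{\mathbb{R}^d} f\big(e^{-s}x + (1-e^{-2s})^{1/2}y\big)\,\mathrm{d}\gamma(y),$$ and its generator is $Lf(x) = \Delta f(x) - x\cdot\nabla f(x)$. A (scalar- or vector-valued) function $F$ on $(0,\infty)\times\mathbb{R}^d$ is of polynomial growth locally uniformly in time $t>0$ if for every fixed $t>0$ there exist a natural number $N$, a compact interval $I\subset(0,\infty)$ containing $t$ (as a neighbourhood of $t$), and a constant $C<\infty$ depending on $t$ such that $\sup_{t'\in I}|F(t',x)| \leq C(1+|x|^2)^{N/2}$ for all $x\in\mathbb{R}^d$. The hypothesis on $u$ is understood to include that the listed derivatives exist; no further regularity is stated. *)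

theory Defs
  imports "HOL-Analysis.Analysis"
begin

definition std_gauss :: "'a::euclidean_space measure" where
  "std_gauss = density lborel
     (\<lambda>y. ennreal (exp (- (norm y)\<^sup>2 / 2) / (2 * pi) powr (real DIM('a) / 2)))"

definition ou_semigroup :: "real \<Rightarrow> ('a::euclidean_space \<Rightarrow> real) \<Rightarrow> 'a \<Rightarrow> real" where
  "ou_semigroup s f x =
     (\<integral>y. f (exp (- s) *\<^sub>R x + sqrt (1 - exp (- 2 * s)) *\<^sub>R y) \<partial>std_gauss)"

text \<open>
  Spatial derivatives are classical pointwise partial derivatives; neither Frechet
  differentiability nor continuity of any derivative is part of these notions.
  The operators below are total functions: they carry information only where
  \<open>has_partial\<close> holds.
\<close>

definition has_partial :: "'a::euclidean_space \<Rightarrow> ('a \<Rightarrow> real) \<Rightarrow> 'a \<Rightarrow> bool" where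
  "has_partial b f x \<longleftrightarrow> (\<lambda>h::real. f (x + h *\<^sub>R b)) differentiable (at 0)"

definition partial :: "'a::euclidean_space \<Rightarrow> ('a \<Rightarrow> real) \<Rightarrow> 'a \<Rightarrow> real" where
  "partial b f x = deriv (\<lambda>h::real. f (x + h *\<^sub>R b)) 0"

definition grad :: "('a::euclidean_space \<Rightarrow> real) \<Rightarrow> 'a \<Rightarrow> 'a" where
  "grad f x = (\<Sum>b\<in>Basis. partial b f x *\<^sub>R b)"

definition laplacian :: "('a::euclidean_space \<Rightarrow> real) \<Rightarrow> 'a \<Rightarrow> real" where
  "laplacian f x = (\<Sum>b\<in>Basis. partial b (partial b f) x)"

definition ou_generator :: "('a::euclidean_space \<Rightarrow> real) \<Rightarrow> 'a \<Rightarrow> real" where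
  "ou_generator f x = laplacian f x - x \<bullet> grad f x"

definition time_deriv :: "(real \<Rightarrow> 'a \<Rightarrow> real) \<Rightarrow> real \<Rightarrow> 'a \<Rightarrow> real" where
  "time_deriv F t x = deriv (\<lambda>\<tau>. F \<tau> x) t"

text \<open>
  Functions on \<open>(0,\<infinity>) \<times> \<real>\<^sup>d\<close> are curried functions with real
  first argument; their values at nonpositive times are irrelevant everywhere below.
\<close>

definition poly_growth ::
  "(real \<Rightarrow> 'a::euclidean_space \<Rightarrow> 'b::real_normed_vector) \<Rightarrow> bool" where
  "poly_growth F \<longleftrightarrow>
     (\<forall>t>0. \<exists>(N::nat) a b C. 0 < a \<and> a < t \<and> t < b \<and>
        (\<forall>t'\<in>{a..b}. \<forall>x. norm (F t' x) \<le> C * (1 + (norm x)\<^sup>2) powr (real N / 2)))"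

definition derivatives_exist :: "(real \<Rightarrow> 'a::euclidean_space \<Rightarrow> real) \<Rightarrow> bool" where
  "derivatives_exist U \<longleftrightarrow>
     (\<forall>t>0. \<forall>x. (\<lambda>\<tau>. U \<tau> x) differentiable (at t) \<and>
        (\<forall>b\<in>Basis. has_partial b (U t) x \<and> has_partial b (partial b (U t)) x))"

text \<open>
  To be applied to \<open>U = u\<^bsup>1/p\<^esup>\<close>, so that dividing by \<open>U\<close> is
  multiplying by \<open>u\<^bsup>-1/p\<^esup>\<close>.
\<close>

definition admissible_growth :: "(real \<Rightarrow> 'a::euclidean_space \<Rightarrow> real) \<Rightarrow> bool" where
  "admissible_growth U \<longleftrightarrow>
     derivatives_exist U \<and>
     poly_growth U \<and>
     poly_growth (time_deriv U) \<and>
     poly_growth (\<lambda>t. grad (U t)) \<and>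
     poly_growth (\<lambda>t x. (norm (grad (U t) x))\<^sup>2 / U t x) \<and>
     poly_growth (\<lambda>t. laplacian (U t))"

text \<open>
  For positive \<open>u\<close>, the derivatives of \<open>u\<close> occurring here exist as soon as
  \<open>derivatives_exist\<close> holds for some power \<open>u\<^bsup>1/p\<^esup>\<close> (one-variable chain rule),
  so the inequality compares genuine derivatives whenever it is used
  together with \<open>admissible_growth\<close>.
\<close>

definition ou_supersolution :: "(real \<Rightarrow> 'a::euclidean_space \<Rightarrow> real) \<Rightarrow> bool" where
  "ou_supersolution u \<longleftrightarrow> (\<forall>t>0. \<forall>x. time_deriv u t x \<ge> ou_generator (u t) x)"

end

theory Submission
  imports Defs "HOL-Probability.Sinc_Integral"
begin

text \<open>
  Write \<open>U = u\<^bsup>1/p\<^esup>\<close>; then \<open>\<partial>\<^sub>t u \<ge> L u\<close> reads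
  \<open>\<partial>\<^sub>t U \<ge> L U + (p - 1) |\<nabla>U|\<^sup>2 / U\<close>. Apply \<open>e\<^bsup>sL\<^esup>\<close>: it commutes with \<open>L\<close>, and
  \<open>|\<nabla> e\<^bsup>sL\<^esup>U|\<^sup>2 \<le> e\<^bsup>-2s\<^esup> (e\<^bsup>sL\<^esup>U) e\<^bsup>sL\<^esup>(|\<nabla>U|\<^sup>2 / U)\<close> by Cauchy--Schwarz, which turns
  \<open>p - 1 = e\<^bsup>-2s\<^esup> (q - 1)\<close> into \<open>q - 1\<close>.

  The difficulty is the commutation \<open>\<integral> \<partial>\<^sub>b\<^sup>2 F d\<gamma> = \<integral> y\<^sub>b \<partial>\<^sub>b F d\<gamma>\<close>, because the pure second partials
  exist only pointwise and only their sum is bounded. Put \<open>g = F e\<^bsup>-|y|\<^sup>2/4\<^esup>\<close>.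
  Comparing \<open>g\<close> with its heat flow \<open>Q\<^sub>r g(x) = \<integral> g(x + r y) d\<gamma>(y)\<close> at a maximum of \<open>Q\<^sub>r g - g - C r\<^sup>2 N\<close>,
  with a weight \<open>N\<close>, gives \<open>|Q\<^sub>r g - g| \<le> C r\<^sup>2 N\<close>; this needs only the pointwise Laplacian of \<open>g\<close>.
  By duality the second difference quotients of \<open>g\<close> are then bounded in \<open>L\<^sup>2\<close> uniformly in the step
  size. They converge pointwise to \<open>\<partial>\<^sub>b\<^sup>2 g\<close>, so the discrete integration by parts
  passes to the limit.
\<close>

text \<open>A second partial that exists everywhere may still fail to be Lebesgue integrable along
  lines, and only the sum of the second partials is controlled; so neither Fubini nor the
  fundamental theorem of calculus in the direction b can be applied directly. The maximum principle
  escapes this: it inspects the second partials at one single point, and only after summing them.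
  The factor e^(-|y|^2/4) is, up to a constant, the square root of the Gaussian density. One copy
  makes g decay, the other is the test function against which the second differences of g are
  integrated, and together they restore the Gaussian measure. The passage from the pointwise
  estimate to L^2 rests on the fact that 2 <w, w - Q_r w> is the Gaussian mean of the squared L^2
  displacements of w. With w a first difference quotient of g, one difference can be shifted, so
  that the second quotient S is tested against g - Q_r g, of size r^2 N. The norm of S then appears
  on both sides and is absorbed.\<close>

lemmas lint_mono = Bochner_Integration.integral_mono
lemmas lint_cong = Bochner_Integration.integral_cong

section \<open>Gaussian averages\<close>

text \<open>The square of the Japanese bracket.\<close>

definition jb :: "'a::euclidean_space \<Rightarrow> real" where
  "jb x = 1 + (norm x)\<^sup>2"

lemma jb_ge_1: "1 \<le> jb x"
  by (simp add: jb_def)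

lemma jb_pos: "0 < jb x"
  using jb_ge_1[of x] by linarith

lemma jb_minus [simp]: "jb (- x) = jb x"
  by (simp add: jb_def)

lemma jb_nonneg: "0 \<le> jb x"
  by (simp add: jb_def)

lemma jb_measurable [measurable]: "jb \<in> borel_measurable borel"
  unfolding jb_def by measurable

text \<open>Here \<open>jb c\<close> is the bracket of a real number. Together with
  \<open>jb_add\<close> this separates \<open>x + c *\<^sub>R y\<close> into factors depending on x,
  on c and on y.\<close>

lemma jb_scale_le: "jb (c *\<^sub>R x) \<le> jb c * jb x"
  unfolding jb_def by (simp add: power_mult_distrib algebra_simps)

lemma norm_add_sq_le: "(norm (x + z :: 'a::real_normed_vector))\<^sup>2 \<le> 2 * (norm x)\<^sup>2 + 2 * (norm z)\<^sup>2"
proof -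
  have "(norm (x + z))\<^sup>2 \<le> (norm x + norm z)\<^sup>2"
    by (intro power_mono norm_triangle_ineq) auto
  also have "\<dots> \<le> 2 * (norm x)\<^sup>2 + 2 * (norm z)\<^sup>2"
    using sum_squares_ge_zero[of "norm x - norm z" 0] by (simp add: power2_eq_square algebra_simps)
  finally show ?thesis .
qed

text \<open>A Peetre-type inequality: translating a power bound costs only a constant that depends
  on the shift.\<close>

lemma jb_add: "jb (x + z) \<le> 2 * jb x * jb z"
proof -
  have "0 \<le> (norm x)\<^sup>2 * (norm z)\<^sup>2" by simp
  moreover have "2 * jb x * jb z = 2 + 2 * (norm x)\<^sup>2 + 2 * (norm z)\<^sup>2 + 2 * ((norm x)\<^sup>2 * (norm z)\<^sup>2)"
    by (simp add: jb_def algebra_simps)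
  ultimately show ?thesis
    using norm_add_sq_le[of x z] unfolding jb_def by linarith
qed

lemma norm_le_jb: "norm x \<le> jb x"
proof -
  have "norm x \<le> 2 * norm x" by simp
  also have "\<dots> \<le> 1 + (norm x)\<^sup>2"
    using zero_le_power2[of "norm x - 1"] unfolding power2_diff by simp
  finally show ?thesis by (simp add: jb_def)
qed

lemma abs_inner_Basis_le_jb: "b \<in> Basis \<Longrightarrow> \<bar>x \<bullet> b\<bar> \<le> jb x"
  by (rule order.trans[OF Basis_le_norm norm_le_jb])

lemma inner_Basis_sq_le_jb: "b \<in> Basis \<Longrightarrow> (x \<bullet> b)\<^sup>2 \<le> jb x"
  using power_mono[OF Basis_le_norm[of b x], of 2] by (simp add: jb_def)

lemma jb_powr_le_power:
  assumes "a \<le> real m"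
  shows "jb x powr a \<le> jb x ^ m"
  using powr_mono[OF assms jb_ge_1[of x]] jb_pos[of x] by (simp add: powr_realpow)

text \<open>From t <= exp t at t = a * jb x / m, raised to the power m. The factor
  \<open>exp a\<close> stems from the 1 inside \<open>jb\<close>.\<close>

lemma jb_power_exp_bounded:
  fixes a :: real
  assumes "a > 0"
  shows "\<exists>C>0. \<forall>x::'a::euclidean_space. jb x ^ m * exp (- (a * (norm x)\<^sup>2)) \<le> C"
proof (intro exI conjI allI)
  show "(real m / a) ^ m * exp a + 1 > 0" using assms by (intro add_nonneg_pos) auto
  fix x :: 'a
  have "jb x ^ m \<le> (real m / a) ^ m * exp (a * jb x)"
  proof (cases "m = 0")
    case True
    then show ?thesis using assms jb_pos[of x] by simp
  next
    case False
    have "a * jb x / m \<le> exp (a * jb x / m)"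
      using exp_ge_add_one_self[of "a * jb x / m"] by linarith
    then have "jb x \<le> real m / a * exp (a * jb x / m)"
      using assms False by (simp add: field_simps)
    then have "jb x ^ m \<le> (real m / a * exp (a * jb x / m)) ^ m"
      by (intro power_mono) (auto simp: jb_nonneg)
    also have "\<dots> = (real m / a) ^ m * exp (a * jb x)"
      using False by (simp add: power_mult_distrib exp_of_nat_mult[symmetric] power_divide)
    finally show ?thesis .
  qed
  also have "exp (a * jb x) = exp a * exp (a * (norm x)\<^sup>2)"
    by (simp add: jb_def algebra_simps flip: exp_add)
  finally have "jb x ^ m * exp (- (a * (norm x)\<^sup>2)) \<le>
      (real m / a) ^ m * (exp a * exp (a * (norm x)\<^sup>2)) * exp (- (a * (norm x)\<^sup>2))"
    by (rule mult_right_mono) simp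
  then show "jb x ^ m * exp (- (a * (norm x)\<^sup>2)) \<le> (real m / a) ^ m * exp a + 1"
    by (simp add: exp_minus field_simps add_increasing)
qed

section \<open>Integrability of inverse powers of the bracket\<close>

lemma integrable_inverse_one_plus_square: "integrable lborel (\<lambda>x::real. 1 / (1 + x\<^sup>2))"
  using integrable_inverse_1_plus_square
  by (simp add: set_integrable_def einterval_def inverse_eq_divide)

text \<open>Every factor is at most \<open>jb x\<close>. Comparison with a tensor product reduces
  integrability over the whole space to the arctangent integral in one variable.\<close>

lemma jb_power_ge_prod:
  "(\<Prod>b\<in>Basis. 1 + (x \<bullet> b)\<^sup>2) \<le> jb (x::'a::euclidean_space) ^ DIM('a)"
proof -
  have "(\<Prod>b\<in>Basis. 1 + (x \<bullet> b)\<^sup>2) \<le> (\<Prod>b\<in>(Basis::'a set). jb x)"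
    using power_mono[OF Basis_le_norm[of _ x], of _ 2]
    by (intro prod_mono) (auto simp: jb_def)
  then show ?thesis by simp
qed

text \<open>This is the dominating function used throughout. The exponent DIM is the number of
  factors in the product bound \<open>jb_power_ge_prod\<close>.\<close>

lemma integrable_inverse_jb:
  "integrable lborel (\<lambda>x::'a::euclidean_space. 1 / jb x ^ DIM('a))"
proof (rule integrableI_bounded)
  show "(\<lambda>x::'a. 1 / jb x ^ DIM('a)) \<in> borel_measurable lborel"
    by measurable
  have "(\<integral>\<^sup>+(x::'a). ennreal (norm (1 / jb x ^ DIM('a))) \<partial>lborel)
      \<le> (\<integral>\<^sup>+(x::'a). (\<Prod>b\<in>Basis. ennreal (1 / (1 + (x \<bullet> b)\<^sup>2))) \<partial>lborel)"
  proof (rule nn_integral_mono)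
    fix x :: 'a
    have pos: "(\<Prod>b\<in>Basis. 1 + (x \<bullet> b)\<^sup>2) > 0"
      by (intro prod_pos ballI) (simp add: add_pos_nonneg)
    have "1 / jb x ^ DIM('a) \<le> 1 / (\<Prod>b\<in>Basis. 1 + (x \<bullet> b)\<^sup>2)"
      using pos jb_power_ge_prod[of x] jb_pos[of x] by (intro divide_left_mono) auto
    then show "ennreal (norm (1 / jb x ^ DIM('a))) \<le> (\<Prod>b\<in>Basis. ennreal (1 / (1 + (x \<bullet> b)\<^sup>2)))"
      using jb_pos[of x]
      by (simp add: prod_ennreal prod_dividef abs_of_pos ennreal_leI)
  qed
  also have "\<dots> = (\<Prod>b\<in>(Basis::'a set). (\<integral>\<^sup>+t. ennreal (1 / (1 + t\<^sup>2)) \<partial>lborel))"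
    by (rule nn_integral_lborel_prod) auto
  also have "\<dots> < \<infinity>"
    using integrable_inverse_one_plus_square
    by (auto simp: integrable_iff_bounded top.not_eq_extremum power_less_top_ennreal)
  finally show "(\<integral>\<^sup>+(x::'a). ennreal (norm (1 / jb x ^ DIM('a))) \<partial>lborel) < \<infinity>" .
qed

lemma integrable_jb_bound:
  fixes v :: "'a::euclidean_space \<Rightarrow> real"
  assumes "v \<in> borel_measurable borel" and "\<And>x. \<bar>v x\<bar> \<le> C / jb x ^ DIM('a)"
  shows "integrable lborel v"
proof (rule Bochner_Integration.integrable_bound)
  show "integrable lborel (\<lambda>x::'a. C * (1 / jb x ^ DIM('a)))"
    using integrable_inverse_jb by (rule integrable_mult_right)
  show "AE x in lborel. norm (v x) \<le> norm (C * (1 / jb x ^ DIM('a)))"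
    using order.trans[OF assms(2) abs_ge_self] by (intro AE_I2) simp
qed (use assms in auto)

section \<open>The standard Gaussian measure and its density\<close>

definition gauss_density :: "'a::euclidean_space \<Rightarrow> real" where
  "gauss_density y = exp (- (norm y)\<^sup>2 / 2) / (2 * pi) powr (real DIM('a) / 2)"

lemma gauss_density_pos: "0 < gauss_density y"
  by (simp add: gauss_density_def)

lemma gauss_density_measurable [measurable]: "gauss_density \<in> borel_measurable borel"
  unfolding gauss_density_def by measurable

lemma std_gauss_eq: "std_gauss = density lborel (\<lambda>y. ennreal (gauss_density y))"
  by (simp add: std_gauss_def gauss_density_def)

lemma sets_std_gauss [measurable_cong, simp]: "sets std_gauss = sets borel"
  by (simp add: std_gauss_eq)

lemma space_std_gauss [simp]: "space std_gauss = UNIV"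
  by (simp add: std_gauss_eq)

lemma integral_std_gauss:
  fixes v :: "'a::euclidean_space \<Rightarrow> real"
  assumes "v \<in> borel_measurable borel"
  shows "(\<integral>y. v y \<partial>std_gauss) = (\<integral>y. gauss_density y * v y \<partial>lborel)"
  unfolding std_gauss_eq using assms
  by (subst integral_density) (auto simp: less_imp_le[OF gauss_density_pos])

lemma integrable_std_gauss:
  fixes v :: "'a::euclidean_space \<Rightarrow> real"
  assumes "v \<in> borel_measurable borel"
  shows "integrable std_gauss v \<longleftrightarrow> integrable lborel (\<lambda>y. gauss_density y * v y)"
  unfolding std_gauss_eq using assms
  by (subst integrable_density) (auto simp: less_imp_le[OF gauss_density_pos])

lemma gauss_density_prod:
  "gauss_density (y::'a::euclidean_space) = (\<Prod>b\<in>Basis. std_normal_density (y \<bullet> b))"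
proof -
  have "(\<Prod>b\<in>(Basis::'a set). std_normal_density (y \<bullet> b)) =
      (1 / sqrt (2 * pi)) ^ DIM('a) * exp (\<Sum>b\<in>(Basis::'a set). - (y \<bullet> b)\<^sup>2 / 2)"
    by (simp add: std_normal_density_def prod.distrib exp_sum prod_dividef power_one_over)
  also have "(\<Sum>b\<in>(Basis::'a set). - (y \<bullet> b)\<^sup>2 / 2) = - (norm y)\<^sup>2 / 2"
    unfolding power2_norm_eq_inner
    by (simp add: euclidean_inner[of y y] sum_negf power2_eq_square flip: sum_divide_distrib)
  also have "(1 / sqrt (2 * pi)) ^ DIM('a) = 1 / (2 * pi) powr (real DIM('a) / 2)"
    by (simp add: power_one_over powr_half_sqrt[symmetric] powr_powr[symmetric] flip: powr_realpow)
      (simp add: powr_realpow[symmetric] powr_powr)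
  finally show ?thesis by (simp add: gauss_density_def)
qed

lemma prob_space_std_gauss: "prob_space (std_gauss :: 'a::euclidean_space measure)"
proof
  have "emeasure (std_gauss :: 'a measure) (space std_gauss) = (\<integral>\<^sup>+(y::'a). ennreal (gauss_density y) \<partial>lborel)"
    by (simp add: std_gauss_eq emeasure_density)
  also have "\<dots> = (\<integral>\<^sup>+(y::'a). (\<Prod>b\<in>Basis. ennreal (std_normal_density (y \<bullet> b))) \<partial>lborel)"
    by (simp add: gauss_density_prod prod_ennreal)
  also have "\<dots> = (\<Prod>b\<in>(Basis::'a set). (\<integral>\<^sup>+t. ennreal (std_normal_density t) \<partial>lborel))"
    by (rule nn_integral_lborel_prod) auto
  also have "\<dots> = 1"
    by (simp add: nn_integral_eq_integral)
  finally show "emeasure (std_gauss :: 'a measure) (space std_gauss) = 1" .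
qed

text \<open>The mean value inequality bounds the difference quotients by \<open>B\<close>, and
  dominated convergence does the rest. Measurability of \<open>F' t\<close> is a conclusion here, as
  a pointwise limit of measurable quotients; this matters for the time derivative of
  \<open>U\<close>, of which only growth is known.\<close>

lemma deriv_under_integral:
  fixes F F' :: "real \<Rightarrow> 'a \<Rightarrow> real"
  assumes e: "e > 0"
    and der: "\<And>\<tau> y. \<bar>\<tau> - t\<bar> < e \<Longrightarrow> ((\<lambda>\<tau>. F \<tau> y) has_real_derivative F' \<tau> y) (at \<tau>)"
    and bound: "\<And>\<tau> y. \<bar>\<tau> - t\<bar> < e \<Longrightarrow> \<bar>F' \<tau> y\<bar> \<le> B y"
    and int: "\<And>\<tau>. \<bar>\<tau> - t\<bar> < e \<Longrightarrow> integrable M (F \<tau>)"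
    and intB: "integrable M B"
  shows "integrable M (F' t)"
    and "((\<lambda>\<tau>. \<integral>y. F \<tau> y \<partial>M) has_real_derivative (\<integral>y. F' t y \<partial>M)) (at t)"
proof -
  have intt: "integrable M (F t)" using int[of t] e by simp
  have quot: "\<bar>(F (t + h) y - F t y) / h\<bar> \<le> B y" if h: "\<bar>h\<bar> < e" "h \<noteq> 0" for h y
  proof -
    have "norm (F (t + h) y - F t y) \<le> B y * norm (t + h - t)"
      by (rule field_differentiable_bound[of "ball t e" "\<lambda>\<tau>. F \<tau> y" "\<lambda>\<tau>. F' \<tau> y"])
        (use der bound h e in \<open>auto simp: dist_real_def abs_minus_commute intro: DERIV_subset\<close>)
    then show ?thesis using h by (simp add: field_simps)
  qed
  have lim: "(\<lambda>n. (F (t + X n) y - F t y) / X n) \<longlonglongrightarrow> F' t y"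
    if "X \<longlonglongrightarrow> 0" "\<And>n. X n \<noteq> 0" for X y
    using der[of t y] e that unfolding DERIV_def tendsto_at_iff_sequentially by (auto simp: o_def)
  have key: "integrable M (F' t) \<and>
      (\<lambda>n. \<integral>y. (F (t + X n) y - F t y) / X n \<partial>M) \<longlonglongrightarrow> (\<integral>y. F' t y \<partial>M)"
    if X: "X \<longlonglongrightarrow> 0" "\<And>n. X n \<noteq> 0" "\<And>n. \<bar>X n\<bar> < e" for X
  proof -
    have [measurable]: "(\<lambda>y. (F (t + X n) y - F t y) / X n) \<in> borel_measurable M" for n
      using int[of "t + X n"] intt X(3)[of n] by (auto intro!: borel_measurable_divide borel_measurable_diff)
    have [measurable]: "F' t \<in> borel_measurable M"
      by (rule borel_measurable_LIMSEQ_real[OF lim[OF X(1,2)]]) auto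
    have lim': "AE y in M. (\<lambda>n. (F (t + X n) y - F t y) / X n) \<longlonglongrightarrow> F' t y"
      using lim[OF X(1,2)] by simp
    have bound': "AE y in M. norm ((F (t + X n) y - F t y) / X n) \<le> B y" for n
      using quot[OF X(3,2)] by (auto simp del: abs_divide)
    show ?thesis
      using integrable_dominated_convergence[OF _ _ intB lim' bound']
        integral_dominated_convergence[OF _ _ intB lim' bound'] by simp
  qed
  show "integrable M (F' t)"
  proof -
    \<comment> \<open>Any null sequence of nonzero steps inside the window serves; the 2 keeps
      already the first step strictly below e.\<close>
    have "(\<lambda>n. e / (real n + 2)) \<longlonglongrightarrow> 0"
      by (rule real_tendsto_divide_at_top[OF tendsto_const],
          rule filterlim_at_top_mono[OF filterlim_real_sequentially]) simp
    moreover have "\<bar>e / (real n + 2)\<bar> < e" for n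
      using e by (simp add: field_simps add_pos_nonneg)
    ultimately show ?thesis
      using key[of "\<lambda>n. e / (real n + 2)"] e by (auto simp del: abs_divide)
  qed
  show "((\<lambda>\<tau>. \<integral>y. F \<tau> y \<partial>M) has_real_derivative (\<integral>y. F' t y \<partial>M)) (at t)"
    unfolding DERIV_def tendsto_at_iff_sequentially
  proof (intro allI impI)
    fix X :: "nat \<Rightarrow> real"
    assume X: "\<forall>i. X i \<in> UNIV - {0}" "X \<longlonglongrightarrow> 0"
    \<comment> \<open>\<open>X\<close> may leave the window finitely often, where neither the bound
      nor integrability is known; there the step is replaced by e / 2, which does not affect the
      limit.\<close>
    define Y where "Y n = (if \<bar>X n\<bar> < e then X n else e / 2)" for n
    have ev: "\<forall>\<^sub>F n in sequentially. \<bar>X n\<bar> < e"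
      using X(2) e unfolding tendsto_iff by (auto simp: dist_real_def)
    then have evY: "\<forall>\<^sub>F n in sequentially. X n = Y n"
      by eventually_elim (simp add: Y_def)
    have "Y \<longlonglongrightarrow> 0"
      using tendsto_cong[OF evY] X(2) by simp
    then have "(\<lambda>n. \<integral>y. (F (t + Y n) y - F t y) / Y n \<partial>M) \<longlonglongrightarrow> (\<integral>y. F' t y \<partial>M)"
      using key[of Y] X e by (auto simp: Y_def)
    moreover have "(\<integral>y. (F (t + Y n) y - F t y) / Y n \<partial>M) =
        ((\<integral>y. F (t + Y n) y \<partial>M) - (\<integral>y. F t y \<partial>M)) / Y n" for n
      using int[of "t + Y n"] intt e by (simp add: Y_def)
    ultimately have "(\<lambda>n. ((\<integral>y. F (t + Y n) y \<partial>M) - (\<integral>y. F t y \<partial>M)) / Y n) \<longlonglongrightarrow> (\<integral>y. F' t y \<partial>M)"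
      by (simp only:)
    moreover have "\<forall>\<^sub>F n in sequentially. ((\<integral>y. F (t + X n) y \<partial>M) - (\<integral>y. F t y \<partial>M)) / X n
        = ((\<integral>y. F (t + Y n) y \<partial>M) - (\<integral>y. F t y \<partial>M)) / Y n"
      using evY by eventually_elim simp
    ultimately show "((\<lambda>h. ((\<integral>y. F (t + h) y \<partial>M) - (\<integral>y. F t y \<partial>M)) / h) \<circ> X)
        \<longlonglongrightarrow> (\<integral>y. F' t y \<partial>M)"
      unfolding o_def by (simp add: tendsto_cong)
  qed
qed

section \<open>Translation and dilation in Lebesgue integrals\<close>

lemma
  fixes f :: "'a::euclidean_space \<Rightarrow> real"
  assumes [measurable]: "f \<in> borel_measurable borel"
  shows integral_lborel_translate: "(\<integral>x. f (x + z) \<partial>lborel) = (\<integral>x. f x \<partial>lborel)"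
    and integrable_lborel_translate: "integrable lborel (\<lambda>x. f (x + z)) \<longleftrightarrow> integrable lborel f"
proof -
  have "(\<integral>x. f x \<partial>lborel) = (\<integral>x. f x \<partial>distr lborel borel ((+) z))"
    by (simp add: lborel_distr_plus)
  also have "\<dots> = (\<integral>x. f (x + z) \<partial>lborel)"
    by (subst integral_distr) (auto simp: add.commute)
  finally show "(\<integral>x. f (x + z) \<partial>lborel) = (\<integral>x. f x \<partial>lborel)" ..
  have "integrable lborel f \<longleftrightarrow> integrable (distr lborel borel ((+) z)) f"
    by (simp add: lborel_distr_plus)
  also have "\<dots> \<longleftrightarrow> integrable lborel (\<lambda>x. f (x + z))"
    by (subst integrable_distr_eq) (auto simp: add.commute)
  finally show "integrable lborel (\<lambda>x. f (x + z)) \<longleftrightarrow> integrable lborel f" ..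
qed

lemma integral_lborel_scale:
  fixes f :: "'a::euclidean_space \<Rightarrow> real"
  assumes [measurable]: "f \<in> borel_measurable borel" and c: "c > 0"
  shows "(\<integral>x. f x \<partial>lborel) = c ^ DIM('a) * (\<integral>x. f (c *\<^sub>R x) \<partial>lborel)"
proof -
  have "(\<integral>x. f x \<partial>lborel) =
      (\<integral>x. f x \<partial>density (distr lborel borel (\<lambda>x::'a. 0 + c *\<^sub>R x)) (\<lambda>_. ennreal (\<bar>c\<bar>^DIM('a))))"
    using lborel_affine[of c "0::'a"] c by simp
  also have "\<dots> = c ^ DIM('a) * (\<integral>x. f (c *\<^sub>R x) \<partial>lborel)"
    using c by (subst integral_density) (auto simp: integral_distr)
  finally show ?thesis .
qed

text \<open>Decay faster than every power, with no condition on derivatives: a kernel and its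
  derivative are each required to be \<open>rapid\<close> where they occur.\<close>

definition rapid :: "('a::euclidean_space \<Rightarrow> real) \<Rightarrow> bool" where
  "rapid k \<longleftrightarrow> (\<forall>j. \<exists>D. \<forall>y. \<bar>k y\<bar> \<le> D / jb y ^ j)"

lemma rapid_poly_gauss:
  fixes k :: "'a::euclidean_space \<Rightarrow> real"
  assumes "\<And>y. \<bar>k y\<bar> \<le> C * jb y ^ m"
  shows "rapid (\<lambda>y. k y * gauss_density y)"
  unfolding rapid_def
proof
  fix j
  obtain C' where C': "C' > 0" "\<And>x::'a. jb x ^ (m + j) * exp (- (1/2 * (norm x)\<^sup>2)) \<le> C'"
    using jb_power_exp_bounded[of "1/2" "m + j"] by auto
  define D where "D = (2 * pi) powr (real DIM('a) / 2)"
  have D: "D > 0" by (simp add: D_def)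
  have "\<bar>k x * gauss_density x\<bar> \<le> (\<bar>C\<bar> * C' / D) / jb x ^ j" for x :: 'a
  proof -
    have "\<bar>k x\<bar> \<le> \<bar>C\<bar> * jb x ^ m"
      using assms[of x] by (rule order.trans) (simp add: mult_right_mono jb_nonneg)
    then have "\<bar>k x * gauss_density x\<bar> \<le> \<bar>C\<bar> * jb x ^ m * gauss_density x"
      by (simp add: abs_mult abs_of_pos gauss_density_pos)
    also have "\<dots> = \<bar>C\<bar> / D * (jb x ^ (m + j) * exp (- (1/2 * (norm x)\<^sup>2))) / jb x ^ j"
      using jb_pos[of x] by (simp add: gauss_density_def D_def power_add field_simps)
    also have "\<dots> \<le> \<bar>C\<bar> / D * C' / jb x ^ j"
      using C'(2)[of x] D jb_pos[of x] by (intro divide_right_mono mult_left_mono) auto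
    finally show ?thesis by simp
  qed
  then show "\<exists>D. \<forall>y. \<bar>k y * gauss_density y\<bar> \<le> D / jb y ^ j" by blast
qed

lemma rapidE_nonneg:
  fixes k :: "'a::euclidean_space \<Rightarrow> real"
  assumes "rapid k"
  obtains D where "D \<ge> 0" "\<And>y. \<bar>k y\<bar> \<le> D / jb y ^ j"
proof -
  obtain D where D: "\<And>y. \<bar>k y\<bar> \<le> D / jb y ^ j"
    using assms unfolding rapid_def by blast
  have "0 \<le> D / jb (0::'a) ^ j" by (rule order.trans[OF abs_ge_zero D])
  then have "D \<ge> 0" by (simp add: jb_def)
  with D that show thesis by blast
qed

lemma poly_bound_nonneg:
  fixes v :: "'a::euclidean_space \<Rightarrow> real"
  assumes "\<And>z. \<bar>v z\<bar> \<le> C * jb z ^ m"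
  shows "0 \<le> (C::real)"
proof -
  have "0 \<le> C * jb (0::'a) ^ m" by (rule order.trans[OF abs_ge_zero assms])
  then show ?thesis by (simp add: jb_def)
qed

lemma poly_bound_affine:
  fixes x :: "'a::euclidean_space"
  assumes v: "\<And>z::'a. \<bar>v z\<bar> \<le> C * jb z ^ m"
  shows "\<bar>v (x + c *\<^sub>R y)\<bar> \<le> C * (2 * jb x * jb c) ^ m * jb y ^ m"
proof -
  have "jb (x + c *\<^sub>R y) \<le> 2 * jb x * jb (c *\<^sub>R y)"
    by (rule jb_add)
  also have "\<dots> \<le> 2 * jb x * (jb c * jb y)"
    by (intro mult_left_mono jb_scale_le) (simp add: jb_nonneg)
  finally have "jb (x + c *\<^sub>R y) ^ m \<le> (2 * jb x * jb c * jb y) ^ m"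
    by (intro power_mono) (auto simp: jb_nonneg mult.assoc)
  then have "C * jb (x + c *\<^sub>R y) ^ m \<le> C * (2 * jb x * jb c * jb y) ^ m"
    by (rule mult_left_mono) (rule poly_bound_nonneg[OF v])
  with v[of "x + c *\<^sub>R y"] show ?thesis by (simp add: power_mult_distrib mult.assoc)
qed

text \<open>\<open>jb_add\<close> for y = (y - z) + z, solved for the inverse power: decay survives
  a translation.\<close>

lemma inverse_jb_shift:
  fixes y z :: "'a::euclidean_space"
  shows "1 / jb (y - z) ^ j \<le> (2 * jb z) ^ j / jb y ^ j"
proof -
  have "jb y \<le> 2 * jb (y - z) * jb z"
    using jb_add[of "y - z" z] by simp
  then have "jb y ^ j \<le> (2 * jb (y - z) * jb z) ^ j"
    by (intro power_mono) (auto simp: jb_nonneg)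
  then show ?thesis
    using jb_pos[of y] jb_pos[of "y - z"] by (simp add: field_simps power_mult_distrib)
qed

lemma integrable_rapid_poly:
  fixes v k :: "'a::euclidean_space \<Rightarrow> real"
  assumes [measurable]: "v \<in> borel_measurable borel" "k \<in> borel_measurable borel"
    and v: "\<And>z. \<bar>v z\<bar> \<le> C * jb z ^ m" and k: "rapid k"
  shows "integrable lborel (\<lambda>y. k y * v y)"
proof -
  obtain D where D: "D \<ge> 0" "\<And>y. \<bar>k y\<bar> \<le> D / jb y ^ (m + DIM('a))"
    using rapidE_nonneg[OF k] by blast
  have "\<bar>k y * v y\<bar> \<le> (D * C) / jb y ^ DIM('a)" for y
  proof -
    have "\<bar>k y * v y\<bar> \<le> (D / jb y ^ (m + DIM('a))) * (C * jb y ^ m)"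
      unfolding abs_mult using D v by (intro mult_mono) (auto simp: jb_nonneg)
    also have "\<dots> = (D * C) / jb y ^ DIM('a)"
      using jb_pos[of y] by (simp add: power_add field_simps)
    finally show ?thesis .
  qed
  then show ?thesis by (rule integrable_jb_bound[rotated]) measurable
qed

lemma integrable_std_gauss_poly:
  fixes v :: "'a::euclidean_space \<Rightarrow> real"
  assumes [measurable]: "v \<in> borel_measurable borel" and v: "\<And>x. \<bar>v x\<bar> \<le> C * jb x ^ m"
  shows "integrable std_gauss v"
proof -
  have "rapid (\<lambda>y::'a. 1 * gauss_density y)" by (rule rapid_poly_gauss[of _ 1 0]) simp
  then have "integrable lborel (\<lambda>y. 1 * gauss_density y * v y)"
    by (rule integrable_rapid_poly[OF _ _ v, rotated 2]) measurable
  then show ?thesis by (simp add: integrable_std_gauss)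
qed

text \<open>The translation by h b is moved from \<open>v\<close> to the kernel by substituting y -
  (h / c) b for y, so that no derivative falls on \<open>v\<close>. By \<open>der\<close>,
  \<open>k'\<close> is minus the derivative of \<open>k\<close> along b; the factor 1 / c comes from
  the substitution.\<close>

lemma has_real_derivative_integral_kernel:
  fixes v k k' :: "'a::euclidean_space \<Rightarrow> real"
  assumes [measurable]: "v \<in> borel_measurable borel" "k \<in> borel_measurable borel"
    and v: "\<And>z. \<bar>v z\<bar> \<le> C * jb z ^ m" and k: "rapid k" and k': "rapid k'"
    and der: "\<And>y h. ((\<lambda>h. k (y - h *\<^sub>R b)) has_real_derivative k' (y - h *\<^sub>R b)) (at h)"
    and b: "b \<in> Basis" and c: "c > 0"
  shows "((\<lambda>h. \<integral>y. k y * v (x + h *\<^sub>R b + c *\<^sub>R y) \<partial>lborel) has_real_derivative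
      (1 / c) * (\<integral>y. k' y * v (x + c *\<^sub>R y) \<partial>lborel)) (at 0)"
proof -
  define A where "A = (2 * jb x * jb c) ^ m"
  have va: "\<bar>v (x + c *\<^sub>R y)\<bar> \<le> C * A * jb y ^ m" for y
    using poly_bound_affine[OF v] by (simp add: A_def)
  obtain D where D: "D \<ge> 0" "\<And>y. \<bar>k' y\<bar> \<le> D / jb y ^ (m + DIM('a))"
    using rapidE_nonneg[OF k'] by blast
  define F where "F h y = k (y - (h / c) *\<^sub>R b) * v (x + c *\<^sub>R y)" for h y
  define F' where "F' h y = (1 / c) * k' (y - (h / c) *\<^sub>R b) * v (x + c *\<^sub>R y)" for h y
  have CA: "C * A \<ge> 0"
    using poly_bound_nonneg[OF v] by (auto simp: A_def jb_nonneg)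
  have shift: "(\<integral>y. k y * v (x + h *\<^sub>R b + c *\<^sub>R y) \<partial>lborel) = (\<integral>y. F h y \<partial>lborel)" for h
  proof -
    have "(\<integral>y. F h y \<partial>lborel) = (\<integral>y. F h (y + (h / c) *\<^sub>R b) \<partial>lborel)"
      unfolding F_def by (rule integral_lborel_translate[symmetric]) measurable
    also have "\<dots> = (\<integral>y. k y * v (x + h *\<^sub>R b + c *\<^sub>R y) \<partial>lborel)"
      unfolding F_def using c by (simp add: scaleR_add_right algebra_simps)
    finally show ?thesis ..
  qed
  define E where "E = D * 4 ^ (m + DIM('a)) * (C * A) / c"
  have "((\<lambda>h. \<integral>y. F h y \<partial>lborel) has_real_derivative (\<integral>y. F' 0 y \<partial>lborel)) (at 0)"
  proof (rule deriv_under_integral(2)[OF c])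
    fix \<tau> y
    have "((\<lambda>h. k (y - (h / c) *\<^sub>R b)) has_real_derivative k' (y - (\<tau> / c) *\<^sub>R b) * (1 / c)) (at \<tau>)"
      by (rule DERIV_chain2[OF der]) (use c in \<open>auto intro!: derivative_eq_intros\<close>)
    from DERIV_cmult_right[OF this, of "v (x + c *\<^sub>R y)"]
    show "((\<lambda>\<tau>. F \<tau> y) has_real_derivative F' \<tau> y) (at \<tau>)"
      by (simp add: F_def F'_def)
  next
    fix \<tau> y assume "\<bar>\<tau> - 0\<bar> < c"
    then have "\<bar>\<tau> / c\<bar> \<le> 1" using c by simp
    then have "(\<tau> / c)\<^sup>2 \<le> 1" by (simp only: abs_square_le_1)
    \<comment> \<open>Inside the window of radius c the kernel is translated by at most one unit, so
      twice the bracket of the translation is at most 4; this is the 4 in \<open>E\<close>.\<close>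
    then have J2: "jb ((\<tau> / c) *\<^sub>R b) \<le> 2"
      using b by (simp add: jb_def power_divide)
    have "\<bar>k' (y - (\<tau> / c) *\<^sub>R b)\<bar> \<le> D * (1 / jb (y - (\<tau> / c) *\<^sub>R b) ^ (m + DIM('a)))"
      using D(2) by simp
    also have "\<dots> \<le> D * ((2 * jb ((\<tau> / c) *\<^sub>R b)) ^ (m + DIM('a)) / jb y ^ (m + DIM('a)))"
      by (intro mult_left_mono inverse_jb_shift D)
    also have "\<dots> \<le> D * (4 ^ (m + DIM('a)) / jb y ^ (m + DIM('a)))"
      using J2 by (intro mult_left_mono divide_right_mono power_mono D)
        (auto simp: jb_nonneg)
    finally have "\<bar>F' \<tau> y\<bar> \<le> (1 / c) * (D * (4 ^ (m + DIM('a)) / jb y ^ (m + DIM('a)))) * (C * A * jb y ^ m)"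
      unfolding F'_def abs_mult using c va CA
      by (intro mult_mono) (auto simp: jb_nonneg D)
    also have "\<dots> = E * (1 / jb y ^ DIM('a))"
      using jb_pos[of y] c by (simp add: E_def power_add field_simps)
    finally show "\<bar>F' \<tau> y\<bar> \<le> E * (1 / jb y ^ DIM('a))" .
  next
    fix \<tau>
    have "integrable lborel (\<lambda>y. k y * v (x + \<tau> *\<^sub>R b + c *\<^sub>R y))"
      by (rule integrable_rapid_poly[OF _ _ poly_bound_affine[OF v] k]) measurable
    moreover have "(\<lambda>y. F \<tau> (y + (\<tau> / c) *\<^sub>R b)) = (\<lambda>y. k y * v (x + \<tau> *\<^sub>R b + c *\<^sub>R y))"
      unfolding F_def using c by (simp add: scaleR_add_right algebra_simps)
    moreover have "F \<tau> \<in> borel_measurable borel"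
      unfolding F_def by measurable
    from integrable_lborel_translate[OF this, of "(\<tau> / c) *\<^sub>R b"]
    have "integrable lborel (\<lambda>y. F \<tau> (y + (\<tau> / c) *\<^sub>R b)) \<longleftrightarrow> integrable lborel (F \<tau>)" .
    ultimately show "integrable lborel (F \<tau>)"
      by (simp only:)
  next
    show "integrable lborel (\<lambda>y::'a. E * (1 / jb y ^ DIM('a)))"
      by (intro integrable_mult_right integrable_inverse_jb)
  qed
  then show ?thesis
    by (simp add: shift F'_def mult.assoc)
qed

text \<open>The heat semigroup at time c^2 / 2. By Mehler's formula the Ornstein-Uhlenbeck semigroup
  is the same average read at the dilated point e^(-s) x, so both flows share the derivative
  formulas below.\<close>

definition gauss_avg :: "real \<Rightarrow> ('a::euclidean_space \<Rightarrow> real) \<Rightarrow> 'a \<Rightarrow> real" where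
  "gauss_avg c v x = (\<integral>y. v (x + c *\<^sub>R y) \<partial>std_gauss)"

lemma integrable_gauss_avg:
  fixes v k :: "'a::euclidean_space \<Rightarrow> real"
  assumes [measurable]: "v \<in> borel_measurable borel" "k \<in> borel_measurable borel"
    and v: "\<And>z. \<bar>v z\<bar> \<le> C * jb z ^ m" and k: "\<And>y. \<bar>k y\<bar> \<le> K * jb y ^ l"
  shows "integrable std_gauss (\<lambda>y. v (x + c *\<^sub>R y) * k y)"
proof (rule integrable_std_gauss_poly)
  define A where "A = (2 * jb x * jb c) ^ m"
  fix y
  have "C * A \<ge> 0"
    using poly_bound_nonneg[OF v] by (auto simp: A_def jb_nonneg)
  then have "\<bar>v (x + c *\<^sub>R y)\<bar> * \<bar>k y\<bar> \<le> (C * A * jb y ^ m) * (K * jb y ^ l)"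
    using poly_bound_affine[OF v, of x c y] k
    by (intro mult_mono) (auto simp: A_def mult.assoc jb_nonneg)
  then show "\<bar>v (x + c *\<^sub>R y) * k y\<bar> \<le> (C * A * K) * jb y ^ (m + l)"
    by (simp add: abs_mult power_add mult_ac)
qed measurable

lemma gauss_density_deriv:
  assumes b: "b \<in> Basis"
  shows "((\<lambda>h. gauss_density (y - h *\<^sub>R b)) has_real_derivative
    ((y - h *\<^sub>R b) \<bullet> b) * gauss_density (y - h *\<^sub>R b)) (at h)"
proof -
  have eq: "(norm (y - h *\<^sub>R b))\<^sup>2 = (norm y)\<^sup>2 - 2 * h * (y \<bullet> b) + h\<^sup>2" for h
    unfolding power2_norm_eq_inner using b
    by (simp add: inner_diff_left inner_diff_right inner_commute power2_eq_square algebra_simps)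
  show ?thesis
    unfolding gauss_density_def eq using b
    by (auto intro!: derivative_eq_intros simp: inner_diff_left field_simps)
qed

text \<open>The weights y_b and y_b^2 - 1 are the Hermite polynomials that arise when the
  derivatives fall on the Gaussian density. Combined, the two formulas give the second partial of
  \<open>gauss_avg c v\<close> with factor 1 / c^2.\<close>

lemma
  fixes v :: "'a::euclidean_space \<Rightarrow> real"
  assumes [measurable]: "v \<in> borel_measurable borel"
    and v: "\<And>z. \<bar>v z\<bar> \<le> C * jb z ^ m"
    and b: "b \<in> Basis" and c: "c > 0"
  shows gauss_avg_deriv: "((\<lambda>h. gauss_avg c v (x + h *\<^sub>R b)) has_real_derivative
      (1 / c) * (\<integral>y. v (x + c *\<^sub>R y) * (y \<bullet> b) \<partial>std_gauss)) (at 0)"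
    and gauss_avg_deriv2: "((\<lambda>h. \<integral>y. v (x + h *\<^sub>R b + c *\<^sub>R y) * (y \<bullet> b) \<partial>std_gauss) has_real_derivative
      (1 / c) * (\<integral>y. v (x + c *\<^sub>R y) * ((y \<bullet> b)\<^sup>2 - 1) \<partial>std_gauss)) (at 0)"
proof -
  have r0: "rapid (gauss_density :: 'a \<Rightarrow> real)"
    using rapid_poly_gauss[of "\<lambda>_. 1" 1 0] by simp
  have r1: "rapid (\<lambda>y::'a. (y \<bullet> b) * gauss_density y)"
    using abs_inner_Basis_le_jb[OF b] by (intro rapid_poly_gauss[of _ 1 1]) simp
  have r2: "rapid (\<lambda>y::'a. ((y \<bullet> b)\<^sup>2 - 1) * gauss_density y)"
  proof (rule rapid_poly_gauss[of _ 1 1])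
    fix y :: 'a
    show "\<bar>(y \<bullet> b)\<^sup>2 - 1\<bar> \<le> 1 * jb y ^ 1"
      using inner_Basis_sq_le_jb[OF b, of y] jb_ge_1[of y] zero_le_power2[of "y \<bullet> b"]
      unfolding abs_le_iff power_one_right by linarith
  qed
  have d2: "((\<lambda>h. ((y - h *\<^sub>R b) \<bullet> b) * gauss_density (y - h *\<^sub>R b)) has_real_derivative
      (((y - h *\<^sub>R b) \<bullet> b)\<^sup>2 - 1) * gauss_density (y - h *\<^sub>R b)) (at h)" for y h
  proof -
    have "((\<lambda>h. (y - h *\<^sub>R b) \<bullet> b) has_real_derivative - 1) (at h)"
      using b by (auto intro!: derivative_eq_intros simp: inner_diff_left)
    from DERIV_mult[OF this gauss_density_deriv[OF b, of y h]] show ?thesis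
      by (simp add: power2_eq_square algebra_simps)
  qed
  show "((\<lambda>h. gauss_avg c v (x + h *\<^sub>R b)) has_real_derivative
      (1 / c) * (\<integral>y. v (x + c *\<^sub>R y) * (y \<bullet> b) \<partial>std_gauss)) (at 0)"
    using has_real_derivative_integral_kernel[OF _ _ v r0 r1 gauss_density_deriv[OF b] b c, of x]
    by (simp add: gauss_avg_def integral_std_gauss mult_ac)
  show "((\<lambda>h. \<integral>y. v (x + h *\<^sub>R b + c *\<^sub>R y) * (y \<bullet> b) \<partial>std_gauss) has_real_derivative
      (1 / c) * (\<integral>y. v (x + c *\<^sub>R y) * ((y \<bullet> b)\<^sup>2 - 1) \<partial>std_gauss)) (at 0)"
    using has_real_derivative_integral_kernel[OF _ _ v r1 r2 d2 b c, of x]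
    by (simp add: integral_std_gauss mult_ac)
qed


text \<open>The bound is uniform in r up to s, which provides a dominating function for rescaled
  kernels.\<close>

lemma inverse_jb_scale:
  fixes z :: "'a::euclidean_space"
  assumes r: "0 < r" "r \<le> s"
  shows "1 / jb ((1 / r) *\<^sub>R z) ^ j \<le> jb s ^ j / jb z ^ j"
proof -
  have eq: "r *\<^sub>R (1 / r) *\<^sub>R z = z" using r by simp
  have "jb z \<le> jb r * jb ((1 / r) *\<^sub>R z)"
    using jb_scale_le[of r "(1 / r) *\<^sub>R z"] unfolding eq .
  also have "\<dots> \<le> jb s * jb ((1 / r) *\<^sub>R z)"
    using r by (intro mult_right_mono jb_nonneg) (simp add: jb_def power_mono)
  finally have "jb z ^ j \<le> (jb s * jb ((1 / r) *\<^sub>R z)) ^ j"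
    by (rule power_mono) (rule jb_nonneg)
  then have "jb z ^ j \<le> jb s ^ j * jb ((1 / r) *\<^sub>R z) ^ j"
    unfolding power_mult_distrib .
  then show ?thesis
    using zero_less_power[OF jb_pos[of z], of j] zero_less_power[OF jb_pos[of "(1 / r) *\<^sub>R z"], of j]
    by (simp only: pos_divide_le_eq pos_le_divide_eq mult_1 times_divide_eq_left)
qed

text \<open>Substituting z = c y puts the parameter into the kernel c^(-n) G(z / c), whose
  derivative carries the weight |y|^2 - n. With \<open>gauss_avg_laplace\<close> this becomes the
  heat equation: the derivative in c is c times the Laplacian.\<close>

lemma gauss_avg_param_deriv:
  fixes v :: "'a::euclidean_space \<Rightarrow> real"
  assumes [measurable]: "v \<in> borel_measurable borel"
    and v: "\<And>z. \<bar>v z\<bar> \<le> C * jb z ^ m"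
    and c: "c > 0"
  shows "((\<lambda>r. gauss_avg r v x) has_real_derivative
      (1 / c) * (\<integral>y. v (x + c *\<^sub>R y) * ((norm y)\<^sup>2 - real DIM('a)) \<partial>std_gauss)) (at c)"
proof -
  define n where "n = DIM('a)"
  define A where "A = (2 * jb x * jb (1::real)) ^ m"
  have CA: "C * A \<ge> 0"
    using poly_bound_nonneg[OF v] by (auto simp: A_def jb_nonneg)
  have va: "\<bar>v (x + z)\<bar> \<le> C * A * jb z ^ m" for z
    using poly_bound_affine[OF v, of x 1 z] by (simp add: A_def)
  define k where "k y = ((norm y)\<^sup>2 - real n) * gauss_density y" for y :: 'a
  have k_meas [measurable]: "k \<in> borel_measurable borel" unfolding k_def by measurable
  have k: "rapid k" unfolding k_def
  proof (rule rapid_poly_gauss[of _ "1 + real n" 1])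
    fix y :: 'a
    have "\<bar>(norm y)\<^sup>2 - real n\<bar> \<le> (norm y)\<^sup>2 + real n"
      unfolding abs_le_iff using zero_le_power2[of "norm y"] by linarith
    also have "\<dots> \<le> (1 + real n) * jb y ^ 1"
      by (simp add: jb_def algebra_simps)
    finally show "\<bar>(norm y)\<^sup>2 - real n\<bar> \<le> (1 + real n) * jb y ^ 1" .
  qed
  then obtain D where D: "D \<ge> 0" "\<And>y. \<bar>k y\<bar> \<le> D / jb y ^ (m + n)"
    using rapidE_nonneg by blast
  define F where "F r z = (1 / r) ^ n * gauss_density ((1 / r) *\<^sub>R z) * v (x + z)" for r z
  define F' where "F' r z = (1 / r) ^ Suc n * k ((1 / r) *\<^sub>R z) * v (x + z)" for r z
  have avg: "gauss_avg r v x = (\<integral>z. F r z \<partial>lborel)" if r: "r > 0" for r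
  proof -
    have "(\<integral>z. F r z \<partial>lborel) = r ^ n * (\<integral>z. F r (r *\<^sub>R z) \<partial>lborel)"
      unfolding n_def F_def by (rule integral_lborel_scale) (use r in measurable)
    also have "\<dots> = (\<integral>z. r ^ n * F r (r *\<^sub>R z) \<partial>lborel)"
      by simp
    also have "\<dots> = gauss_avg r v x"
      using r by (simp add: F_def gauss_avg_def integral_std_gauss power_divide)
    finally show ?thesis ..
  qed
  define E where "E = (2 / c) ^ Suc n * (D * jb (2 * c) ^ (m + n)) * (C * A)"
  \<comment> \<open>The window of radius c / 2 keeps r away from 0, so that 1 / r <= 2 / c, and
    below 2 c, as \<open>inverse_jb_scale\<close> requires.\<close>
  have "((\<lambda>r. \<integral>z. F r z \<partial>lborel) has_real_derivative (\<integral>z. F' c z \<partial>lborel)) (at c)"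
  proof (rule deriv_under_integral(2)[of "c / 2"])
    fix r :: real and z :: 'a assume "\<bar>r - c\<bar> < c / 2"
    then have r: "r > c / 2" "r > 0" "r \<le> 2 * c"
      unfolding abs_less_iff using c by linarith+
    have eq: "gauss_density ((1 / r) *\<^sub>R z) =
        exp (- (norm z)\<^sup>2 / 2 * (1 / r)\<^sup>2) * (1 / (2 * pi) powr (real DIM('a) / 2))" for r
    proof -
      have "(norm ((1 / r) *\<^sub>R z))\<^sup>2 = (norm z)\<^sup>2 * (1 / r)\<^sup>2"
        unfolding norm_scaleR power_mult_distrib power2_abs real_norm_def by (rule mult.commute)
      then show ?thesis
        unfolding gauss_density_def by simp
    qed
    have inv: "((\<lambda>r. 1 / r) has_real_derivative - (1 / r)\<^sup>2) (at r)"
      using r by (auto intro!: derivative_eq_intros simp: power2_eq_square)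
    have gd: "((\<lambda>r. gauss_density ((1 / r) *\<^sub>R z)) has_real_derivative
        gauss_density ((1 / r) *\<^sub>R z) * ((norm z)\<^sup>2 * (1 / r) ^ 3)) (at r)"
      unfolding eq
      by (rule DERIV_cong[OF DERIV_cmult_right[OF DERIV_fun_exp[OF DERIV_cmult[OF DERIV_power[OF inv]]]]])
        (simp add: power2_eq_square power3_eq_cube)
    have pw: "((\<lambda>r. (1 / r) ^ n) has_real_derivative - real n * (1 / r) ^ Suc n) (at r)"
    proof -
      obtain l where l: "n = Suc l" unfolding n_def using DIM_positive not0_implies_Suc by blast
      have "real (Suc l) * (- (q\<^sup>2) * q ^ (Suc l - Suc 0)) = - real (Suc l) * q ^ Suc (Suc l)" for q :: real
        by (simp add: power2_eq_square algebra_simps)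
      then show ?thesis
        unfolding l by (rule DERIV_cong[OF DERIV_power[OF inv]])
    qed
    have alg: "- real n * q ^ Suc n * G + G * (N * q ^ 3) * q ^ n = q ^ Suc n * ((N * q\<^sup>2 - real n) * G)"
      for q G N :: real
      by (simp add: power2_eq_square power3_eq_cube algebra_simps)
    have nz: "(norm ((1 / r) *\<^sub>R z))\<^sup>2 = (norm z)\<^sup>2 * (1 / r)\<^sup>2"
      unfolding norm_scaleR power_mult_distrib power2_abs real_norm_def by (rule mult.commute)
    have "((\<lambda>r. (1 / r) ^ n * gauss_density ((1 / r) *\<^sub>R z)) has_real_derivative
        (1 / r) ^ Suc n * k ((1 / r) *\<^sub>R z)) (at r)"
      unfolding k_def nz by (rule DERIV_cong[OF DERIV_mult[OF pw gd]]) (rule alg)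
    from DERIV_cmult_right[OF this, of "v (x + z)"]
    show "((\<lambda>r. F r z) has_real_derivative F' r z) (at r)"
      by (simp add: F_def F'_def)
    have "\<bar>k ((1 / r) *\<^sub>R z)\<bar> \<le> D * (1 / jb ((1 / r) *\<^sub>R z) ^ (m + n))"
      using D(2) by simp
    also have "\<dots> \<le> D * (jb (2 * c) ^ (m + n) / jb z ^ (m + n))"
      using r by (intro mult_left_mono inverse_jb_scale D)
    finally have kb: "\<bar>k ((1 / r) *\<^sub>R z)\<bar> \<le> D * (jb (2 * c) ^ (m + n) / jb z ^ (m + n))" .
    have "1 / r \<le> 2 / c" using r c by (simp add: field_simps)
    then have "(1 / r) ^ Suc n \<le> (2 / c) ^ Suc n"
      using r by (intro power_mono) auto
    then have "\<bar>F' r z\<bar> \<le> (2 / c) ^ Suc n * (D * (jb (2 * c) ^ (m + n) / jb z ^ (m + n))) * (C * A * jb z ^ m)"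
      unfolding F'_def abs_mult using r c va CA kb D
      by (intro mult_mono) (auto simp: power_one_over jb_nonneg power_divide simp del: power_Suc)
    also have "\<dots> = E * (1 / jb z ^ n)"
      using jb_pos[of z] by (simp add: E_def power_add field_simps)
    finally show "\<bar>F' r z\<bar> \<le> E * (1 / jb z ^ n)" .
  next
    fix r :: real assume "\<bar>r - c\<bar> < c / 2"
    then have r: "r > 0" "r \<le> 2 * c"
      unfolding abs_less_iff using c by linarith+
    have "rapid (\<lambda>z::'a. gauss_density ((1 / r) *\<^sub>R z))"
      unfolding rapid_def
    proof
      fix j
      have "rapid (gauss_density :: 'a \<Rightarrow> real)"
        using rapid_poly_gauss[of "\<lambda>_. 1" 1 0] by simp
      then obtain D where D: "D \<ge> 0" "\<And>y::'a. \<bar>gauss_density y\<bar> \<le> D / jb y ^ j"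
        using rapidE_nonneg by blast
      have "\<bar>gauss_density ((1 / r) *\<^sub>R z)\<bar> \<le> (D * jb (2 * c) ^ j) / jb z ^ j" for z :: 'a
      proof -
        have "\<bar>gauss_density ((1 / r) *\<^sub>R z)\<bar> \<le> D * (1 / jb ((1 / r) *\<^sub>R z) ^ j)"
          using D(2) by simp
        also have "\<dots> \<le> D * (jb (2 * c) ^ j / jb z ^ j)"
          using r by (intro mult_left_mono inverse_jb_scale D)
        finally show ?thesis by simp
      qed
      then show "\<exists>D. \<forall>z. \<bar>gauss_density ((1 / r) *\<^sub>R z :: 'a)\<bar> \<le> D / jb z ^ j" by blast
    qed
    then have "integrable lborel (\<lambda>z. gauss_density ((1 / r) *\<^sub>R z) * v (x + z))"
      by (rule integrable_rapid_poly[OF _ _ va, rotated 2]) measurable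
    then show "integrable lborel (F r)"
      unfolding F_def mult.assoc by (rule integrable_mult_right)
  next
    show "integrable lborel (\<lambda>z::'a. E * (1 / jb z ^ n))"
      unfolding n_def by (intro integrable_mult_right integrable_inverse_jb)
  qed (use c in simp)
  moreover have "\<forall>\<^sub>F r in nhds c. gauss_avg r v x = (\<integral>z. F r z \<partial>lborel)"
    using c avg eventually_nhds_in_open[of "{0<..}" c] by (auto elim: eventually_mono)
  ultimately have "((\<lambda>r. gauss_avg r v x) has_real_derivative (\<integral>z. F' c z \<partial>lborel)) (at c)"
    by (subst DERIV_cong_ev[OF refl _ refl])
  moreover have "(\<integral>z. F' c z \<partial>lborel) =
      (1 / c) * (\<integral>y. v (x + c *\<^sub>R y) * ((norm y)\<^sup>2 - real n) \<partial>std_gauss)"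
  proof -
    have "(\<integral>z. F' c z \<partial>lborel) = c ^ n * (\<integral>z. F' c (c *\<^sub>R z) \<partial>lborel)"
      unfolding n_def F'_def by (rule integral_lborel_scale) (use c in measurable)
    also have "\<dots> = (\<integral>z. c ^ n * F' c (c *\<^sub>R z) \<partial>lborel)"
      by simp
    also have "\<dots> = (\<integral>y. (1 / c) * (gauss_density y * (v (x + c *\<^sub>R y) * ((norm y)\<^sup>2 - real n))) \<partial>lborel)"
      using c by (intro lint_cong) (auto simp: F'_def k_def field_simps)
    also have "\<dots> = (1 / c) * (\<integral>y. v (x + c *\<^sub>R y) * ((norm y)\<^sup>2 - real n) \<partial>std_gauss)"
      by (simp add: integral_std_gauss)
    finally show ?thesis .
  qed
  ultimately show ?thesis by (simp add: n_def)
qed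

text \<open>|y|^2 - DIM is the sum of the Hermite polynomials y_b^2 - 1; this identifies the
  derivative in the parameter with the Laplacian, up to the factor c.\<close>

lemma gauss_avg_laplace:
  fixes v :: "'a::euclidean_space \<Rightarrow> real"
  assumes [measurable]: "v \<in> borel_measurable borel"
    and v: "\<And>z. \<bar>v z\<bar> \<le> C * jb z ^ m"
  shows "(\<Sum>b\<in>Basis. \<integral>y. v (x + c *\<^sub>R y) * ((y \<bullet> b)\<^sup>2 - 1) \<partial>std_gauss) =
    (\<integral>y. v (x + c *\<^sub>R y) * ((norm y)\<^sup>2 - real DIM('a)) \<partial>std_gauss)"
proof -
  have int: "integrable std_gauss (\<lambda>y. v (x + c *\<^sub>R y) * ((y \<bullet> b)\<^sup>2 - 1))" if b: "b \<in> Basis" for b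
  proof (rule integrable_gauss_avg[OF _ _ v])
    show "\<bar>(y \<bullet> b)\<^sup>2 - 1\<bar> \<le> 1 * jb y ^ 1" for y
      using inner_Basis_sq_le_jb[OF b, of y] jb_ge_1[of y] zero_le_power2[of "y \<bullet> b"]
      unfolding abs_le_iff power_one_right by linarith
  qed measurable
  have "(norm y)\<^sup>2 - real DIM('a) = (\<Sum>b\<in>Basis. (y \<bullet> b)\<^sup>2 - 1)" for y :: 'a
    unfolding power2_norm_eq_inner euclidean_inner[of y y] by (simp add: sum_subtractf power2_eq_square)
  then have "v (x + c *\<^sub>R y) * ((norm y)\<^sup>2 - real DIM('a)) =
      (\<Sum>b\<in>Basis. v (x + c *\<^sub>R y) * ((y \<bullet> b)\<^sup>2 - 1))" for y
    by (simp only: sum_distrib_left)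
  then show ?thesis
    using Bochner_Integration.integral_sum[of Basis std_gauss "\<lambda>b y. v (x + c *\<^sub>R y) * ((y \<bullet> b)\<^sup>2 - 1)", OF int]
    by simp
qed

section \<open>A maximum principle for the heat flow\<close>

text \<open>A relation instead of the total operator \<open>partial\<close>, so that existence
  everywhere and the value of the derivative travel together. \<open>has_pderiv_iff\<close> connects
  the two.\<close>

definition has_pderiv :: "'a::euclidean_space \<Rightarrow> ('a \<Rightarrow> real) \<Rightarrow> ('a \<Rightarrow> real) \<Rightarrow> bool" where
  "has_pderiv b f f' \<longleftrightarrow> (\<forall>x. ((\<lambda>h. f (x + h *\<^sub>R b)) has_real_derivative f' x) (at 0))"

lemma has_pderivD:
  assumes "has_pderiv b f f'"
  shows "((\<lambda>h. f (x + h *\<^sub>R b)) has_real_derivative f' (x + t *\<^sub>R b)) (at t)"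
proof -
  have "((\<lambda>h. f ((x + t *\<^sub>R b) + h *\<^sub>R b)) has_real_derivative f' (x + t *\<^sub>R b)) (at 0)"
    using assms unfolding has_pderiv_def by blast
  moreover have "(\<lambda>h. f ((x + t *\<^sub>R b) + h *\<^sub>R b)) = (\<lambda>h. (\<lambda>h. f (x + h *\<^sub>R b)) (h + t))"
    by (simp add: scaleR_add_left add_ac)
  ultimately show ?thesis
    using DERIV_shift[of "\<lambda>h. f (x + h *\<^sub>R b)" "f' (x + t *\<^sub>R b)" 0 t] by simp
qed

text \<open>f' need not be differentiable off 0. If l > 0, then f' is positive just to the right of
  0, because f' 0 = 0, and the mean value theorem makes f larger than f 0 there.\<close>

lemma second_deriv_le_0_at_max:
  fixes f f' :: "real \<Rightarrow> real"
  assumes f: "\<And>h. (f has_real_derivative f' h) (at h)" and f': "(f' has_real_derivative l) (at 0)"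
    and max: "\<And>h. f h \<le> f 0"
  shows "l \<le> 0"
proof (rule ccontr)
  assume "\<not> l \<le> 0"
  then have "l > 0" by simp
  have f'0: "f' 0 = 0"
    using DERIV_local_max[OF f[of 0], of 1] max by simp
  obtain d where d: "d > 0" "\<And>h. 0 < h \<Longrightarrow> h < d \<Longrightarrow> f' 0 < f' (0 + h)"
    using DERIV_pos_inc_right[OF f' \<open>l > 0\<close>] by blast
  obtain z where z: "0 < z" "z < d / 2" "f (d / 2) - f 0 = (d / 2 - 0) * f' z"
    using MVT2[of 0 "d / 2" f f'] f d(1) by auto
  have "f' z > 0" using d(2)[of z] z d(1) f'0 by simp
  then have "0 < (d / 2 - 0) * f' z" using d(1) by simp
  with z(3) have "f (d / 2) > f 0" by linarith
  with max[of "d / 2"] show False by linarith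
qed

section \<open>The weight N = 1 / jb^n and its second derivatives\<close>

lemma jb_partial_deriv:
  assumes b: "b \<in> Basis"
  shows "((\<lambda>h. jb (x + h *\<^sub>R b)) has_real_derivative 2 * ((x + t *\<^sub>R b) \<bullet> b)) (at t)"
proof -
  have "jb (x + h *\<^sub>R b) = jb x + 2 * h * (x \<bullet> b) + h\<^sup>2" for h
    unfolding jb_def power2_norm_eq_inner using b
    by (simp add: inner_add_left inner_add_right inner_commute power2_eq_square algebra_simps)
  then show ?thesis
    using b by (auto intro!: derivative_eq_intros simp: inner_add_left)
qed

lemma weight_partial_derivs:
  fixes n :: nat
  assumes b: "b \<in> Basis"
  shows "has_pderiv b (\<lambda>x. 1 / jb x ^ n) (\<lambda>x. - 2 * real n * (x \<bullet> b) / jb x ^ Suc n)"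
    and "has_pderiv b (\<lambda>x. - 2 * real n * (x \<bullet> b) / jb x ^ Suc n)
      (\<lambda>x. 4 * real n * real (Suc n) * (x \<bullet> b)\<^sup>2 / jb x ^ (n + 2) - 2 * real n / jb x ^ Suc n)"
proof -
  have inv: "((\<lambda>h. 1 / jb (x + h *\<^sub>R b) ^ m) has_real_derivative
      - 2 * real m * (x \<bullet> b) / jb x ^ Suc m) (at 0)" for x m
  proof -
    have "((\<lambda>h. inverse (jb (x + h *\<^sub>R b)) ^ m) has_real_derivative
        of_nat m * (- (inverse (jb x) * (2 * (x \<bullet> b)) * inverse (jb x)) * inverse (jb x) ^ (m - Suc 0))) (at 0)"
      using DERIV_power[OF DERIV_inverse'[OF jb_partial_deriv[OF b, of x 0]], of m]
        jb_pos[of x] by simp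
    moreover have "of_nat m * (- (i * y * i) * i ^ (m - Suc 0)) = - real m * y * i ^ Suc m" for i y :: real
      by (cases m) (simp_all add: algebra_simps)
    ultimately have "((\<lambda>h. inverse (jb (x + h *\<^sub>R b)) ^ m) has_real_derivative
        - real m * (2 * (x \<bullet> b)) * inverse (jb x) ^ Suc m) (at 0)"
      by (simp only:)
    then show ?thesis
      by (simp add: inverse_eq_divide power_divide field_simps del: power_Suc)
  qed
  show "has_pderiv b (\<lambda>x. 1 / jb x ^ n) (\<lambda>x. - 2 * real n * (x \<bullet> b) / jb x ^ Suc n)"
    unfolding has_pderiv_def using inv by blast
  show "has_pderiv b (\<lambda>x. - 2 * real n * (x \<bullet> b) / jb x ^ Suc n)
      (\<lambda>x. 4 * real n * real (Suc n) * (x \<bullet> b)\<^sup>2 / jb x ^ (n + 2) - 2 * real n / jb x ^ Suc n)"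
    unfolding has_pderiv_def
  proof
    fix x
    have "((\<lambda>h. - 2 * real n * ((x + h *\<^sub>R b) \<bullet> b)) has_real_derivative - 2 * real n) (at 0)"
      using b by (auto intro!: derivative_eq_intros simp: inner_add_left)
    from DERIV_mult[OF this inv[of x "Suc n"]]
    show "((\<lambda>h. - 2 * real n * ((x + h *\<^sub>R b) \<bullet> b) / jb (x + h *\<^sub>R b) ^ Suc n) has_real_derivative
        4 * real n * real (Suc n) * (x \<bullet> b)\<^sup>2 / jb x ^ (n + 2) - 2 * real n / jb x ^ Suc n) (at 0)"
      by (simp add: power2_eq_square mult_ac del: of_nat_Suc)
  qed
qed

text \<open>The negative term is dropped and (x . b)^2 <= jb x * jb x is inserted. Summed over the
  basis with n = DIM, the Laplacian of N is at most 4 n n (n + 1) N: the constant in the smallness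
  condition on \<open>T\<close> below.\<close>

lemma weight_second_deriv_le:
  fixes x b :: "'a::euclidean_space"
  assumes b: "b \<in> Basis"
  shows "4 * real n * real (Suc n) * (x \<bullet> b)\<^sup>2 / jb x ^ (n + 2) - 2 * real n / jb x ^ Suc n
    \<le> 4 * real n * real (Suc n) * (1 / jb x ^ n)"
proof -
  have "(x \<bullet> b)\<^sup>2 \<le> jb x * jb x"
    using mult_left_mono[OF jb_ge_1[of x] jb_nonneg[of x]]
      inner_Basis_sq_le_jb[OF b, of x] by linarith
  then have "(x \<bullet> b)\<^sup>2 / (jb x * jb x) \<le> 1"
    using jb_pos[of x] by simp
  then have "(4 * real n * real (Suc n) * (1 / jb x ^ n)) * ((x \<bullet> b)\<^sup>2 / (jb x * jb x))
      \<le> 4 * real n * real (Suc n) * (1 / jb x ^ n) * 1"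
    using jb_pos[of x] by (intro mult_left_mono) auto
  moreover have "(4 * real n * real (Suc n) * (1 / jb x ^ n)) * ((x \<bullet> b)\<^sup>2 / (jb x * jb x))
      = 4 * real n * real (Suc n) * (x \<bullet> b)\<^sup>2 / jb x ^ (n + 2)"
    by (simp add: power_add power2_eq_square mult_ac)
  moreover have "2 * real n / jb x ^ Suc n \<ge> 0"
    using jb_pos[of x] by simp
  ultimately show ?thesis by linarith
qed

text \<open>Joint continuity, r = 0 included, is what lets the comparison function attain its
  maximum on a compact set that contains the initial time.\<close>

lemma gauss_avg_continuous:
  fixes g :: "'a::euclidean_space \<Rightarrow> real"
  assumes cont: "continuous_on UNIV g" and bd: "\<And>x. \<bar>g x\<bar> \<le> A"
  shows "continuous_on UNIV (\<lambda>p. gauss_avg (fst p) g (snd p))"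
  unfolding continuous_on_sequentially
proof (intro ballI allI impI, elim conjE)
  interpret prob_space "std_gauss :: 'a measure" by (rule prob_space_std_gauss)
  have [measurable]: "g \<in> borel_measurable borel"
    using cont by (simp add: borel_measurable_continuous_onI)
  fix X :: "nat \<Rightarrow> real \<times> 'a" and a
  assume "X \<longlonglongrightarrow> a"
  have "(\<lambda>n. \<integral>y. g (snd (X n) + fst (X n) *\<^sub>R y) \<partial>std_gauss) \<longlonglongrightarrow> (\<integral>y. g (snd a + fst a *\<^sub>R y) \<partial>std_gauss)"
  proof (rule integral_dominated_convergence[where w = "\<lambda>_. A"])
    show "AE y in std_gauss. (\<lambda>n. g (snd (X n) + fst (X n) *\<^sub>R y)) \<longlonglongrightarrow> g (snd a + fst a *\<^sub>R y)"
    proof (rule AE_I2)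
      fix y
      have "isCont g (snd a + fst a *\<^sub>R y)"
        using cont by (simp add: continuous_on_eq_continuous_at)
      then show "(\<lambda>n. g (snd (X n) + fst (X n) *\<^sub>R y)) \<longlonglongrightarrow> g (snd a + fst a *\<^sub>R y)"
        by (rule isCont_tendsto_compose) (intro tendsto_intros \<open>X \<longlonglongrightarrow> a\<close>)
    qed
  qed (use bd in auto)
  then show "((\<lambda>p. gauss_avg (fst p) g (snd p)) \<circ> X) \<longlonglongrightarrow> gauss_avg (fst a) g (snd a)"
    by (simp add: gauss_avg_def o_def)
qed

text \<open>One constant serves all r up to T; this prevents the maximum in the comparison argument
  from escaping to infinity.\<close>

lemma gauss_avg_decay:
  fixes g :: "'a::euclidean_space \<Rightarrow> real"
  assumes [measurable]: "g \<in> borel_measurable borel" and bd: "\<And>x. \<bar>g x\<bar> \<le> A / jb x ^ n"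
  obtains B where "B \<ge> 0" "\<And>r x. 0 \<le> r \<Longrightarrow> r \<le> T \<Longrightarrow> \<bar>gauss_avg r g x\<bar> \<le> B / jb x ^ n"
proof
  have A: "A \<ge> 0" using order.trans[OF abs_ge_zero bd[of 0]] by (simp add: jb_def)
  define M where "M = (\<integral>(y::'a). jb y ^ n \<partial>std_gauss)"
  have int: "integrable std_gauss (\<lambda>y::'a. jb y ^ n)"
    by (rule integrable_std_gauss_poly[of _ 1 n]) (auto simp: jb_nonneg)
  have M: "M \<ge> 0" unfolding M_def by (intro integral_nonneg_AE) (simp add: jb_nonneg)
  show "A * (2 * jb T) ^ n * M \<ge> 0"
    using A M by (simp add: jb_nonneg)
  fix r x assume r: "0 \<le> r" "r \<le> T"
  have bd2: "\<bar>g (x + r *\<^sub>R y)\<bar> \<le> A * (2 * jb T) ^ n / jb x ^ n * jb y ^ n" for y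
  proof -
    have "\<bar>g (x + r *\<^sub>R y)\<bar> \<le> A * (1 / jb (x - (- (r *\<^sub>R y))) ^ n)"
      using bd[of "x + r *\<^sub>R y"] by simp
    also have "\<dots> \<le> A * ((2 * jb (- (r *\<^sub>R y))) ^ n / jb x ^ n)"
      by (intro mult_left_mono A inverse_jb_shift)
    also have "jb (- (r *\<^sub>R y)) \<le> jb T * jb y"
    proof -
      have "jb (r *\<^sub>R y) \<le> jb r * jb y" by (rule jb_scale_le)
      also have "\<dots> \<le> jb T * jb y"
        using r by (intro mult_right_mono jb_nonneg) (simp add: jb_def power_mono)
      finally show ?thesis by simp
    qed
    then have "A * ((2 * jb (- (r *\<^sub>R y))) ^ n / jb x ^ n) \<le> A * ((2 * (jb T * jb y)) ^ n / jb x ^ n)"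
      by (intro mult_left_mono divide_right_mono power_mono A) (auto simp: jb_nonneg)
    finally show ?thesis by (simp add: power_mult_distrib mult_ac)
  qed
  have "\<bar>gauss_avg r g x\<bar> \<le> (\<integral>y. \<bar>g (x + r *\<^sub>R y)\<bar> \<partial>std_gauss)"
    unfolding gauss_avg_def by (rule integral_abs_bound)
  also have "\<dots> \<le> (\<integral>(y::'a). A * (2 * jb T) ^ n / jb x ^ n * jb y ^ n \<partial>std_gauss)"
  proof (rule lint_mono[OF _ integrable_mult_right[OF int]])
    show "integrable std_gauss (\<lambda>y. \<bar>g (x + r *\<^sub>R y)\<bar>)"
      by (rule integrable_std_gauss_poly[of _ "A * (2 * jb T) ^ n / jb x ^ n" n]) (measurable, simp only: abs_idempotent, rule bd2)
  qed (rule bd2)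
  also have "\<dots> = A * (2 * jb T) ^ n * M / jb x ^ n"
    by (simp add: M_def)
  finally show "\<bar>gauss_avg r g x\<bar> \<le> A * (2 * jb T) ^ n * M / jb x ^ n" .
qed

lemma gauss_avg_0 [simp]: "gauss_avg 0 (g :: 'a::euclidean_space \<Rightarrow> real) x = g x"
proof -
  interpret prob_space "std_gauss :: 'a measure" by (rule prob_space_std_gauss)
  show ?thesis using prob_space by (simp add: gauss_avg_def)
qed

text \<open>At a positive maximum of H the heat equation gives 2 (K + 1) N <= Laplacian of Q_r g.
  The second derivatives in space give Laplacian of Q_r g <= K N + (K + 1) r^2 Laplacian N <= (2 K +
  1) N, the last step by smallness of \<open>T\<close>. The 1 added to K makes the two
  incompatible.\<close>

lemma gauss_avg_minus_le:
  fixes g :: "'a::euclidean_space \<Rightarrow> real" and g1 g2 :: "'a \<Rightarrow> 'a \<Rightarrow> real"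
  defines "n \<equiv> DIM('a)"
  assumes cont: "continuous_on UNIV g" and decay: "\<And>x. \<bar>g x\<bar> \<le> A / jb x ^ n"
    and d1: "\<And>b. b \<in> Basis \<Longrightarrow> has_pderiv b g (g1 b)"
    and d2: "\<And>b. b \<in> Basis \<Longrightarrow> has_pderiv b (g1 b) (g2 b)"
    and lap: "\<And>x. (\<Sum>b\<in>Basis. g2 b x) \<le> K / jb x ^ n"
    and T: "4 * real n * real n * real (Suc n) * T\<^sup>2 \<le> 1"
    and r1: "0 \<le> r1" "r1 \<le> T" and K: "K \<ge> 0"
  shows "gauss_avg r1 g x1 - g x1 \<le> (K + 1) * r1\<^sup>2 / jb x1 ^ n"
proof (rule ccontr)
  define N where "N x = 1 / jb x ^ n" for x :: 'a
  have N: "N x > 0" for x using jb_pos[of x] by (simp add: N_def)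
  have n: "n \<ge> 1" unfolding n_def by (simp add: DIM_positive Suc_leI)
  have [measurable]: "g \<in> borel_measurable borel"
    using cont by (simp add: borel_measurable_continuous_onI)
  have A: "A \<ge> 0" using order.trans[OF abs_ge_zero decay[of 0]] by (simp add: jb_def)
  have bdg: "\<bar>g z\<bar> \<le> A * jb z ^ 0" for z
  proof -
    have "A / jb z ^ n \<le> A / 1"
      using A jb_ge_1[of z] by (intro divide_left_mono) auto
    with decay[of z] show ?thesis by simp
  qed
  define H where "H r x = gauss_avg r g x - g x - (K + 1) * r\<^sup>2 * N x" for r x
  assume "\<not> ?thesis"
  then have pos: "H r1 x1 > 0" by (simp add: H_def N_def)
  obtain B where B: "B \<ge> 0" "\<And>r x. 0 \<le> r \<Longrightarrow> r \<le> T \<Longrightarrow> \<bar>gauss_avg r g x\<bar> \<le> B / jb x ^ n"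
    using gauss_avg_decay[OF _ decay] by auto
  \<comment> \<open>Beyond this radius the decay of g and of its averages forces H below its
    positive value at \<open>(r1, x1)\<close>.\<close>
  define R where "R = (A + B) / H r1 x1"
  have far: "H r x < H r1 x1" if r: "0 \<le> r" "r \<le> T" and x: "norm x > R" for r x
  proof -
    have "(K + 1) * r\<^sup>2 * N x \<ge> 0" using K less_imp_le[OF N[of x]] by simp
    then have "H r x \<le> (A + B) / jb x ^ n"
      using B(2)[OF r, of x] decay[of x] unfolding H_def add_divide_distrib by linarith
    also have "\<dots> \<le> (A + B) / jb x"
      using A B n jb_ge_1[of x] power_increasing[OF n jb_ge_1[of x]]
      by (intro divide_left_mono) auto
    also have "\<dots> < H r1 x1"
    proof -
      have "(A + B) / H r1 x1 < jb x" using x norm_le_jb[of x] by (simp add: R_def)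
      then show ?thesis using pos jb_pos[of x] by (simp add: field_simps)
    qed
    finally show ?thesis .
  qed
  let ?S = "{0..T} \<times> cball (0::'a) R"
  have contH: "continuous_on ?S (\<lambda>p. H (fst p) (snd p))"
    unfolding H_def N_def jb_def
  proof (intro continuous_intros)
    show "continuous_on ?S (\<lambda>p. gauss_avg (fst p) g (snd p))"
      using gauss_avg_continuous[OF cont, of A] bdg by (auto intro: continuous_on_subset)
    show "continuous_on ?S (\<lambda>p. g (snd p))"
      using cont by (rule continuous_on_compose2) (auto intro: continuous_intros)
    show "\<forall>p\<in>?S. (1 + (norm (snd p))\<^sup>2) ^ n \<noteq> 0"
      by (simp add: add_nonneg_eq_0_iff)
  qed
  have x1: "norm x1 \<le> R" using far[OF r1, of x1] by force
  have "(r1, x1) \<in> ?S" using r1 x1 by simp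
  then have "\<exists>p\<in>?S. \<forall>p'\<in>?S. H (fst p') (snd p') \<le> H (fst p) (snd p)"
    by (intro continuous_attains_sup contH compact_Times compact_Icc compact_cball) blast
  then obtain p where p: "p \<in> ?S" "\<And>p'. p' \<in> ?S \<Longrightarrow> H (fst p') (snd p') \<le> H (fst p) (snd p)"
    by blast
  define r x where "r = fst p" and "x = snd p"
  have rx: "0 \<le> r" "r \<le> T" using p(1) by (auto simp: r_def)
  have ge: "H r1 x1 \<le> H r x" using p(2)[OF \<open>(r1, x1) \<in> ?S\<close>] by (simp add: r_def x_def)
  have max: "H r' x' \<le> H r x" if "0 \<le> r'" "r' \<le> T" for r' x'
  proof (cases "norm x' \<le> R")
    case True
    then show ?thesis using p(2)[of "(r', x')"] that by (simp add: r_def x_def)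
  next
    case False
    then show ?thesis using far[OF that, of x'] ge by simp
  qed
  \<comment> \<open>H vanishes at r = 0, so a positive maximum sits at a positive time.\<close>
  have "r \<noteq> 0" using ge pos by (auto simp: H_def)
  then have r: "r > 0" using rx by simp
  define L where "L = (\<integral>y. g (x + r *\<^sub>R y) * ((norm y)\<^sup>2 - real n) \<partial>std_gauss)"
  have time: "2 * (K + 1) * N x \<le> L / r\<^sup>2"
  proof -
    have "((\<lambda>r. H r x) has_real_derivative (1 / r) * L - 2 * (K + 1) * r * N x) (at r)"
      unfolding H_def L_def n_def
      by (auto intro!: derivative_eq_intros gauss_avg_param_deriv[OF _ bdg r])
    \<comment> \<open>The maximum may lie on the boundary r = T, so only earlier times can be
      compared: the derivative is nonnegative, not necessarily zero.\<close>
    then have "0 \<le> (1 / r) * L - 2 * (K + 1) * r * N x"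
    proof (rule contrapos_pp)
      fix D assume "\<not> 0 \<le> (1 / r) * L - 2 * (K + 1) * r * N x"
      then have neg: "(1 / r) * L - 2 * (K + 1) * r * N x < 0" by simp
      show "\<not> ((\<lambda>r. H r x) has_real_derivative (1 / r) * L - 2 * (K + 1) * r * N x) (at r)"
      proof
        assume "((\<lambda>r. H r x) has_real_derivative (1 / r) * L - 2 * (K + 1) * r * N x) (at r)"
        from DERIV_neg_dec_left[OF this neg] obtain d
          where d: "d > 0" "\<And>h. 0 < h \<Longrightarrow> h < d \<Longrightarrow> H r x < H (r - h) x" by blast
        define h where "h = min (d / 2) r"
        have "0 < h" "h < d" "h \<le> r" using d r by (auto simp: h_def)
        then show False using d(2)[of h] max[of "r - h" x] rx by force
      qed
    qed
    then have "2 * (K + 1) * N x * r\<^sup>2 \<le> L"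
      using r by (simp add: field_simps power2_eq_square)
    then show ?thesis using r by (simp add: field_simps)
  qed
  define N2 where "N2 b x = 4 * real n * real (Suc n) * (x \<bullet> b)\<^sup>2 / jb x ^ (n + 2) - 2 * real n / jb x ^ Suc n"
    for b x :: 'a
  have space: "(1 / r\<^sup>2) * (\<integral>y. g (x + r *\<^sub>R y) * ((y \<bullet> b)\<^sup>2 - 1) \<partial>std_gauss) \<le> g2 b x + (K + 1) * r\<^sup>2 * N2 b x"
    if b: "b \<in> Basis" for b
  proof -
    define G1 where "G1 x = (1 / r) * (\<integral>y. g (x + r *\<^sub>R y) * (y \<bullet> b) \<partial>std_gauss)" for x
    define G2 where "G2 x = (1 / r) * ((1 / r) * (\<integral>y. g (x + r *\<^sub>R y) * ((y \<bullet> b)\<^sup>2 - 1) \<partial>std_gauss))" for x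
    define N1 where "N1 x = - 2 * real n * (x \<bullet> b) / jb x ^ Suc n" for x :: 'a
    have G: "has_pderiv b (gauss_avg r g) G1" "has_pderiv b G1 G2"
      unfolding has_pderiv_def G1_def G2_def
      by (intro allI gauss_avg_deriv[OF _ bdg b r] DERIV_cmult gauss_avg_deriv2[OF _ bdg b r]; measurable)+
    have NN: "has_pderiv b N N1" "has_pderiv b N1 (N2 b)"
      using weight_partial_derivs[OF b, of n] by (simp_all add: N_def[abs_def] N1_def[abs_def] N2_def[abs_def])
    have "G2 x - g2 b x - (K + 1) * r\<^sup>2 * N2 b x \<le> 0"
    proof (rule second_deriv_le_0_at_max)
      show "((\<lambda>h. H r (x + h *\<^sub>R b)) has_real_derivative
          (G1 (x + h *\<^sub>R b) - g1 b (x + h *\<^sub>R b) - (K + 1) * r\<^sup>2 * N1 (x + h *\<^sub>R b))) (at h)" for h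
        unfolding H_def
        by (intro DERIV_diff DERIV_cmult has_pderivD G NN d1 b)
      show "((\<lambda>h. G1 (x + h *\<^sub>R b) - g1 b (x + h *\<^sub>R b) - (K + 1) * r\<^sup>2 * N1 (x + h *\<^sub>R b))
          has_real_derivative (G2 x - g2 b x - (K + 1) * r\<^sup>2 * N2 b x)) (at 0)"
        using has_pderivD[OF G(2), of x 0] has_pderivD[OF d2[OF b], of x 0]
          has_pderivD[OF NN(2), of x 0]
        by (intro DERIV_diff DERIV_cmult) simp_all
      show "H r (x + h *\<^sub>R b) \<le> H r (x + 0 *\<^sub>R b)" for h
        using max[of r] rx by simp
    qed
    then show ?thesis by (simp add: G2_def power2_eq_square)
  qed
  have "L / r\<^sup>2 = (\<Sum>b\<in>Basis. (1 / r\<^sup>2) * (\<integral>y. g (x + r *\<^sub>R y) * ((y \<bullet> b)\<^sup>2 - 1) \<partial>std_gauss))"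
    using gauss_avg_laplace[OF _ bdg, of x r] by (simp add: L_def n_def flip: sum_divide_distrib)
  also have "\<dots> \<le> (\<Sum>b\<in>Basis. g2 b x + (K + 1) * r\<^sup>2 * N2 b x)"
    by (rule sum_mono[OF space])
  also have "\<dots> \<le> (\<Sum>b\<in>Basis. g2 b x + (K + 1) * r\<^sup>2 * (4 * real n * real (Suc n) * N x))"
    using weight_second_deriv_le[of _ n x] K
    by (intro sum_mono add_left_mono mult_left_mono) (auto simp: N2_def N_def)
  also have "\<dots> = (\<Sum>b\<in>Basis. g2 b x) + (K + 1) * N x * (4 * real n * real n * real (Suc n) * r\<^sup>2)"
    by (simp add: sum.distrib n_def del: of_nat_Suc)
  also have "\<dots> \<le> K * N x + (K + 1) * N x * 1"
  proof (intro add_mono mult_left_mono)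
    show "(\<Sum>b\<in>Basis. g2 b x) \<le> K * N x" using lap[of x] by (simp add: N_def)
    have "4 * real n * real n * real (Suc n) * r\<^sup>2 \<le> 4 * real n * real n * real (Suc n) * T\<^sup>2"
      using rx by (intro mult_left_mono power_mono) auto
    with T show "4 * real n * real n * real (Suc n) * r\<^sup>2 \<le> 1" by linarith
    show "0 \<le> (K + 1) * N x" using K less_imp_le[OF N[of x]] by simp
  qed
  finally have "2 * (K + 1) * N x \<le> K * N x + (K + 1) * N x" using time by simp
  then have "N x \<le> 0" by (simp add: algebra_simps)
  with N[of x] show False by simp
qed

section \<open>Second differences in mean square\<close>

text \<open>The exponent is that of \<open>integrable_inverse_jb\<close>. The class is closed under
  sums, products and translations, so the integrals of the L^2 argument exist without separate
  estimates.\<close>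

definition decays :: "('a::euclidean_space \<Rightarrow> real) \<Rightarrow> bool" where
  "decays f \<longleftrightarrow> f \<in> borel_measurable borel \<and> (\<exists>A. \<forall>x. \<bar>f x\<bar> \<le> A / jb x ^ DIM('a))"

lemma decays_measurable: "decays f \<Longrightarrow> f \<in> borel_measurable borel"
  by (simp add: decays_def)

lemma decaysI:
  fixes f :: "'a::euclidean_space \<Rightarrow> real"
  shows "f \<in> borel_measurable borel \<Longrightarrow> (\<And>x. \<bar>f x\<bar> \<le> A / jb x ^ DIM('a)) \<Longrightarrow> decays f"
  unfolding decays_def by blast

lemma decays_bound:
  fixes f :: "'a::euclidean_space \<Rightarrow> real"
  assumes "decays f"
  shows "\<exists>A\<ge>0. (\<forall>x. \<bar>f x\<bar> \<le> A / jb x ^ DIM('a)) \<and> (\<forall>x. \<bar>f x\<bar> \<le> A)"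
proof -
  obtain A where A: "\<And>x. \<bar>f x\<bar> \<le> A / jb x ^ DIM('a)"
    using assms unfolding decays_def by blast
  have "A \<ge> 0" using order.trans[OF abs_ge_zero A[of 0]] by (simp add: jb_def)
  moreover have "\<bar>f x\<bar> \<le> A" for x
  proof -
    have "A / jb x ^ DIM('a) \<le> A / 1"
      using \<open>A \<ge> 0\<close> jb_ge_1[of x] by (intro divide_left_mono) auto
    with A[of x] show ?thesis by simp
  qed
  ultimately show ?thesis using A by blast
qed

lemma decays_integrable:
  fixes f :: "'a::euclidean_space \<Rightarrow> real"
  assumes f: "decays f"
  shows "integrable lborel f"
proof -
  obtain A where A: "A \<ge> 0" "\<And>x. \<bar>f x\<bar> \<le> A / jb x ^ DIM('a)" "\<And>x. \<bar>f x\<bar> \<le> A"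
    using decays_bound[OF f] by blast
  show ?thesis by (rule integrable_jb_bound[OF decays_measurable[OF f] A(2)])
qed

lemma decays_mult_bounded:
  fixes f g :: "'a::euclidean_space \<Rightarrow> real"
  assumes f: "decays f" and [measurable]: "g \<in> borel_measurable borel" and g: "\<And>x. \<bar>g x\<bar> \<le> B"
  shows "decays (\<lambda>x. f x * g x)"
proof -
  obtain A where A: "A \<ge> 0" "\<And>x. \<bar>f x\<bar> \<le> A / jb x ^ DIM('a)" "\<And>x. \<bar>f x\<bar> \<le> A"
    using decays_bound[OF f] by blast
  show ?thesis
  proof (rule decaysI)
    show "(\<lambda>x. f x * g x) \<in> borel_measurable borel"
      using decays_measurable[OF f] by measurable
    fix x
    have "\<bar>f x * g x\<bar> \<le> (A / jb x ^ DIM('a)) * B"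
      unfolding abs_mult using A(1,2) g by (intro mult_mono) (auto simp: jb_nonneg)
    then show "\<bar>f x * g x\<bar> \<le> (A * B) / jb x ^ DIM('a)" by simp
  qed
qed

lemma decays_mult:
  fixes f g :: "'a::euclidean_space \<Rightarrow> real"
  assumes f: "decays f" and g: "decays g"
  shows "decays (\<lambda>x. f x * g x)"
proof -
  obtain B where B: "B \<ge> 0" "\<And>x. \<bar>g x\<bar> \<le> B / jb x ^ DIM('a)" "\<And>x. \<bar>g x\<bar> \<le> B"
    using decays_bound[OF g] by blast
  show ?thesis by (rule decays_mult_bounded[OF f decays_measurable[OF g] B(3)])
qed

lemma decays_cmult: "decays f \<Longrightarrow> decays (\<lambda>x. c * f x)"
  using decays_mult_bounded[of f "\<lambda>_. c" "\<bar>c\<bar>"] by (simp add: mult.commute)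

lemma decays_add:
  fixes f g :: "'a::euclidean_space \<Rightarrow> real"
  assumes f: "decays f" and g: "decays g"
  shows "decays (\<lambda>x. f x + g x)"
proof -
  obtain A where A: "A \<ge> 0" "\<And>x. \<bar>f x\<bar> \<le> A / jb x ^ DIM('a)" "\<And>x. \<bar>f x\<bar> \<le> A"
    using decays_bound[OF f] by blast
  obtain B where B: "B \<ge> 0" "\<And>x. \<bar>g x\<bar> \<le> B / jb x ^ DIM('a)" "\<And>x. \<bar>g x\<bar> \<le> B"
    using decays_bound[OF g] by blast
  show ?thesis
  proof (rule decaysI)
    show "(\<lambda>x. f x + g x) \<in> borel_measurable borel"
      using decays_measurable[OF f] decays_measurable[OF g] by measurable
    show "\<bar>f x + g x\<bar> \<le> (A + B) / jb x ^ DIM('a)" for x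
      using A(2)[of x] B(2)[of x] unfolding add_divide_distrib by linarith
  qed
qed

lemma decays_diff: "decays f \<Longrightarrow> decays g \<Longrightarrow> decays (\<lambda>x. f x - g x)"
  using decays_add[of f "\<lambda>x. (-1) * g x"] decays_cmult[of g "-1"] by simp

lemma decays_translate:
  fixes f :: "'a::euclidean_space \<Rightarrow> real"
  assumes f: "decays f"
  shows "decays (\<lambda>x. f (x + z))"
proof -
  obtain A where A: "A \<ge> 0" "\<And>x. \<bar>f x\<bar> \<le> A / jb x ^ DIM('a)" "\<And>x. \<bar>f x\<bar> \<le> A"
    using decays_bound[OF f] by blast
  show ?thesis
  proof (rule decaysI)
    show "(\<lambda>x. f (x + z)) \<in> borel_measurable borel"
      using decays_measurable[OF f] by measurable
    fix x
    have "\<bar>f (x + z)\<bar> \<le> A * (1 / jb (x - (- z)) ^ DIM('a))"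
      using A(2)[of "x + z"] by simp
    also have "\<dots> \<le> A * ((2 * jb (- z)) ^ DIM('a) / jb x ^ DIM('a))"
      by (intro mult_left_mono A(1) inverse_jb_shift)
    finally show "\<bar>f (x + z)\<bar> \<le> (A * (2 * jb (- z)) ^ DIM('a)) / jb x ^ DIM('a)"
      by simp
  qed
qed

text \<open>The squared L^2 distance between \<open>w\<close> and its translate. Its Gaussian mean
  is a Dirichlet form of the heat semigroup, by \<open>displacement_gauss\<close>.\<close>

definition displacement :: "('a::euclidean_space \<Rightarrow> real) \<Rightarrow> 'a \<Rightarrow> real" where
  "displacement w z = (\<integral>x. (w (x + z) - w x)\<^sup>2 \<partial>lborel)"

lemma decays_displacement: "decays w \<Longrightarrow> decays (\<lambda>x. (w (x + z) - w x)\<^sup>2)"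
  unfolding power2_eq_square by (intro decays_mult decays_diff decays_translate)

lemma displacement_nonneg: "0 \<le> displacement w z"
  unfolding displacement_def by (intro integral_nonneg_AE) simp

lemma displacement_measurable [measurable]:
  assumes [measurable]: "w \<in> borel_measurable borel"
  shows "displacement w \<in> borel_measurable borel"
  unfolding displacement_def[abs_def] by measurable

lemma displacement_minus:
  assumes w: "decays w"
  shows "displacement w (- z) = displacement w z"
proof -
  note [measurable] = decays_measurable[OF w]
  have "displacement w (- z) = (\<integral>x. (w ((x + z) + - z) - w (x + z))\<^sup>2 \<partial>lborel)"
    unfolding displacement_def by (rule integral_lborel_translate[symmetric]) measurable
  also have "\<dots> = displacement w z"
    unfolding displacement_def by (simp add: power2_commute)
  finally show ?thesis .
qed

lemma displacement_translate:
  assumes w: "decays w"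
  shows "(\<integral>x. (w (x + y + z) - w (x + y))\<^sup>2 \<partial>lborel) = displacement w z"
proof -
  note [measurable] = decays_measurable[OF w]
  show ?thesis
    unfolding displacement_def
    using integral_lborel_translate[of "\<lambda>x. (w (x + z) - w x)\<^sup>2" y] by simp
qed

lemma displacement_add:
  assumes w: "decays w"
  shows "displacement w (y + z) \<le> 2 * displacement w y + 2 * displacement w z"
proof -
  note [measurable] = decays_measurable[OF w]
  have int: "integrable lborel (\<lambda>x. (w (x + y + z) - w (x + y))\<^sup>2)"
    using decays_integrable[OF decays_translate[OF decays_displacement[OF w, of z], of y]] .
  have int': "integrable lborel (\<lambda>x. (w (x + y) - w x)\<^sup>2)" "integrable lborel (\<lambda>x. (w (x + (y + z)) - w x)\<^sup>2)"
    using decays_integrable[OF decays_displacement[OF w]] by auto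
  have "displacement w (y + z) \<le>
      (\<integral>x. 2 * (w (x + y) - w x)\<^sup>2 + 2 * (w (x + y + z) - w (x + y))\<^sup>2 \<partial>lborel)"
    unfolding displacement_def
  proof (rule lint_mono)
    fix x
    have "(a + b)\<^sup>2 \<le> 2 * a\<^sup>2 + 2 * b\<^sup>2" for a b :: real
      using zero_le_power2[of "a - b"] unfolding power2_sum power2_diff by simp
    from this[of "w (x + y) - w x" "w (x + y + z) - w (x + y)"]
    show "(w (x + (y + z)) - w x)\<^sup>2 \<le> 2 * (w (x + y) - w x)\<^sup>2 + 2 * (w (x + y + z) - w (x + y))\<^sup>2"
      by (simp add: add.assoc)
  qed (use int int' in auto)
  also have "\<dots> = 2 * displacement w y + 2 * displacement w z"
    using int int' displacement_translate[OF w, of y z] by (simp add: displacement_def)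
  finally show ?thesis .
qed

text \<open>The translate by m z is reached in m equal steps; Cauchy-Schwarz over the telescoping
  sum costs the factor m^2. This trades a long displacement for a short one.\<close>

lemma displacement_multiple:
  assumes w: "decays w"
  shows "displacement w (real m *\<^sub>R z) \<le> (real m)\<^sup>2 * displacement w z"
proof -
  have int: "integrable lborel (\<lambda>x. (w (x + real k *\<^sub>R z + z) - w (x + real k *\<^sub>R z))\<^sup>2)" for k
    using decays_integrable[OF decays_translate[OF decays_displacement[OF w, of z], of "real k *\<^sub>R z"]] .
  have "displacement w (real m *\<^sub>R z) \<le>
      (\<integral>x. (\<Sum>k<m. (w (x + real k *\<^sub>R z + z) - w (x + real k *\<^sub>R z))\<^sup>2) * real m \<partial>lborel)"
    unfolding displacement_def
  proof (rule lint_mono)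
    fix x
    have "w (x + real m *\<^sub>R z) - w x = (\<Sum>k<m. w (x + real (Suc k) *\<^sub>R z) - w (x + real k *\<^sub>R z))"
      using sum_lessThan_telescope[of "\<lambda>k. w (x + real k *\<^sub>R z)" m] by simp
    also have "\<dots> = (\<Sum>k<m. w (x + real k *\<^sub>R z + z) - w (x + real k *\<^sub>R z))"
      by (simp add: scaleR_add_left add_ac)
    also have "\<dots>\<^sup>2 \<le> (\<Sum>k<m. (w (x + real k *\<^sub>R z + z) - w (x + real k *\<^sub>R z))\<^sup>2) * card {..<m}"
      by (rule sum_squared_le_sum_of_squares)
    finally show "(w (x + real m *\<^sub>R z) - w x)\<^sup>2 \<le>
        (\<Sum>k<m. (w (x + real k *\<^sub>R z + z) - w (x + real k *\<^sub>R z))\<^sup>2) * real m" by simp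
  qed (use int decays_integrable[OF decays_displacement[OF w]] in auto)
  also have "\<dots> = (\<Sum>k<m. displacement w z) * real m"
    using int displacement_translate[OF w] by simp
  finally show ?thesis by (simp add: power2_eq_square mult_ac)
qed

lemma displacement_expand:
  assumes w: "decays w"
  shows "displacement w z = 2 * (\<integral>x. (w x)\<^sup>2 \<partial>lborel) - 2 * (\<integral>x. w (x + z) * w x \<partial>lborel)"
proof -
  note [measurable] = decays_measurable[OF w]
  have i1: "integrable lborel (\<lambda>x. (w x)\<^sup>2)"
    unfolding power2_eq_square by (intro decays_integrable decays_mult w)
  have i2: "integrable lborel (\<lambda>x. (w (x + z))\<^sup>2)"
    unfolding power2_eq_square by (intro decays_integrable decays_mult decays_translate w)
  have i3: "integrable lborel (\<lambda>x. w (x + z) * w x)"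
    by (intro decays_integrable decays_mult decays_translate w)
  have "displacement w z = (\<integral>x. (w (x + z))\<^sup>2 + (w x)\<^sup>2 - 2 * (w (x + z) * w x) \<partial>lborel)"
    unfolding displacement_def by (simp add: power2_diff mult.assoc)
  also have "\<dots> = (\<integral>x. (w (x + z))\<^sup>2 \<partial>lborel) + (\<integral>x. (w x)\<^sup>2 \<partial>lborel) - 2 * (\<integral>x. w (x + z) * w x \<partial>lborel)"
    using i1 i2 i3 by simp
  also have "(\<integral>x. (w (x + z))\<^sup>2 \<partial>lborel) = (\<integral>x. (w x)\<^sup>2 \<partial>lborel)"
    by (rule integral_lborel_translate) measurable
  finally show ?thesis by simp
qed

text \<open>By \<open>displacement_expand\<close> only the correlation of w with its translate
  depends on y, and Fubini turns its Gaussian mean into the integral of w times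
  \<open>gauss_avg r w\<close>.\<close>

lemma displacement_gauss:
  fixes w :: "'a::euclidean_space \<Rightarrow> real"
  assumes w: "decays w"
  shows "(\<integral>y. displacement w (r *\<^sub>R y) \<partial>std_gauss) = 2 * (\<integral>x. w x * (w x - gauss_avg r w x) \<partial>lborel)"
    and "integrable std_gauss (\<lambda>y. displacement w (r *\<^sub>R y))"
    and "decays (\<lambda>x. w x * gauss_avg r w x)"
proof -
  interpret prob_space "std_gauss :: 'a measure" by (rule prob_space_std_gauss)
  interpret pair_sigma_finite "std_gauss :: 'a measure" "lborel :: 'a measure" ..
  note [measurable] = decays_measurable[OF w]
  obtain A where A: "A \<ge> 0" "\<And>x. \<bar>w x\<bar> \<le> A / jb x ^ DIM('a)" "\<And>x. \<bar>w x\<bar> \<le> A"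
    using decays_bound[OF w] by blast
  let ?f = "\<lambda>(y, x). w (x + r *\<^sub>R y) * w x"
  have iw: "integrable lborel (\<lambda>x. \<bar>w x\<bar>)" using decays_integrable[OF w] by simp
  have int: "integrable lborel (\<lambda>x. w (x + z) * w x)" for z
    by (intro decays_integrable decays_mult decays_translate w)
  have bound: "(\<integral>x. \<bar>w (x + z) * w x\<bar> \<partial>lborel) \<le> A * (\<integral>x. \<bar>w x\<bar> \<partial>lborel)" for z
  proof -
    have "(\<integral>x. \<bar>w (x + z) * w x\<bar> \<partial>lborel) \<le> (\<integral>x. A * \<bar>w x\<bar> \<partial>lborel)"
      using integrable_abs[OF int[of z]] iw A(3)
      by (intro lint_mono) (auto simp: abs_mult mult_right_mono)
    then show ?thesis by simp
  qed
  have int2: "integrable (std_gauss \<Otimes>\<^sub>M lborel) ?f"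
  proof (rule Fubini_integrable)
    show "integrable std_gauss (\<lambda>y. \<integral>x. norm (?f (y, x)) \<partial>lborel)"
      by (rule integrable_const_bound[where B = "A * (\<integral>x. \<bar>w x\<bar> \<partial>lborel)"])
        (use bound in \<open>auto simp: integral_nonneg_AE\<close>)
  qed (use int in auto)
  have "(\<integral>x. (\<integral>y. w (x + r *\<^sub>R y) * w x \<partial>std_gauss) \<partial>lborel) = (\<integral>y. (\<integral>x. w (x + r *\<^sub>R y) * w x \<partial>lborel) \<partial>std_gauss)"
    using Fubini_integral[OF int2] by simp
  then have fub: "(\<integral>x. w x * gauss_avg r w x \<partial>lborel) = (\<integral>y. (\<integral>x. w (x + r *\<^sub>R y) * w x \<partial>lborel) \<partial>std_gauss)"
    by (simp add: gauss_avg_def mult.commute)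
  have i3: "integrable std_gauss (\<lambda>y. \<integral>x. w (x + r *\<^sub>R y) * w x \<partial>lborel)"
    using integrable_fst[OF int2] by simp
  have i1: "integrable lborel (\<lambda>x. (w x)\<^sup>2)"
    unfolding power2_eq_square by (intro decays_integrable decays_mult w)
  show dec: "decays (\<lambda>x. w x * gauss_avg r w x)"
  proof (rule decays_mult_bounded[OF w])
    show "gauss_avg r w \<in> borel_measurable borel"
      unfolding gauss_avg_def[abs_def] by measurable
    show "\<bar>gauss_avg r w x\<bar> \<le> A" for x
    proof -
      have "\<bar>gauss_avg r w x\<bar> \<le> (\<integral>y. \<bar>w (x + r *\<^sub>R y)\<bar> \<partial>std_gauss)"
        unfolding gauss_avg_def by (rule integral_abs_bound)
      also have "\<dots> \<le> (\<integral>(y::'a). A \<partial>std_gauss)"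
        by (rule lint_mono)
          (auto intro!: A(3) integrable_const_bound[where B = A])
      also have "\<dots> = A" using prob_space by simp
      finally show ?thesis .
    qed
  qed
  show "integrable std_gauss (\<lambda>y. displacement w (r *\<^sub>R y))"
    unfolding displacement_expand[OF w] using i3 by simp
  have "(\<integral>y. displacement w (r *\<^sub>R y) \<partial>std_gauss) = 2 * (\<integral>x. (w x)\<^sup>2 \<partial>lborel) - 2 * (\<integral>x. w x * gauss_avg r w x \<partial>lborel)"
    unfolding displacement_expand[OF w] fub using i3 prob_space by simp
  also have "\<dots> = 2 * (\<integral>x. w x * (w x - gauss_avg r w x) \<partial>lborel)"
    using i1 decays_integrable[OF dec] by (simp add: right_diff_distrib power2_eq_square)
  finally show "(\<integral>y. displacement w (r *\<^sub>R y) \<partial>std_gauss) = 2 * (\<integral>x. w x * (w x - gauss_avg r w x) \<partial>lborel)" .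
qed

text \<open>Squaring the density doubles its exponent, and |y|^2 <= 2 |y - z|^2 + 2 |z|^2 loses just
  that factor. So all translates of the square by at most one unit lie below one multiple of the
  density.\<close>

lemma gauss_density_sq_shift:
  fixes y z :: "'a::euclidean_space"
  assumes z: "norm z \<le> 1"
  shows "(gauss_density (y - z))\<^sup>2 \<le> exp 1 / (2 * pi) powr (real DIM('a) / 2) * gauss_density y"
proof -
  define k where "k = (2 * pi) powr (real DIM('a) / 2)"
  have k: "k > 0" by (simp add: k_def)
  have "(norm y)\<^sup>2 \<le> 2 * (norm (y - z))\<^sup>2 + 2 * (norm z)\<^sup>2"
    using norm_add_sq_le[of "y - z" z] by simp
  moreover have "(norm z)\<^sup>2 \<le> 1"
    using power_mono[OF z, of 2] by simp
  ultimately have "- (norm (y - z))\<^sup>2 \<le> 1 - (norm y)\<^sup>2 / 2"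
    by simp
  then have "exp (- (norm (y - z))\<^sup>2) \<le> exp 1 * exp (- (norm y)\<^sup>2 / 2)"
    by (simp flip: exp_add)
  moreover have "(gauss_density (y - z))\<^sup>2 = exp (- (norm (y - z))\<^sup>2) / k\<^sup>2"
    by (simp add: gauss_density_def k_def power_divide power2_eq_square flip: exp_add)
  moreover have "exp 1 / k * gauss_density y = exp 1 * exp (- (norm y)\<^sup>2 / 2) / k\<^sup>2"
    by (simp add: gauss_density_def k_def power2_eq_square)
  ultimately show ?thesis
    using k by (simp add: divide_right_mono flip: k_def)
qed

text \<open>A mean over y has to control the single point y = b, which is a null set. Writing b = (y
  + b/2) - (y - b/2) bounds the displacement along b by those along y + b/2 and y - b/2, for every
  y; integration against the squared density keeps these below the Gaussian mean. It is essential
  that \<open>C\<close> depends neither on w nor on h.\<close>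

lemma displacement_le_gauss:
  fixes b :: "'a::euclidean_space"
  assumes b: "b \<in> Basis"
  obtains C where "C \<ge> 0"
    "\<And>w h. decays w \<Longrightarrow> displacement w (h *\<^sub>R b) \<le> C * (\<integral>y. displacement w (h *\<^sub>R y) \<partial>std_gauss)"
proof -
  define E where "E y = (gauss_density y)\<^sup>2" for y :: 'a
  define k where "k = exp 1 / (2 * pi) powr (real DIM('a) / 2)"
  have k: "k > 0" by (simp add: k_def)
  have Em [measurable]: "E \<in> borel_measurable borel" unfolding E_def by measurable
  have Ek: "E (y - z) \<le> k * gauss_density y" if "norm z \<le> 1" for y z
    using gauss_density_sq_shift[OF that] by (simp add: E_def k_def)
  have Epos: "E y > 0" for y using gauss_density_pos[of y] by (simp add: E_def)
  have intg: "integrable lborel (gauss_density :: 'a \<Rightarrow> real)"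
    using integrable_std_gauss_poly[of "\<lambda>_::'a. 1" 1 0] by (simp add: integrable_std_gauss)
  have intE: "integrable lborel E"
  proof (rule Bochner_Integration.integrable_bound[of _ "\<lambda>y. k * gauss_density y"])
    show "AE y in lborel. norm (E y) \<le> norm (k * gauss_density y)"
      using Ek[of 0] Epos k gauss_density_pos by (intro AE_I2) (simp add: abs_mult abs_of_pos abs_of_pos[OF gauss_density_pos])
  qed (use intg in auto)
  define M where "M = (\<integral>y. E y \<partial>lborel)"
  have "M \<noteq> 0"
  proof
    assume "M = 0"
    then have "AE y in lborel. E y = 0"
      using integral_nonneg_eq_0_iff_AE[OF intE] Epos by (simp add: M_def less_imp_le)
    then have "AE y in (lborel :: 'a measure). False"
      using Epos by (auto simp: less_le)
    then show False
      using AE_iff_measurable[of UNIV "lborel :: 'a measure" "\<lambda>_. False"] by simp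
  qed
  then have M: "M > 0"
    unfolding M_def using Epos by (simp add: less_le integral_nonneg_AE)
  show thesis
  proof
    \<comment> \<open>The 4 collects the coefficients of the two shifted displacements, k compares
      the translated weight with the density, and M is the mass of the weight
      \<open>E\<close>.\<close>
    show "4 * k / M \<ge> 0" using k M by simp
    fix w :: "'a \<Rightarrow> real" and h assume w: "decays w"
    note [measurable] = decays_measurable[OF w]
    define D where "D y = displacement w (h *\<^sub>R y)" for y
    have Dm [measurable]: "D \<in> borel_measurable borel"
      unfolding D_def by measurable
    have D0: "D y \<ge> 0" for y by (simp add: D_def displacement_nonneg)
    have intD: "integrable lborel (\<lambda>y. gauss_density y * D y)"
      using displacement_gauss(2)[OF w, of h] by (simp add: integrable_std_gauss D_def[symmetric])
    have ED: "integrable lborel (\<lambda>y. E y * D (y + z))"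
        "(\<integral>y. E y * D (y + z) \<partial>lborel) \<le> k * (\<integral>y. D y \<partial>std_gauss)"
      if z: "norm z \<le> 1" for z
    proof -
      have le: "E (y - z) * D y \<le> k * (gauss_density y * D y)" for y
        using mult_right_mono[OF Ek[OF z] D0[of y]] by (simp add: mult.assoc)
      have i: "integrable lborel (\<lambda>y. E (y - z) * D y)"
      proof (rule Bochner_Integration.integrable_bound)
        show "integrable lborel (\<lambda>y. k * (gauss_density y * D y))" using intD by simp
        show "AE y in lborel. norm (E (y - z) * D y) \<le> norm (k * (gauss_density y * D y))"
          using le D0 Epos by (auto simp: less_imp_le intro!: order.trans[OF le] abs_ge_self)
      qed measurable
      have "integrable lborel (\<lambda>y. E ((y + z) - z) * D (y + z))"
        using i integrable_lborel_translate[of "\<lambda>y. E (y - z) * D y" z] by simp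
      then show "integrable lborel (\<lambda>y. E y * D (y + z))" by simp
      have "(\<integral>y. E y * D (y + z) \<partial>lborel) = (\<integral>y. E ((y + z) - z) * D (y + z) \<partial>lborel)" by simp
      also have "\<dots> = (\<integral>y. E (y - z) * D y \<partial>lborel)"
        by (rule integral_lborel_translate) measurable
      also have "\<dots> \<le> (\<integral>y. k * (gauss_density y * D y) \<partial>lborel)"
        using i intD le by (intro lint_mono) auto
      also have "\<dots> = k * (\<integral>y. D y \<partial>std_gauss)"
        by (simp add: integral_std_gauss)
      finally show "(\<integral>y. E y * D (y + z) \<partial>lborel) \<le> k * (\<integral>y. D y \<partial>std_gauss)" .
    qed
    define z where "z = (1/2) *\<^sub>R b"
    have z: "norm z \<le> 1" "norm (- z) \<le> 1" using b by (simp_all add: z_def)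
    have le: "D b \<le> 2 * D (y + z) + 2 * D (y + - z)" for y
    proof -
      have "(y + z) - (y + - z) = b" by (simp add: z_def flip: scaleR_add_left)
      then have "h *\<^sub>R b = h *\<^sub>R (y + z) + - (h *\<^sub>R (y + - z))"
        by (metis diff_conv_add_uminus scaleR_diff_right)
      then show ?thesis
        unfolding D_def using displacement_add[OF w, of "h *\<^sub>R (y + z)" "- (h *\<^sub>R (y + - z))"]
          displacement_minus[OF w] by simp
    qed
    have "D b * M = (\<integral>y. E y * D b \<partial>lborel)" by (simp add: M_def)
    also have "\<dots> \<le> (\<integral>y. 2 * (E y * D (y + z)) + 2 * (E y * D (y + - z)) \<partial>lborel)"
    proof (rule lint_mono)
      show "integrable lborel (\<lambda>y. E y * D b)" using intE by simp
      show "integrable lborel (\<lambda>y. 2 * (E y * D (y + z)) + 2 * (E y * D (y + - z)))"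
        using ED(1)[OF z(1)] ED(1)[OF z(2)] by (intro Bochner_Integration.integrable_add integrable_mult_right)
      fix y
      show "E y * D b \<le> 2 * (E y * D (y + z)) + 2 * (E y * D (y + - z))"
        using mult_left_mono[OF le[of y] less_imp_le[OF Epos[of y]]] by (simp add: algebra_simps)
    qed
    also have "\<dots> = 2 * (\<integral>y. E y * D (y + z) \<partial>lborel) + 2 * (\<integral>y. E y * D (y + - z) \<partial>lborel)"
      using ED(1)[OF z(1)] ED(1)[OF z(2)] by (subst Bochner_Integration.integral_add) (auto simp del: add_uminus_conv_diff)
    also have "\<dots> \<le> 4 * k * (\<integral>y. D y \<partial>std_gauss)"
      using ED(2)[OF z(1)] ED(2)[OF z(2)] by linarith
    finally have "D b \<le> 4 * k / M * (\<integral>y. D y \<partial>std_gauss)"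
      using M by (simp add: field_simps)
    then show "displacement w (h *\<^sub>R b) \<le> 4 * k / M * (\<integral>y. displacement w (h *\<^sub>R y) \<partial>std_gauss)"
      by (simp add: D_def)
  qed
qed

lemma gauss_avg_measurable:
  fixes v :: "'a::euclidean_space \<Rightarrow> real"
  assumes [measurable]: "v \<in> borel_measurable borel"
  shows "gauss_avg r v \<in> borel_measurable borel"
proof -
  interpret prob_space "std_gauss :: 'a measure" by (rule prob_space_std_gauss)
  show ?thesis unfolding gauss_avg_def[abs_def] by measurable
qed

lemma second_difference_L2_bound:
  fixes g :: "'a::euclidean_space \<Rightarrow> real"
  assumes g: "decays g" and b: "b \<in> Basis" and T: "T > 0"
    and near: "\<And>r x. 0 \<le> r \<Longrightarrow> r \<le> T \<Longrightarrow> \<bar>g x - gauss_avg r g x\<bar> \<le> K * r\<^sup>2 / jb x ^ DIM('a)"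
  shows "\<exists>X. \<forall>h>0. decays (\<lambda>x. (g (x + h *\<^sub>R b) + g (x - h *\<^sub>R b) - 2 * g x) / h\<^sup>2) \<and>
    (\<integral>x. ((g (x + h *\<^sub>R b) + g (x - h *\<^sub>R b) - 2 * g x) / h\<^sup>2)\<^sup>2 \<partial>lborel) \<le> X"
proof -
  obtain C where C: "C \<ge> 0"
    "\<And>w h. decays w \<Longrightarrow> displacement w (h *\<^sub>R b) \<le> C * (\<integral>y. displacement w (h *\<^sub>R y) \<partial>std_gauss)"
    using displacement_le_gauss[OF b] by metis
  note [measurable] = decays_measurable[OF g]
  define N where "N x = 1 / jb x ^ DIM('a)" for x :: 'a
  have N: "decays N" unfolding N_def by (rule decaysI[of _ 1]) (auto simp: jb_nonneg)
  have N0: "N x \<ge> 0" for x by (simp add: N_def jb_nonneg)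
  have K: "K \<ge> 0"
  proof -
    have "0 \<le> K * T\<^sup>2 / jb (0::'a) ^ DIM('a)"
      using order.trans[OF abs_ge_zero near[of T 0]] T by simp
    then show ?thesis using T by (simp add: jb_def zero_le_mult_iff)
  qed
  define M where "M = (\<integral>x. N x * N x \<partial>lborel)"
  define k where "k = 2 * C * K"
  have k: "k \<ge> 0" using C(1) K by (simp add: k_def)
  have main: "decays S \<and> (\<integral>x. (S x)\<^sup>2 \<partial>lborel) \<le> (k + 1)\<^sup>2 * M"
    if h: "h > 0" and S: "S = (\<lambda>x. (g (x + h *\<^sub>R b) + g (x - h *\<^sub>R b) - 2 * g x) / h\<^sup>2)" for h S
  proof -
    have tr: "decays (\<lambda>x. f (x + h *\<^sub>R b))" "decays (\<lambda>x. f (x - h *\<^sub>R b))" if "decays f" for f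
      using decays_translate[OF that, of "h *\<^sub>R b"] decays_translate[OF that, of "- (h *\<^sub>R b)"] by auto
    have "decays (\<lambda>x. (1 / h\<^sup>2) * (g (x + h *\<^sub>R b) + g (x - h *\<^sub>R b) - 2 * g x))"
      by (intro decays_cmult decays_diff decays_add tr g)
    then have decS: "decays S" by (simp add: S)
    \<comment> \<open>For this w the displacement along h b is exactly h^2 times the squared L^2
      norm of the second quotient S.\<close>
    define w where "w x = (1 / h) * (g (x + h *\<^sub>R b) - g x)" for x
    have w: "decays w" unfolding w_def by (intro decays_cmult decays_diff tr g)
    note [measurable] = decays_measurable[OF w] decays_measurable[OF decS]
    define X where "X = (\<integral>x. (S x)\<^sup>2 \<partial>lborel)"
    have iS2: "integrable lborel (\<lambda>x. (S x)\<^sup>2)"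
      unfolding power2_eq_square by (intro decays_integrable decays_mult decS)
    have "displacement w (h *\<^sub>R b) = (\<integral>x. h\<^sup>2 * (S (x + h *\<^sub>R b))\<^sup>2 \<partial>lborel)"
      unfolding displacement_def
    proof (rule lint_cong[OF refl])
      fix x
      have "w (x + h *\<^sub>R b) - w x = h * S (x + h *\<^sub>R b)"
        using h by (simp add: w_def S field_simps power2_eq_square)
      then show "(w (x + h *\<^sub>R b) - w x)\<^sup>2 = h\<^sup>2 * (S (x + h *\<^sub>R b))\<^sup>2"
        by (simp add: power_mult_distrib)
    qed
    also have "\<dots> = h\<^sup>2 * X"
      unfolding X_def using integral_lborel_translate[of "\<lambda>x. (S x)\<^sup>2" "h *\<^sub>R b"] by simp
    finally have D: "displacement w (h *\<^sub>R b) = h\<^sup>2 * X" .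
    \<comment> \<open>\<open>near\<close> is available only for r <= T while h is arbitrary. With r
      = h / m the cost m^2 of \<open>displacement_multiple\<close> cancels against r^2 = h^2 /
      m^2.\<close>
    obtain m where m: "real m > h / T" using reals_Archimedean2 by blast
    then have m0: "m > 0" using h T by (cases m) (auto simp: field_simps zero_less_divide_iff not_less)
    define r where "r = h / m"
    have r: "0 < r" "r \<le> T" using m m0 h T by (auto simp: r_def field_simps)
    define e where "e x = g x - gauss_avg r g x" for x
    have em: "e \<in> borel_measurable borel"
      unfolding e_def using gauss_avg_measurable[of g r] by measurable
    have eb: "\<bar>e x\<bar> \<le> (K * r\<^sup>2) * N x" for x
      using near[of r x] r by (simp add: e_def N_def)
    have dece: "decays e"
      by (rule decaysI[OF em, of "K * r\<^sup>2"]) (use eb in \<open>simp add: N_def\<close>)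
    have avgw: "w x - gauss_avg r w x = (1 / h) * (e (x + h *\<^sub>R b) - e x)" for x
    proof -
      obtain A where A: "\<And>x. \<bar>g x\<bar> \<le> A" using decays_bound[OF g] by blast
      have int: "integrable std_gauss (\<lambda>y. g (x + r *\<^sub>R y))" for x
        by (rule integrable_std_gauss_poly[of _ A 0]) (use A in auto)
      have "gauss_avg r w x = (\<integral>y. (1 / h) * (g (x + h *\<^sub>R b + r *\<^sub>R y) - g (x + r *\<^sub>R y)) \<partial>std_gauss)"
        unfolding gauss_avg_def w_def by (simp add: add_ac)
      also have "\<dots> = (1 / h) * (gauss_avg r g (x + h *\<^sub>R b) - gauss_avg r g x)"
        unfolding gauss_avg_def integral_mult_right_zero
        by (subst Bochner_Integration.integral_diff[OF int int]) (rule refl)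
      finally have "gauss_avg r w x = (1 / h) * (gauss_avg r g (x + h *\<^sub>R b) - gauss_avg r g x)" .
      then show ?thesis by (simp add: w_def e_def algebra_simps)
    qed
    \<comment> \<open>Summation by parts: w - Q_r w is a first difference of e, and shifting that
      difference onto the first difference of g produces S.\<close>
    have "(\<integral>x. w x * (w x - gauss_avg r w x) \<partial>lborel) = - (\<integral>x. e x * S x \<partial>lborel)"
    proof -
      have tre: "(\<integral>x. g (x + h *\<^sub>R b) * e (x + h *\<^sub>R b) \<partial>lborel) = (\<integral>x. g x * e x \<partial>lborel)"
        using em by (intro integral_lborel_translate) measurable
      have "(\<integral>x. g x * e (x + h *\<^sub>R b) \<partial>lborel) = (\<integral>x. g (x + h *\<^sub>R b - h *\<^sub>R b) * e (x + h *\<^sub>R b) \<partial>lborel)"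
        by simp
      also have "\<dots> = (\<integral>x. g (x - h *\<^sub>R b) * e x \<partial>lborel)"
        using em by (intro integral_lborel_translate) measurable
      finally have tre2: "(\<integral>x. g x * e (x + h *\<^sub>R b) \<partial>lborel) = (\<integral>x. g (x - h *\<^sub>R b) * e x \<partial>lborel)" .
      note ints = decays_integrable[OF decays_mult[OF tr(1)[OF g] tr(1)[OF dece]]]
        decays_integrable[OF decays_mult[OF g dece]]
        decays_integrable[OF decays_mult[OF tr(1)[OF g] dece]]
        decays_integrable[OF decays_mult[OF tr(2)[OF g] dece]]
        decays_integrable[OF decays_mult[OF g tr(1)[OF dece]]]
      have "(\<integral>x. w x * (w x - gauss_avg r w x) \<partial>lborel) =
          (\<integral>x. (1 / h\<^sup>2) * (g (x + h *\<^sub>R b) * e (x + h *\<^sub>R b) + g x * e x - g (x + h *\<^sub>R b) * e x - g x * e (x + h *\<^sub>R b)) \<partial>lborel)"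
        by (intro lint_cong refl)
          (simp only: avgw, simp add: w_def power2_eq_square field_simps)
      also have "\<dots> = (1 / h\<^sup>2) * (2 * (\<integral>x. g x * e x \<partial>lborel) - (\<integral>x. g (x + h *\<^sub>R b) * e x \<partial>lborel) - (\<integral>x. g (x - h *\<^sub>R b) * e x \<partial>lborel))"
        using ints tre tre2 by simp
      also have "\<dots> = (\<integral>x. (1 / h\<^sup>2) * (2 * (g x * e x) - g (x + h *\<^sub>R b) * e x - g (x - h *\<^sub>R b) * e x) \<partial>lborel)"
        using ints by simp
      also have "\<dots> = (\<integral>x. - (e x * S x) \<partial>lborel)"
        unfolding S by (intro lint_cong refl)
          (simp add: diff_divide_distrib add_divide_distrib algebra_simps)
      finally show ?thesis by simp
    qed
    also have "\<dots> \<le> (\<integral>x. (K * r\<^sup>2) * (N x * \<bar>S x\<bar>) \<partial>lborel)"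
    proof -
      have "- (\<integral>x. e x * S x \<partial>lborel) = (\<integral>x. - (e x * S x) \<partial>lborel)" by simp
      also have "\<dots> \<le> (\<integral>x. (K * r\<^sup>2) * (N x * \<bar>S x\<bar>) \<partial>lborel)"
      proof (rule lint_mono)
        show "integrable lborel (\<lambda>x. - (e x * S x))"
          using decays_integrable[OF decays_mult[OF dece decS]] by simp
        show "integrable lborel (\<lambda>x. (K * r\<^sup>2) * (N x * \<bar>S x\<bar>))"
          using integrable_abs[OF decays_integrable[OF decays_mult[OF N decS]]] N0 by (simp add: abs_mult)
        fix x
        have "- (e x * S x) \<le> \<bar>e x\<bar> * \<bar>S x\<bar>" by (metis abs_ge_self abs_minus_cancel abs_mult)
        also have "\<dots> \<le> (K * r\<^sup>2) * N x * \<bar>S x\<bar>" by (intro mult_right_mono eb) simp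
        finally show "- (e x * S x) \<le> (K * r\<^sup>2) * (N x * \<bar>S x\<bar>)" by (simp only: mult.assoc)
      qed
      finally show ?thesis .
    qed
    finally have E: "(\<integral>x. w x * (w x - gauss_avg r w x) \<partial>lborel) \<le> (K * r\<^sup>2) * (\<integral>x. N x * \<bar>S x\<bar> \<partial>lborel)" by simp
    have "h\<^sup>2 * X \<le> C * (\<integral>y. displacement w (h *\<^sub>R y) \<partial>std_gauss)"
      using C(2)[OF w, of h] D by simp
    also have "\<dots> \<le> C * (\<integral>y. (real m)\<^sup>2 * displacement w (r *\<^sub>R y) \<partial>std_gauss)"
    proof (intro mult_left_mono C lint_mono)
      show "displacement w (h *\<^sub>R y) \<le> (real m)\<^sup>2 * displacement w (r *\<^sub>R y)" for y
        using displacement_multiple[OF w, of m "r *\<^sub>R y"] m0 by (simp add: r_def)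
    qed (use displacement_gauss(2)[OF w] in auto)
    also have "\<dots> = C * (real m)\<^sup>2 * (2 * (\<integral>x. w x * (w x - gauss_avg r w x) \<partial>lborel))"
      by (simp add: displacement_gauss(1)[OF w])
    also have "\<dots> \<le> C * (real m)\<^sup>2 * (2 * ((K * r\<^sup>2) * (\<integral>x. N x * \<bar>S x\<bar> \<partial>lborel)))"
      using E C(1) by (intro mult_left_mono) auto
    also have "\<dots> = h\<^sup>2 * (k * (\<integral>x. N x * \<bar>S x\<bar> \<partial>lborel))"
      using m0 by (simp add: k_def r_def power_divide)
    finally have "X \<le> k * (\<integral>x. N x * \<bar>S x\<bar> \<partial>lborel)"
      using h by simp
    also have "\<dots> = (\<integral>x. k * (N x * \<bar>S x\<bar>) \<partial>lborel)" by simp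
    \<comment> \<open>Young's inequality: X reappears with factor 1/2 and is absorbed. This is
      legitimate since X is finite for each h, as \<open>S\<close> decays.\<close>
    also have "\<dots> \<le> (\<integral>x. (k\<^sup>2 * (N x * N x) + (S x)\<^sup>2) / 2 \<partial>lborel)"
    proof (rule lint_mono)
      show "integrable lborel (\<lambda>x. k * (N x * \<bar>S x\<bar>))"
        using integrable_abs[OF decays_integrable[OF decays_mult[OF N decS]]] N0 by (simp add: abs_mult)
      show "integrable lborel (\<lambda>x. (k\<^sup>2 * (N x * N x) + (S x)\<^sup>2) / 2)"
        using decays_integrable[OF decays_mult[OF N N]] iS2 by simp
      show "k * (N x * \<bar>S x\<bar>) \<le> (k\<^sup>2 * (N x * N x) + (S x)\<^sup>2) / 2" for x
        using zero_le_power2[of "k * N x - \<bar>S x\<bar>"]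
        by (simp add: power2_eq_square algebra_simps)
    qed
    also have "\<dots> = (k\<^sup>2 * M + X) / 2"
      using decays_integrable[OF decays_mult[OF N N]] iS2 by (simp add: M_def X_def)
    finally have "X \<le> k\<^sup>2 * M" by simp
    also have "\<dots> \<le> (k + 1)\<^sup>2 * M"
      using k N0 by (intro mult_right_mono power_mono) (auto simp: M_def intro!: integral_nonneg_AE)
    finally show ?thesis using decS by (simp add: X_def)
  qed
  show ?thesis
    using main[OF _ refl] by (intro exI[of _ "(k + 1)\<^sup>2 * M"] allI impI)
qed

text \<open>An \<open>L\<^sup>2\<close> bound replaces the dominating function of dominated convergence.\<close>
lemma L2_bounded_convergence:
  fixes f :: "nat \<Rightarrow> 'a \<Rightarrow> real"
  assumes [measurable]: "\<And>k. f k \<in> borel_measurable M" "f' \<in> borel_measurable M" "p \<in> borel_measurable M"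
    and lim: "\<And>x. (\<lambda>k. f k x) \<longlonglongrightarrow> f' x"
    and p: "integrable M p" "\<And>x. 0 \<le> p x" "\<And>x. p x \<le> 1"
    and int: "\<And>k. integrable M (\<lambda>x. (f k x)\<^sup>2)" and bound: "\<And>k. (\<integral>x. (f k x)\<^sup>2 \<partial>M) \<le> X"
  shows "integrable M (\<lambda>x. p x * f' x)" and "(\<lambda>k. \<integral>x. p x * f k x \<partial>M) \<longlonglongrightarrow> (\<integral>x. p x * f' x \<partial>M)"
proof -
  have X: "X \<ge> 0" using order.trans[OF integral_nonneg_AE bound[of 0]] by simp
  \<comment> \<open>Fatou's lemma puts the limit into L^2 with the same bound X.\<close>
  have "(\<integral>\<^sup>+x. ennreal ((f' x)\<^sup>2) \<partial>M) = (\<integral>\<^sup>+x. liminf (\<lambda>k. ennreal ((f k x)\<^sup>2)) \<partial>M)"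
  proof (rule nn_integral_cong)
    fix x
    have "(\<lambda>k. ennreal ((f k x)\<^sup>2)) \<longlonglongrightarrow> ennreal ((f' x)\<^sup>2)"
      by (intro tendsto_ennrealI tendsto_power lim)
    then show "ennreal ((f' x)\<^sup>2) = liminf (\<lambda>k. ennreal ((f k x)\<^sup>2))"
      by (intro lim_imp_Liminf[symmetric] trivial_limit_sequentially)
  qed
  also have "\<dots> \<le> liminf (\<lambda>k. \<integral>\<^sup>+x. ennreal ((f k x)\<^sup>2) \<partial>M)"
    by (rule nn_integral_liminf) measurable
  also have "\<dots> \<le> liminf (\<lambda>k. ennreal X)"
    using int bound by (intro Liminf_mono always_eventually allI) (simp add: nn_integral_eq_integral ennreal_leI)
  also have "\<dots> = ennreal X" by (simp add: Liminf_const)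
  finally have fat: "(\<integral>\<^sup>+x. ennreal ((f' x)\<^sup>2) \<partial>M) \<le> ennreal X" .
  then have intf': "integrable M (\<lambda>x. (f' x)\<^sup>2)"
    by (intro integrableI_bounded) (auto intro: le_less_trans)
  have f'X: "(\<integral>x. (f' x)\<^sup>2 \<partial>M) \<le> X"
    using fat X intf' by (simp add: nn_integral_eq_integral)
  have ab: "a \<le> 1 + a\<^sup>2" for a :: real
    using zero_le_power2[of "a - 1 / 2"] by (simp add: power2_diff power_divide)
  have pint: "integrable M (\<lambda>x. p x * F x)" if "integrable M (\<lambda>x. (F x)\<^sup>2)" and [measurable]: "F \<in> borel_measurable M" for F
  proof (rule Bochner_Integration.integrable_bound[of _ "\<lambda>x. p x + (F x)\<^sup>2"])
    show "AE x in M. norm (p x * F x) \<le> norm (p x + (F x)\<^sup>2)"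
    proof (rule AE_I2)
      fix x
      have "p x * \<bar>F x\<bar> \<le> p x * (1 + \<bar>F x\<bar>\<^sup>2)" by (intro mult_left_mono ab p)
      also have "\<dots> \<le> p x + 1 * (F x)\<^sup>2"
        using mult_right_mono[OF p(3)[of x], of "(F x)\<^sup>2"] by (simp add: distrib_left)
      finally show "norm (p x * F x) \<le> norm (p x + (F x)\<^sup>2)"
        using p(2)[of x] by (simp add: abs_mult)
    qed
  qed (use that p in auto)
  show "integrable M (\<lambda>x. p x * f' x)" by (rule pint[OF intf']) measurable
  have diff_sq: "integrable M (\<lambda>x. (f k x - f' x)\<^sup>2)" "(\<integral>x. (f k x - f' x)\<^sup>2 \<partial>M) \<le> 4 * X" for k
  proof -
    have sq: "(a - b)\<^sup>2 \<le> 2 * a\<^sup>2 + 2 * b\<^sup>2" for a b :: real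
      using zero_le_power2[of "a + b"] unfolding power2_sum power2_diff by simp
    show i: "integrable M (\<lambda>x. (f k x - f' x)\<^sup>2)"
      by (rule Bochner_Integration.integrable_bound[of _ "\<lambda>x. 2 * (f k x)\<^sup>2 + 2 * (f' x)\<^sup>2"])
        (use int intf' sq in \<open>auto intro!: AE_I2\<close>)
    have "(\<integral>x. (f k x - f' x)\<^sup>2 \<partial>M) \<le> (\<integral>x. 2 * (f k x)\<^sup>2 + 2 * (f' x)\<^sup>2 \<partial>M)"
      using i int intf' sq by (intro lint_mono) auto
    also have "\<dots> \<le> 4 * X" using int[of k] intf' bound[of k] f'X by simp
    finally show "(\<integral>x. (f k x - f' x)\<^sup>2 \<partial>M) \<le> 4 * X" .
  qed
  have conv: "(\<lambda>k. \<integral>x. p x * \<bar>f k x - f' x\<bar> \<partial>M) \<longlonglongrightarrow> 0"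
  proof (rule LIMSEQ_I)
    fix e :: real assume e: "e > 0"
    \<comment> \<open>Truncation level. Values a above R satisfy a <= a^2 / R, so the tail costs at
      most 4 X / R, which this choice makes smaller than e / 2, also for X = 0. Below the level, p *
      R dominates.\<close>
    define R where "R = (8 * X + 1) / e"
    have R: "R > 0" using X e by (simp add: R_def)
    have "(\<lambda>k. \<integral>x. p x * min \<bar>f k x - f' x\<bar> R \<partial>M) \<longlonglongrightarrow> (\<integral>x. 0 \<partial>M)"
    proof (rule integral_dominated_convergence[where w = "\<lambda>x. p x * R"])
      show "AE x in M. (\<lambda>k. p x * min \<bar>f k x - f' x\<bar> R) \<longlonglongrightarrow> 0"
      proof (rule AE_I2)
        fix x
        have "(\<lambda>k. p x * min \<bar>f k x - f' x\<bar> R) \<longlonglongrightarrow> p x * min \<bar>f' x - f' x\<bar> R"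
          by (intro tendsto_intros lim)
        then show "(\<lambda>k. p x * min \<bar>f k x - f' x\<bar> R) \<longlonglongrightarrow> 0" using R by simp
      qed
      show "AE x in M. norm (p x * min \<bar>f k x - f' x\<bar> R) \<le> p x * R" for k
        using p(2) R by (intro AE_I2) (simp add: abs_mult mult_left_mono)
    qed (use p in auto)
    from LIMSEQ_D[OF this, of "e / 2"] e obtain k0
      where k0: "\<And>k. k \<ge> k0 \<Longrightarrow> \<bar>\<integral>x. p x * min \<bar>f k x - f' x\<bar> R \<partial>M\<bar> < e / 2" by auto
    have "norm ((\<integral>x. p x * \<bar>f k x - f' x\<bar> \<partial>M) - 0) < e" if k: "k \<ge> k0" for k
    proof -
      have i1: "integrable M (\<lambda>x. p x * min \<bar>f k x - f' x\<bar> R)"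
      proof (rule Bochner_Integration.integrable_bound[of _ "\<lambda>x. p x * R"])
        show "AE x in M. norm (p x * min \<bar>f k x - f' x\<bar> R) \<le> norm (p x * R)"
          using p(2) R by (intro AE_I2) (simp add: abs_mult mult_left_mono)
      qed (use p(1) in simp_all)
      have i2: "integrable M (\<lambda>x. p x * \<bar>f k x - f' x\<bar>)"
      proof (rule pint)
        show "integrable M (\<lambda>x. \<bar>f k x - f' x\<bar>\<^sup>2)" using diff_sq(1)[of k] by simp
      qed measurable
      have "(\<integral>x. p x * \<bar>f k x - f' x\<bar> \<partial>M) \<le> (\<integral>x. p x * min \<bar>f k x - f' x\<bar> R + (f k x - f' x)\<^sup>2 / R \<partial>M)"
      proof (rule lint_mono)
        fix x
        define a where "a = \<bar>f k x - f' x\<bar>"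
        have "p x * a \<le> p x * min a R + a\<^sup>2 / R"
        proof (cases "a \<le> R")
          case True
          then show ?thesis using R by simp
        next
          case False
          then have "a * R \<le> a * a" by (intro mult_left_mono) (auto simp: a_def)
          then have "a \<le> a\<^sup>2 / R" using R by (simp add: field_simps power2_eq_square)
          moreover have "p x * a \<le> 1 * a" using p by (intro mult_right_mono) (auto simp: a_def)
          moreover have "p x * min a R \<ge> 0" using p(2)[of x] R by (simp add: a_def)
          ultimately show ?thesis by linarith
        qed
        then show "p x * \<bar>f k x - f' x\<bar> \<le> p x * min \<bar>f k x - f' x\<bar> R + (f k x - f' x)\<^sup>2 / R"
          by (simp add: a_def)
      qed (rule i2, intro Bochner_Integration.integrable_add integrable_divide i1 diff_sq(1))
      also have "\<dots> = (\<integral>x. p x * min \<bar>f k x - f' x\<bar> R \<partial>M) + (\<integral>x. (f k x - f' x)\<^sup>2 \<partial>M) / R"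
        by (subst Bochner_Integration.integral_add[OF i1 integrable_divide[OF diff_sq(1)]]) simp
      also have "\<dots> \<le> (\<integral>x. p x * min \<bar>f k x - f' x\<bar> R \<partial>M) + 4 * X / R"
        using diff_sq(2)[of k] R by (simp add: divide_right_mono)
      also have "4 * X / R < e / 2"
        using X e by (simp add: R_def field_simps)
      finally have "(\<integral>x. p x * \<bar>f k x - f' x\<bar> \<partial>M) < e" using k0[OF k] by linarith
      moreover have "(\<integral>x. p x * \<bar>f k x - f' x\<bar> \<partial>M) \<ge> 0"
        using p by (intro integral_nonneg_AE) simp
      ultimately show ?thesis by simp
    qed
    then show "\<exists>no. \<forall>n\<ge>no. norm ((\<integral>x. p x * \<bar>f n x - f' x\<bar> \<partial>M) - 0) < e" by blast
  qed
  have le: "\<bar>(\<integral>x. p x * f k x \<partial>M) - (\<integral>x. p x * f' x \<partial>M)\<bar> \<le> (\<integral>x. p x * \<bar>f k x - f' x\<bar> \<partial>M)" for k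
  proof -
    have "(\<integral>x. p x * f k x \<partial>M) - (\<integral>x. p x * f' x \<partial>M) = (\<integral>x. p x * (f k x - f' x) \<partial>M)"
      using pint[OF int[of k]] pint[OF intf'] by (simp add: right_diff_distrib)
    moreover have "\<bar>\<integral>x. p x * (f k x - f' x) \<partial>M\<bar> \<le> (\<integral>x. \<bar>p x * (f k x - f' x)\<bar> \<partial>M)"
      by (rule integral_abs_bound)
    ultimately show ?thesis using p(2) by (simp add: abs_mult)
  qed
  have "(\<lambda>k. (\<integral>x. p x * f k x \<partial>M) - (\<integral>x. p x * f' x \<partial>M)) \<longlonglongrightarrow> 0"
    by (rule Lim_null_comparison[OF _ conv]) (simp add: le)
  then show "(\<lambda>k. \<integral>x. p x * f k x \<partial>M) \<longlonglongrightarrow> (\<integral>x. p x * f' x \<partial>M)"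
    by (simp add: LIM_zero_iff)
qed

section \<open>Gaussian integration by parts for pure second partials\<close>

lemma inverse_Suc_tendsto_0: "(\<lambda>k. 1 / real (Suc k)) \<longlonglongrightarrow> 0"
  using LIMSEQ_inverse_real_of_nat by (simp add: inverse_eq_divide)

text \<open>The derivative is a pointwise limit of difference quotients along the steps 1 / (k +
  1).\<close>

lemma has_pderiv_measurable:
  fixes f :: "'a::euclidean_space \<Rightarrow> real"
  assumes [measurable]: "f \<in> borel_measurable borel" and d: "has_pderiv b f f'"
  shows "f' \<in> borel_measurable borel"
proof (rule borel_measurable_LIMSEQ_real)
  fix x
  have "((\<lambda>h. (f (x + h *\<^sub>R b) - f x) / h) \<longlongrightarrow> f' x) (at 0)"
    using d unfolding has_pderiv_def DERIV_def by simp
  then show "(\<lambda>k. (f (x + (1 / real (Suc k)) *\<^sub>R b) - f x) / (1 / real (Suc k))) \<longlonglongrightarrow> f' x"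
    by (rule filterlim_compose) (auto simp: filterlim_at intro!: inverse_Suc_tendsto_0[simplified])
qed measurable

lemma has_pderiv_mult:
  assumes "has_pderiv b f f'" "has_pderiv b g g'"
  shows "has_pderiv b (\<lambda>x. f x * g x) (\<lambda>x. f' x * g x + f x * g' x)"
  unfolding has_pderiv_def
proof
  fix x
  have "((\<lambda>h. f (x + h *\<^sub>R b)) has_real_derivative f' x) (at 0)"
    and "((\<lambda>h. g (x + h *\<^sub>R b)) has_real_derivative g' x) (at 0)"
    using assms unfolding has_pderiv_def by auto
  from DERIV_mult[OF this]
  show "((\<lambda>h. f (x + h *\<^sub>R b) * g (x + h *\<^sub>R b)) has_real_derivative f' x * g x + f x * g' x) (at 0)"
    by (simp add: mult.commute)
qed

lemma has_pderiv_add: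
  assumes "has_pderiv b f f'" "has_pderiv b g g'"
  shows "has_pderiv b (\<lambda>x. f x + g x) (\<lambda>x. f' x + g' x)"
  using assms unfolding has_pderiv_def by (auto intro: DERIV_add)

lemma has_pderiv_minus:
  assumes "has_pderiv b f f'"
  shows "has_pderiv b (\<lambda>x. - f x) (\<lambda>x. - f' x)"
  using assms unfolding has_pderiv_def by (auto intro: DERIV_minus)

lemma has_pderiv_const: "has_pderiv b (\<lambda>x. c) (\<lambda>x. 0)"
  unfolding has_pderiv_def by simp

lemma has_pderiv_coord:
  "b \<in> Basis \<Longrightarrow> has_pderiv b (\<lambda>x. c * (x \<bullet> b)) (\<lambda>x. c)"
  unfolding has_pderiv_def by (auto intro!: derivative_eq_intros simp: inner_add_left)

lemma has_pderiv_cong: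
  "has_pderiv b f f' \<Longrightarrow> (\<And>x. f' x = g' x) \<Longrightarrow> has_pderiv b f g'"
  unfolding has_pderiv_def by simp

text \<open>One application of L'Hopital leaves (f' h - f' (- h)) / (2 h), the mean of two
  difference quotients of f' at 0. The second derivative enters at the point 0 alone.\<close>

lemma second_difference_tendsto:
  fixes f f' :: "real \<Rightarrow> real"
  assumes f: "\<And>h. (f has_real_derivative f' h) (at h)" and f': "(f' has_real_derivative l) (at 0)"
  shows "((\<lambda>h. (f h + f (- h) - 2 * f 0) / h\<^sup>2) \<longlongrightarrow> l) (at_right 0)"
proof (rule lhopital_right_0)
  have cont: "isCont f x" for x using f[of x] by (rule DERIV_isCont)
  have "((\<lambda>h. f h + f (- h) - 2 * f 0) \<longlongrightarrow> f 0 + f (- 0) - 2 * f 0) (at 0)"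
    by (intro tendsto_intros isCont_tendsto_compose[OF cont] tendsto_ident_at)
  then have "((\<lambda>h. f h + f (- h) - 2 * f 0) \<longlongrightarrow> 0) (at 0)" by simp
  then show "((\<lambda>h. f h + f (- h) - 2 * f 0) \<longlongrightarrow> 0) (at_right 0)"
    by (rule tendsto_mono[OF at_le, rotated]) simp
  show "((\<lambda>h::real. h\<^sup>2) \<longlongrightarrow> 0) (at_right 0)"
    by (auto intro!: tendsto_eq_intros)
  show "\<forall>\<^sub>F h in at_right (0::real). h\<^sup>2 \<noteq> 0"
    by (simp add: eventually_at_filter)
  show "\<forall>\<^sub>F h in at_right (0::real). 2 * h \<noteq> 0"
    by (simp add: eventually_at_filter)
  show "\<forall>\<^sub>F h in at_right 0. ((\<lambda>h. f h + f (- h) - 2 * f 0) has_real_derivative (f' h - f' (- h))) (at h)"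
  proof (rule always_eventually, rule allI)
    fix h
    have "((\<lambda>h. f (- h)) has_real_derivative f' (- h) * (- 1)) (at h)"
      by (rule DERIV_chain2[OF f]) (auto intro!: derivative_eq_intros)
    then show "((\<lambda>h. f h + f (- h) - 2 * f 0) has_real_derivative (f' h - f' (- h))) (at h)"
      using f[of h] by (auto intro!: derivative_eq_intros)
  qed
  show "\<forall>\<^sub>F h in at_right (0::real). ((\<lambda>h. h\<^sup>2) has_real_derivative 2 * h) (at h)"
    by (rule always_eventually) (auto intro!: derivative_eq_intros)
  have q: "((\<lambda>h. (f' h - f' 0) / h) \<longlongrightarrow> l) (at 0)"
    using f' unfolding DERIV_def by simp
  have "((\<lambda>h. (f' (- h) - f' 0) / - h) \<longlongrightarrow> l) (at 0)"
    by (rule filterlim_compose[OF q]) (auto simp: filterlim_at eventually_at_filter intro!: tendsto_eq_intros)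
  then have "((\<lambda>h. ((f' h - f' 0) / h + (f' (- h) - f' 0) / - h) / 2) \<longlongrightarrow> (l + l) / 2) (at 0)"
    by (intro tendsto_intros q) auto
  then have "((\<lambda>h. (f' h - f' (- h)) / (2 * h)) \<longlongrightarrow> l) (at 0)"
    by (simp add: diff_divide_distrib add_divide_distrib mult.commute)
  then show "((\<lambda>h. (f' h - f' (- h)) / (2 * h)) \<longlongrightarrow> l) (at_right 0)"
    by (rule tendsto_mono[OF at_le, rotated]) simp
qed

text \<open>The mean value inequality twice: for f' between - t and t, then for f t + f (- t) on
  [0, h].\<close>

lemma second_difference_bound:
  fixes f f' f'' :: "real \<Rightarrow> real"
  assumes f: "\<And>h. (f has_real_derivative f' h) (at h)" and f': "\<And>h. (f' has_real_derivative f'' h) (at h)"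
    and bd: "\<And>h. \<bar>f'' h\<bar> \<le> B" and h: "h > 0"
  shows "\<bar>(f h + f (- h) - 2 * f 0) / h\<^sup>2\<bar> \<le> 2 * B"
proof -
  have B: "B \<ge> 0" using order.trans[OF abs_ge_zero bd] .
  have d': "norm (f' t - f' (- t)) \<le> B * norm (t - (- t))" for t
    by (rule field_differentiable_bound[of UNIV f' f'']) (use f' bd in auto)
  have "norm ((f h + f (- h)) - (f 0 + f (- 0))) \<le> (B * (2 * h)) * norm (h - 0)"
  proof (rule field_differentiable_bound[of "{0..h}" "\<lambda>t. f t + f (- t)" "\<lambda>t. f' t - f' (- t)"])
    fix t assume t: "t \<in> {0..h}"
    have "((\<lambda>t. f (- t)) has_real_derivative f' (- t) * (- 1)) (at t)"
      by (rule DERIV_chain2[OF f]) (auto intro!: derivative_eq_intros)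
    then have "((\<lambda>t. f t + f (- t)) has_real_derivative (f' t - f' (- t))) (at t)"
      using f[of t] by (auto intro!: derivative_eq_intros)
    then show "((\<lambda>t. f t + f (- t)) has_field_derivative (f' t - f' (- t))) (at t within {0..h})"
      by (rule DERIV_subset) simp
    have "norm (f' t - f' (- t)) \<le> B * (2 * t)"
      using d'[of t] t by simp
    also have "\<dots> \<le> B * (2 * h)" using t B by (intro mult_left_mono) auto
    finally show "norm (f' t - f' (- t)) \<le> B * (2 * h)" .
  qed (use h in auto)
  then show ?thesis using h by (simp add: field_simps power2_eq_square)
qed

text \<open>Existence of partials alone does not give continuity, but locally bounded partials do:
  the increment is taken one coordinate at a time, and each step is Lipschitz by the mean value
  inequality.\<close>

lemma continuous_of_partial_derivs:
  fixes F :: "'a::euclidean_space \<Rightarrow> real"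
  assumes d: "\<And>b. b \<in> Basis \<Longrightarrow> has_pderiv b F (F1 b)"
    and bd: "\<And>b x. b \<in> Basis \<Longrightarrow> \<bar>F1 b x\<bar> \<le> C * jb x ^ m"
  shows "continuous_on UNIV F"
proof -
  have "isCont F x" for x
  proof -
    obtain b0 :: 'a where "b0 \<in> Basis" using nonempty_Basis by blast
    then have C: "C \<ge> 0" using poly_bound_nonneg[of "F1 b0"] bd by blast
    \<comment> \<open>For |v| <= 1 the coordinate path from x to x + v has at most DIM steps of
      length at most 1 and stays in the ball of radius DIM about x; B bounds the partials on that
      ball.\<close>
    define B where "B = C * (2 * jb x * (1 + (real DIM('a))\<^sup>2)) ^ m"
    have B: "B \<ge> 0" using C by (simp add: B_def jb_nonneg)
    have bdB: "\<bar>F1 b (x + z)\<bar> \<le> B" if "b \<in> Basis" "norm z \<le> real DIM('a)" for b z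
    proof -
      have "jb (x + z) \<le> 2 * jb x * jb z" by (rule jb_add)
      also have "\<dots> \<le> 2 * jb x * (1 + (real DIM('a))\<^sup>2)"
        using that(2) by (intro mult_left_mono) (auto simp: jb_def power_mono)
      finally have "jb (x + z) ^ m \<le> (2 * jb x * (1 + (real DIM('a))\<^sup>2)) ^ m"
        by (intro power_mono jb_nonneg)
      then have "C * jb (x + z) ^ m \<le> B" unfolding B_def by (rule mult_left_mono[OF _ C])
      with bd[OF that(1), of "x + z"] show ?thesis by linarith
    qed
    have ind: "\<bar>F (x + (\<Sum>b\<in>S. (v \<bullet> b) *\<^sub>R b)) - F x\<bar> \<le> B * (\<Sum>b\<in>S. \<bar>v \<bullet> b\<bar>)"
      if S: "S \<subseteq> Basis" and v: "norm v \<le> 1" for S v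
      using finite_subset[OF S finite_Basis] S
    proof (induction S rule: finite_induct)
      case empty
      then show ?case by simp
    next
      case (insert b S)
      define z where "z = (\<Sum>b\<in>S. (v \<bullet> b) *\<^sub>R b)"
      define a where "a = \<bar>v \<bullet> b\<bar>"
      have b: "b \<in> Basis" using insert.prems by simp
      have vb: "\<bar>v \<bullet> c\<bar> \<le> 1" if "c \<in> Basis" for c
        using Basis_le_norm[OF that, of v] v by linarith
      have zb: "norm (z + t *\<^sub>R b) \<le> real DIM('a)" if "\<bar>t\<bar> \<le> a" for t
      proof -
        have "norm (z + t *\<^sub>R b) \<le> norm z + norm (t *\<^sub>R b)" by (rule norm_triangle_ineq)
        also have "\<dots> \<le> (\<Sum>c\<in>S. 1) + 1"
        proof (rule add_mono)
          show "norm z \<le> (\<Sum>c\<in>S. 1)"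
            unfolding z_def using insert.prems vb by (intro sum_norm_le) auto
          show "norm (t *\<^sub>R b) \<le> 1" using that vb[OF b] b by (simp add: a_def)
        qed
        also have "\<dots> = real (card (insert b S))" using insert.hyps by simp
        also have "\<dots> \<le> real DIM('a)"
          using card_mono[OF finite_Basis insert.prems] by simp
        finally show ?thesis .
      qed
      have "norm (F ((x + z) + (v \<bullet> b) *\<^sub>R b) - F ((x + z) + 0 *\<^sub>R b)) \<le> B * norm ((v \<bullet> b) - 0)"
      proof (rule field_differentiable_bound[of "{- a..a}" "\<lambda>t. F ((x + z) + t *\<^sub>R b)" "\<lambda>t. F1 b ((x + z) + t *\<^sub>R b)"])
        fix t assume t: "t \<in> {- a..a}"
        show "((\<lambda>t. F ((x + z) + t *\<^sub>R b)) has_field_derivative F1 b ((x + z) + t *\<^sub>R b)) (at t within {- a..a})"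
          by (rule DERIV_subset[OF has_pderivD[OF d[OF b]]]) simp
        show "norm (F1 b ((x + z) + t *\<^sub>R b)) \<le> B"
          using bdB[OF b zb[of t]] t by (simp add: add.assoc abs_le_iff)
      qed (auto simp: a_def)
      then have "\<bar>F (x + (z + (v \<bullet> b) *\<^sub>R b)) - F (x + z)\<bar> \<le> B * \<bar>v \<bullet> b\<bar>"
        by (simp add: add.assoc)
      moreover have "\<bar>F (x + z) - F x\<bar> \<le> B * (\<Sum>b\<in>S. \<bar>v \<bullet> b\<bar>)"
        using insert unfolding z_def by simp
      ultimately show ?case
        using insert.hyps by (simp add: z_def distrib_left add.commute[of "(v \<bullet> b) *\<^sub>R b"])
    qed
    have "((\<lambda>y. F y - F x) \<longlongrightarrow> 0) (at x)"
    proof (rule Lim_null_comparison)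
      show "\<forall>\<^sub>F y in at x. norm (F y - F x) \<le> B * (\<Sum>b\<in>Basis. \<bar>(y - x) \<bullet> b\<bar>)"
        unfolding eventually_at
      proof (intro exI conjI ballI impI)
        fix y assume "y \<noteq> x \<and> dist y x < 1"
        then have "norm (y - x) \<le> 1" by (simp add: dist_norm)
        from ind[OF subset_refl this] show "norm (F y - F x) \<le> B * (\<Sum>b\<in>Basis. \<bar>(y - x) \<bullet> b\<bar>)"
          by (simp add: euclidean_representation)
      qed simp
      have "((\<lambda>y. B * (\<Sum>b\<in>Basis. \<bar>(y - x) \<bullet> b\<bar>)) \<longlongrightarrow> B * (\<Sum>b\<in>Basis. \<bar>(x - x) \<bullet> b\<bar>)) (at x)"
        by (intro tendsto_intros)
      then show "((\<lambda>y. B * (\<Sum>b\<in>Basis. \<bar>(y - x) \<bullet> b\<bar>)) \<longlongrightarrow> 0) (at x)" by simp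
    qed
    then show ?thesis by (simp add: isCont_def LIM_zero_iff)
  qed
  then show ?thesis by (simp add: continuous_on_eq_continuous_at)
qed

lemma half_gauss_partial_deriv:
  assumes c: "c \<in> Basis"
  shows "has_pderiv c (\<lambda>x. exp (- (norm x)\<^sup>2 / 4)) (\<lambda>x. (- 1 / 2) * (x \<bullet> c) * exp (- (norm x)\<^sup>2 / 4))"
  unfolding has_pderiv_def
proof
  fix x
  have eq: "(norm (x + h *\<^sub>R c))\<^sup>2 = (norm x)\<^sup>2 + 2 * h * (x \<bullet> c) + h\<^sup>2" for h
    unfolding power2_norm_eq_inner using c
    by (simp add: inner_add_left inner_add_right inner_commute power2_eq_square algebra_simps)
  show "((\<lambda>h. exp (- (norm (x + h *\<^sub>R c))\<^sup>2 / 4)) has_real_derivative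
      (- 1 / 2) * (x \<bullet> c) * exp (- (norm x)\<^sup>2 / 4)) (at 0)"
    unfolding eq by (auto intro!: derivative_eq_intros)
qed

text \<open>The symmetric identity, integral of \<psi> g'' = integral of g \<psi>'' for g = F
  \<psi>, comes first. Since \<psi>^2 is a multiple of the density, expanding g'' leaves F2 - y_b F1
  against the Gaussian, and the terms containing F cancel.\<close>

lemma
  fixes F :: "'a::euclidean_space \<Rightarrow> real" and F1 F2 :: "'a \<Rightarrow> 'a \<Rightarrow> real"
  assumes d1: "\<And>c. c \<in> Basis \<Longrightarrow> has_pderiv c F (F1 c)"
    and d2: "\<And>c. c \<in> Basis \<Longrightarrow> has_pderiv c (F1 c) (F2 c)"
    and F: "\<And>x. \<bar>F x\<bar> \<le> C * jb x ^ m"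
    and F1: "\<And>c x. c \<in> Basis \<Longrightarrow> \<bar>F1 c x\<bar> \<le> C * jb x ^ m"
    and lap: "\<And>x. \<bar>\<Sum>c\<in>Basis. F2 c x\<bar> \<le> C * jb x ^ m"
    and b: "b \<in> Basis"
  shows gauss_integrable_second_partial: "integrable std_gauss (F2 b)"
    and gauss_integral_second_partial: "(\<integral>y. F2 b y \<partial>std_gauss) = (\<integral>y. F1 b y * (y \<bullet> b) \<partial>std_gauss)"
proof -
  define n where "n = DIM('a)"
  have n1: "n \<ge> 1" unfolding n_def by (simp add: Suc_leI)
  have contF: "continuous_on UNIV F" by (rule continuous_of_partial_derivs[OF d1 F1])
  have C: "C \<ge> 0" by (rule poly_bound_nonneg[OF F])
  have Fm [measurable]: "F \<in> borel_measurable borel"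
    using contF by (simp add: borel_measurable_continuous_onI)
  have F1m [measurable]: "F1 b \<in> borel_measurable borel"
    by (rule has_pderiv_measurable[OF Fm d1[OF b]])
  have F2m [measurable]: "F2 b \<in> borel_measurable borel"
    by (rule has_pderiv_measurable[OF F1m d2[OF b]])
  define \<psi> where "\<psi> x = exp (- (norm x)\<^sup>2 / 4)" for x :: 'a
  have \<psi>m [measurable]: "\<psi> \<in> borel_measurable borel" unfolding \<psi>_def by measurable
  have \<psi>0: "0 \<le> \<psi> x" "\<psi> x \<le> 1" for x by (simp_all add: \<psi>_def)
  have \<psi>d: "has_pderiv c \<psi> (\<lambda>x. (- 1 / 2) * (x \<bullet> c) * \<psi> x)" if "c \<in> Basis" for c
    using half_gauss_partial_deriv[OF that] by (simp add: \<psi>_def[abs_def])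
  have \<psi>dd: "has_pderiv c (\<lambda>x. (- 1 / 2) * (x \<bullet> c) * \<psi> x) (\<lambda>x. ((x \<bullet> c)\<^sup>2 / 4 - 1 / 2) * \<psi> x)" if "c \<in> Basis" for c
    by (rule has_pderiv_cong[OF has_pderiv_mult[OF has_pderiv_coord[OF that] \<psi>d[OF that]]])
      (simp add: power2_eq_square algebra_simps)
  \<comment> \<open>The exponent pays for the growth m of F and its first partials, one further
    power for the polynomial factors that derivatives of \<psi> create, and n for the decay that has
    to remain.\<close>
  obtain E where E: "E > 0" "\<And>x. jb x ^ (m + 1 + n) * \<psi> x \<le> E"
    using jb_power_exp_bounded[of "1/4" "m + 1 + n"] unfolding \<psi>_def by auto
  have decE: "\<bar>P * \<psi> x\<bar> \<le> (c * E) / jb x ^ n" if P: "\<bar>P\<bar> \<le> c * jb x ^ (m + 1)" for P c x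
  proof -
    have "0 \<le> c * jb x ^ (m + 1)" using P by linarith
    then have c: "c \<ge> 0"
      using zero_less_power[OF jb_pos[of x], of "m + 1"] unfolding zero_le_mult_iff by linarith
    have "\<bar>P * \<psi> x\<bar> \<le> c * jb x ^ (m + 1) * \<psi> x"
      unfolding abs_mult using P \<psi>0 by (simp add: mult_right_mono)
    also have "\<dots> = c * (jb x ^ (m + 1 + n) * \<psi> x) / jb x ^ n"
      using jb_pos[of x] by (simp add: power_add)
    also have "\<dots> \<le> c * E / jb x ^ n"
      using E c jb_pos[of x] by (intro divide_right_mono mult_left_mono) auto
    finally show ?thesis .
  qed
  have Jm: "jb x ^ m \<le> jb x ^ (m + 1)" for x :: 'a
    by (intro power_increasing jb_ge_1) simp
  have dec\<psi>: "decays \<psi>"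
  proof (rule decaysI[of _ E])
    fix x :: 'a
    have "1 \<le> 1 * jb x ^ (m + 1)" using one_le_power[OF jb_ge_1[of x], of "m + 1"] by simp
    then show "\<bar>\<psi> x\<bar> \<le> E / jb x ^ DIM('a)"
      using decE[of 1 1 x] by (simp add: n_def)
  qed measurable
  have int\<psi>: "integrable lborel \<psi>" by (rule decays_integrable[OF dec\<psi>])
  define g where "g x = F x * \<psi> x" for x
  define g1 where "g1 c x = F1 c x * \<psi> x + F x * ((- 1 / 2) * (x \<bullet> c) * \<psi> x)" for c x
  define g2 where "g2 c x = (F2 c x - (x \<bullet> c) * F1 c x + ((x \<bullet> c)\<^sup>2 / 4 - 1 / 2) * F x) * \<psi> x" for c x
  have gd1: "has_pderiv c g (g1 c)" if "c \<in> Basis" for c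
    unfolding g_def g1_def by (intro has_pderiv_mult d1 \<psi>d that)
  have gd2: "has_pderiv c (g1 c) (g2 c)" if c: "c \<in> Basis" for c
    unfolding g1_def
    by (rule has_pderiv_cong[OF has_pderiv_add[OF has_pderiv_mult[OF d2[OF c] \<psi>d[OF c]]
            has_pderiv_mult[OF d1[OF c] \<psi>dd[OF c]]]])
      (simp add: g2_def algebra_simps)
  have gb: "\<bar>g x\<bar> \<le> (C * E) / jb x ^ n" for x
    unfolding g_def using order.trans[OF F mult_left_mono[OF Jm C]] by (rule decE)
  have decg: "decays g"
    by (rule decaysI[of _ "C * E"]) (use gb in \<open>simp_all add: n_def g_def[abs_def]\<close>)
  have "continuous_on UNIV \<psi>" unfolding \<psi>_def by (intro continuous_intros) auto
  then have contg: "continuous_on UNIV g"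
    unfolding g_def by (intro continuous_intros contF)
  \<comment> \<open>In units of C jb^(m+1): 1 for the Laplacian of F, n for the sum of the (x . c)
    F1 terms, and 1 + n for the term with F, as |x|^2 / 4 - n / 2 is at most (1 + n) jb x in
    modulus.\<close>
  define K where "K = (C * (2 + 2 * real n)) * E"
  have K: "K \<ge> 0" using C E by (simp add: K_def)
  have lapg: "\<bar>\<Sum>c\<in>Basis. g2 c x\<bar> \<le> K / jb x ^ n" for x
  proof -
    define P where "P = (\<Sum>c\<in>Basis. F2 c x) - (\<Sum>c\<in>Basis. (x \<bullet> c) * F1 c x) + ((norm x)\<^sup>2 / 4 - real n / 2) * F x"
    have "(norm x)\<^sup>2 = (\<Sum>c\<in>Basis. (x \<bullet> c)\<^sup>2)"
      unfolding power2_norm_eq_inner euclidean_inner[of x x] by (simp add: power2_eq_square)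
    then have "(\<Sum>c\<in>Basis. ((x \<bullet> c)\<^sup>2 / 4 - 1 / 2)) = (norm x)\<^sup>2 / 4 - real n / 2"
      by (simp add: sum_subtractf sum_divide_distrib n_def)
    then have eq: "(\<Sum>c\<in>Basis. g2 c x) = P * \<psi> x"
      by (simp add: g2_def P_def sum.distrib sum_subtractf flip: sum_distrib_right)
    have "\<bar>\<Sum>c\<in>Basis. (x \<bullet> c) * F1 c x\<bar> \<le> (\<Sum>c\<in>(Basis :: 'a set). C * jb x ^ (m + 1))"
    proof (rule order.trans[OF sum_abs sum_mono])
      fix c :: 'a assume c: "c \<in> Basis"
      have "\<bar>x \<bullet> c\<bar> * \<bar>F1 c x\<bar> \<le> jb x * (C * jb x ^ m)"
        using abs_inner_Basis_le_jb[OF c, of x] F1[OF c, of x] jb_pos[of x] by (intro mult_mono) auto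
      then show "\<bar>(x \<bullet> c) * F1 c x\<bar> \<le> C * jb x ^ (m + 1)" by (simp add: abs_mult mult_ac)
    qed
    then have p2: "\<bar>\<Sum>c\<in>Basis. (x \<bullet> c) * F1 c x\<bar> \<le> real n * (C * jb x ^ (m + 1))"
      by (simp add: n_def)
    have "\<bar>(norm x)\<^sup>2 / 4 - real n / 2\<bar> \<le> (1 + real n) * jb x"
    proof -
      have "real n * 1 \<le> real n * jb x" by (intro mult_left_mono jb_ge_1) simp
      moreover have "(norm x)\<^sup>2 \<le> jb x" "0 \<le> (norm x)\<^sup>2" by (simp_all add: jb_def)
      ultimately show ?thesis unfolding abs_le_iff distrib_right by linarith
    qed
    then have "\<bar>(norm x)\<^sup>2 / 4 - real n / 2\<bar> * \<bar>F x\<bar> \<le> ((1 + real n) * jb x) * (C * jb x ^ m)"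
      using F[of x] jb_pos[of x] by (intro mult_mono) auto
    then have p3: "\<bar>((norm x)\<^sup>2 / 4 - real n / 2) * F x\<bar> \<le> (1 + real n) * (C * jb x ^ (m + 1))"
      by (simp add: abs_mult mult_ac)
    have p1: "\<bar>\<Sum>c\<in>Basis. F2 c x\<bar> \<le> C * jb x ^ (m + 1)"
      by (rule order.trans[OF lap mult_left_mono[OF Jm C]])
    have "\<bar>P\<bar> \<le> C * jb x ^ (m + 1) + real n * (C * jb x ^ (m + 1)) + (1 + real n) * (C * jb x ^ (m + 1))"
      using p1 p2 p3 unfolding P_def by linarith
    also have "\<dots> = (C * (2 + 2 * real n)) * jb x ^ (m + 1)"
      by (simp add: algebra_simps)
    finally show ?thesis unfolding eq K_def by (rule decE)
  qed
  \<comment> \<open>With this choice 4 n n (n + 1) T^2 = 1 / (4 (n + 1)), within the condition of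
    \<open>gauss_avg_minus_le\<close>.\<close>
  define T where "T = 1 / (4 * real n * real (Suc n))"
  have T0: "T > 0" using n1 by (simp add: T_def)
  have T: "4 * real n * real n * real (Suc n) * T\<^sup>2 \<le> 1"
  proof -
    have "4 * real n * real n * real (Suc n) * T\<^sup>2 = 1 / (4 * real (Suc n))"
      using n1 by (simp add: T_def power2_eq_square field_simps del: of_nat_Suc)
    also have "\<dots> \<le> 1" by simp
    finally show ?thesis .
  qed
  have near: "\<bar>g x - gauss_avg r g x\<bar> \<le> (K + 1) * r\<^sup>2 / jb x ^ DIM('a)" if r: "0 \<le> r" "r \<le> T" for r x
  proof -
    have up: "gauss_avg r g x - g x \<le> (K + 1) * r\<^sup>2 / jb x ^ DIM('a)"
    proof (rule gauss_avg_minus_le[OF contg _ gd1 gd2 _ _ r K])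
      show "\<bar>g x\<bar> \<le> (C * E) / jb x ^ DIM('a)" for x using gb by (simp add: n_def)
      show "(\<Sum>b\<in>Basis. g2 b x) \<le> K / jb x ^ DIM('a)" for x using lapg[of x] by (simp add: n_def abs_le_iff)
      show "4 * real DIM('a) * real DIM('a) * real (Suc DIM('a)) * T\<^sup>2 \<le> 1" using T by (simp add: n_def)
    qed
    \<comment> \<open>The comparison is one-sided; the other side is the same statement for - g,
      which is why the Laplacian was bounded in modulus.\<close>
    have "gauss_avg r (\<lambda>x. - g x) x - (- g x) \<le> (K + 1) * r\<^sup>2 / jb x ^ DIM('a)"
    proof (rule gauss_avg_minus_le[OF _ _ has_pderiv_minus[OF gd1] has_pderiv_minus[OF gd2] _ _ r K])
      show "continuous_on UNIV (\<lambda>x. - g x)" using contg by (intro continuous_intros)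
      show "\<bar>- g x\<bar> \<le> (C * E) / jb x ^ DIM('a)" for x using gb by (simp add: n_def)
      show "(\<Sum>b\<in>Basis. - g2 b x) \<le> K / jb x ^ DIM('a)" for x
        using lapg[of x] by (simp add: n_def abs_le_iff sum_negf)
      show "4 * real DIM('a) * real DIM('a) * real (Suc DIM('a)) * T\<^sup>2 \<le> 1" using T by (simp add: n_def)
    qed
    with up show ?thesis by (simp add: gauss_avg_def abs_le_iff)
  qed
  obtain X where X: "\<And>h. h > 0 \<Longrightarrow>
      decays (\<lambda>x. (g (x + h *\<^sub>R b) + g (x - h *\<^sub>R b) - 2 * g x) / h\<^sup>2) \<and>
      (\<integral>x. ((g (x + h *\<^sub>R b) + g (x - h *\<^sub>R b) - 2 * g x) / h\<^sup>2)\<^sup>2 \<partial>lborel) \<le> X"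
    using second_difference_L2_bound[OF decg b T0 near] by blast
  define h where "h k = 1 / real (Suc k)" for k
  have h0: "h k > 0" for k by (simp add: h_def)
  have hlim: "filterlim h (at_right 0) sequentially"
    unfolding filterlim_at using inverse_Suc_tendsto_0 h0 by (auto simp: h_def[abs_def])
  define sd where "sd q k x = (q (x + h k *\<^sub>R b) + q (x - h k *\<^sub>R b) - 2 * q x) / (h k)\<^sup>2" for q :: "'a \<Rightarrow> real" and k x
  have sdlim: "(\<lambda>k. sd q k x) \<longlonglongrightarrow> q2 x" if "has_pderiv b q q1" "has_pderiv b q1 q2" for q q1 q2 x
  proof -
    have "((\<lambda>h. (q (x + h *\<^sub>R b) + q (x + (- h) *\<^sub>R b) - 2 * q (x + 0 *\<^sub>R b)) / h\<^sup>2) \<longlongrightarrow> q2 x) (at_right 0)"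
      by (rule second_difference_tendsto[OF has_pderivD[OF that(1)]])
        (use has_pderivD[OF that(2), of x 0] in simp)
    from filterlim_compose[OF this hlim] show ?thesis
      by (simp add: sd_def)
  qed
  have gm [measurable]: "g \<in> borel_measurable borel" by (rule decays_measurable[OF decg])
  have g2m [measurable]: "g2 b \<in> borel_measurable borel" unfolding g2_def[abs_def] by measurable
  have sddec: "decays (sd g k)" "(\<integral>x. (sd g k x)\<^sup>2 \<partial>lborel) \<le> X" for k
    using X[OF h0[of k]] by (simp_all add: sd_def[abs_def])
  \<comment> \<open>No pointwise bound on the second differences of g is known, so the limit relies
    on their L^2 bound; \<psi>, integrable with values in [0, 1], is the weight.\<close>
  have i: "integrable lborel (\<lambda>x. \<psi> x * g2 b x)" and
    lim1: "(\<lambda>k. \<integral>x. \<psi> x * sd g k x \<partial>lborel) \<longlonglongrightarrow> (\<integral>x. \<psi> x * g2 b x \<partial>lborel)"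
  proof -
    have meas: "sd g k \<in> borel_measurable lborel" for k using decays_measurable[OF sddec(1)] by simp
    have sq: "integrable lborel (\<lambda>x. (sd g k x)\<^sup>2)" for k
      unfolding power2_eq_square by (intro decays_integrable decays_mult sddec)
    have gm2: "g2 b \<in> borel_measurable lborel" "\<psi> \<in> borel_measurable lborel" by simp_all
    note L = L2_bounded_convergence[OF meas gm2 sdlim[OF gd1[OF b] gd2[OF b]] int\<psi> \<psi>0 sq sddec(2)]
    show "integrable lborel (\<lambda>x. \<psi> x * g2 b x)" by (rule L(1))
    show "(\<lambda>k. \<integral>x. \<psi> x * sd g k x \<partial>lborel) \<longlonglongrightarrow> (\<integral>x. \<psi> x * g2 b x \<partial>lborel)" by (rule L(2))
  qed
  define \<psi>2 where "\<psi>2 x = ((x \<bullet> b)\<^sup>2 / 4 - 1 / 2) * \<psi> x" for x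
  have \<psi>2b: "\<bar>\<psi>2 x\<bar> \<le> E" for x
  proof -
    have "\<bar>(x \<bullet> b)\<^sup>2 / 4 - 1 / 2\<bar> \<le> 1 * jb x"
      using inner_Basis_sq_le_jb[OF b, of x] jb_ge_1[of x] zero_le_power2[of "x \<bullet> b"]
      unfolding abs_le_iff by linarith
    also have "\<dots> \<le> 1 * jb x ^ (m + 1)"
      using power_increasing[OF _ jb_ge_1[of x], of 1 "m + 1"] by simp
    finally have "\<bar>\<psi>2 x\<bar> \<le> 1 * E / jb x ^ n" unfolding \<psi>2_def by (rule decE)
    also have "\<dots> \<le> 1 * E / 1"
      using E jb_ge_1[of x] by (intro divide_left_mono) auto
    finally show ?thesis by simp
  qed
  have sd\<psi>: "\<bar>sd \<psi> k x\<bar> \<le> 2 * E" for k x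
    using second_difference_bound[of "\<lambda>h. \<psi> (x + h *\<^sub>R b)" "\<lambda>h. (- 1 / 2) * ((x + h *\<^sub>R b) \<bullet> b) * \<psi> (x + h *\<^sub>R b)"
        "\<lambda>h. \<psi>2 (x + h *\<^sub>R b)" E "h k", OF has_pderivD[OF \<psi>d[OF b]] _ \<psi>2b h0]
      has_pderivD[OF \<psi>dd[OF b]] by (simp add: sd_def \<psi>2_def)
  \<comment> \<open>The symmetric second difference is self-adjoint: a translation by z of one
    factor is a translation by - z of the other.\<close>
  have swap: "(\<integral>x. \<psi> x * sd g k x \<partial>lborel) = (\<integral>x. g x * sd \<psi> k x \<partial>lborel)" for k
  proof -
    define z where "z = h k *\<^sub>R b"
    have shift: "integrable lborel (\<lambda>x. p x * q (x + w))" "(\<integral>x. p x * q (x + w) \<partial>lborel) = (\<integral>x. q x * p (x - w) \<partial>lborel)"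
      if "decays p" "decays q" for p q :: "'a \<Rightarrow> real" and w
    proof -
      note [measurable] = decays_measurable[OF that(1)] decays_measurable[OF that(2)]
      show "integrable lborel (\<lambda>x. p x * q (x + w))"
        by (intro decays_integrable decays_mult decays_translate that)
      have "(\<integral>x. p x * q (x + w) \<partial>lborel) = (\<integral>x. p ((x + w) - w) * q (x + w) \<partial>lborel)" by simp
      also have "\<dots> = (\<integral>x. p (x - w) * q x \<partial>lborel)"
        by (rule integral_lborel_translate) measurable
      finally show "(\<integral>x. p x * q (x + w) \<partial>lborel) = (\<integral>x. q x * p (x - w) \<partial>lborel)" by (simp add: mult.commute)
    qed
    note s1 = shift[OF dec\<psi> decg, of z] and s2 = shift[OF dec\<psi> decg, of "- z"] and s0 = shift(1)[OF dec\<psi> decg, of 0]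
      and t1 = shift[OF decg dec\<psi>, of z] and t2 = shift[OF decg dec\<psi>, of "- z"] and t0 = shift(1)[OF decg dec\<psi>, of 0]
    have "(\<integral>x. \<psi> x * sd g k x \<partial>lborel) = (\<integral>x. (\<psi> x * g (x + z) + \<psi> x * g (x + - z) - 2 * (\<psi> x * g (x + 0))) / (h k)\<^sup>2 \<partial>lborel)"
      by (intro lint_cong refl) (simp add: sd_def z_def algebra_simps)
    also have "\<dots> = ((\<integral>x. \<psi> x * g (x + z) \<partial>lborel) + (\<integral>x. \<psi> x * g (x + - z) \<partial>lborel) - 2 * (\<integral>x. \<psi> x * g (x + 0) \<partial>lborel)) / (h k)\<^sup>2"
      using s1(1) s2(1) s0 by simp
    also have "\<dots> = ((\<integral>x. g x * \<psi> (x + - z) \<partial>lborel) + (\<integral>x. g x * \<psi> (x + z) \<partial>lborel) - 2 * (\<integral>x. g x * \<psi> (x + 0) \<partial>lborel)) / (h k)\<^sup>2"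
      using s1(2) s2(2) by (simp add: mult.commute)
    also have "\<dots> = (\<integral>x. (g x * \<psi> (x + - z) + g x * \<psi> (x + z) - 2 * (g x * \<psi> (x + 0))) / (h k)\<^sup>2 \<partial>lborel)"
      using t1(1) t2(1) t0 by simp
    also have "\<dots> = (\<integral>x. g x * sd \<psi> k x \<partial>lborel)"
      by (intro lint_cong refl) (simp add: sd_def z_def algebra_simps)
    finally show ?thesis .
  qed
  \<comment> \<open>On this side the second differences fall on the smooth \<psi> and are bounded by
    2 E, so ordinary dominated convergence suffices.\<close>
  have lim2: "(\<lambda>k. \<integral>x. g x * sd \<psi> k x \<partial>lborel) \<longlonglongrightarrow> (\<integral>x. g x * \<psi>2 x \<partial>lborel)"
  proof (rule integral_dominated_convergence[where w = "\<lambda>x. \<bar>g x\<bar> * (2 * E)"])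
    show "(\<lambda>x. g x * \<psi>2 x) \<in> borel_measurable lborel" unfolding \<psi>2_def by measurable
    show "(\<lambda>x. g x * sd \<psi> k x) \<in> borel_measurable lborel" for k unfolding sd_def by measurable
    show "integrable lborel (\<lambda>x. \<bar>g x\<bar> * (2 * E))" using decays_integrable[OF decg] by simp
    show "AE x in lborel. (\<lambda>k. g x * sd \<psi> k x) \<longlonglongrightarrow> g x * \<psi>2 x"
      using sdlim[OF \<psi>d[OF b] \<psi>dd[OF b]] by (intro AE_I2 tendsto_mult_left) (simp add: \<psi>2_def)
    show "AE x in lborel. norm (g x * sd \<psi> k x) \<le> \<bar>g x\<bar> * (2 * E)" for k
      using sd\<psi> by (intro AE_I2) (simp add: abs_mult mult_left_mono)
  qed
  have eq: "(\<integral>x. \<psi> x * g2 b x \<partial>lborel) = (\<integral>x. g x * \<psi>2 x \<partial>lborel)"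
    using LIMSEQ_unique[OF lim1] lim2 unfolding swap by blast
  have igp: "integrable lborel (\<lambda>x. g x * \<psi>2 x)"
    by (intro decays_integrable decays_mult_bounded[OF decg _ \<psi>2b]) (simp add: \<psi>2_def[abs_def])
  define k where "k = (2 * pi) powr (real DIM('a) / 2)"
  have \<psi>sq: "\<psi> y * \<psi> y = k * gauss_density y" for y
    by (simp add: \<psi>_def gauss_density_def k_def flip: exp_add)
  have k: "k > 0" by (simp add: k_def)
  have iF1: "integrable std_gauss (\<lambda>y. F1 b y * (y \<bullet> b))"
  proof (rule integrable_std_gauss_poly[of _ C "m + 1"])
    fix x
    have "\<bar>F1 b x\<bar> * \<bar>x \<bullet> b\<bar> \<le> (C * jb x ^ m) * jb x"
      using abs_inner_Basis_le_jb[OF b, of x] F1[OF b, of x] jb_pos[of x] C by (intro mult_mono) auto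
    then show "\<bar>F1 b x * (x \<bullet> b)\<bar> \<le> C * jb x ^ (m + 1)" by (simp add: abs_mult mult_ac)
  qed measurable
  then have iF1': "integrable lborel (\<lambda>y. gauss_density y * (F1 b y * (y \<bullet> b)))"
    by (simp add: integrable_std_gauss)
  \<comment> \<open>Because \<psi>^2 = k * density, the product \<psi> g2 contains F2, the
    first-order term and a term with F; the latter is exactly g \<psi>2 and is subtracted. By
    \<open>eq\<close> the two outer integrals then cancel.\<close>
  have split: "gauss_density y * F2 b y =
      (1 / k) * (\<psi> y * g2 b y) + gauss_density y * (F1 b y * (y \<bullet> b)) - (1 / k) * (g y * \<psi>2 y)" for y
  proof -
    have e1: "\<psi> y * g2 b y = (\<psi> y * \<psi> y) * (F2 b y - (y \<bullet> b) * F1 b y + ((y \<bullet> b)\<^sup>2 / 4 - 1 / 2) * F y)"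
      by (simp add: g2_def)
    have e2: "g y * \<psi>2 y = (\<psi> y * \<psi> y) * (((y \<bullet> b)\<^sup>2 / 4 - 1 / 2) * F y)"
      by (simp add: g_def \<psi>2_def)
    have "(1 / k) * (k * r * p) = r * p" for r p using k by simp
    then show ?thesis
      unfolding e1 e2 \<psi>sq by (simp only:) (simp add: algebra_simps)
  qed
  have i2: "integrable lborel (\<lambda>y. gauss_density y * F2 b y)"
    unfolding split using i iF1' igp by simp
  then show "integrable std_gauss (F2 b)" by (simp add: integrable_std_gauss)
  have "(\<integral>y. gauss_density y * F2 b y \<partial>lborel) = (\<integral>y. gauss_density y * (F1 b y * (y \<bullet> b)) \<partial>lborel)"
    unfolding split using i iF1' igp eq by simp
  then show "(\<integral>y. F2 b y \<partial>std_gauss) = (\<integral>y. F1 b y * (y \<bullet> b) \<partial>std_gauss)"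
    by (simp add: integral_std_gauss)
qed

section \<open>Averages under the Ornstein--Uhlenbeck semigroup\<close>

lemma has_pderiv_iff:
  "has_pderiv b f f' \<longleftrightarrow> (\<forall>x. has_partial b f x) \<and> partial b f = f'"
proof
  assume d: "has_pderiv b f f'"
  then have "has_partial b f x" for x
    unfolding has_pderiv_def has_partial_def real_differentiable_def by blast
  moreover have "partial b f x = f' x" for x
    using d unfolding has_pderiv_def partial_def by (blast intro: DERIV_imp_deriv)
  ultimately show "(\<forall>x. has_partial b f x) \<and> partial b f = f'" by blast
next
  assume "(\<forall>x. has_partial b f x) \<and> partial b f = f'"
  then show "has_pderiv b f f'"
    unfolding has_pderiv_def has_partial_def partial_def
    using DERIV_deriv_iff_real_differentiable by blast
qed

lemma has_pderiv_affine:
  assumes "has_pderiv b f f'"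
  shows "has_pderiv b (\<lambda>y. f (z + c *\<^sub>R y)) (\<lambda>y. c * f' (z + c *\<^sub>R y))"
  unfolding has_pderiv_def
proof
  fix y
  have "((\<lambda>h. f ((z + c *\<^sub>R y) + (c * h) *\<^sub>R b)) has_real_derivative f' ((z + c *\<^sub>R y) + (c * 0) *\<^sub>R b) * c) (at 0)"
    by (rule DERIV_chain2[OF has_pderivD[OF assms]]) (auto intro!: derivative_eq_intros)
  then show "((\<lambda>h. f (z + c *\<^sub>R (y + h *\<^sub>R b))) has_real_derivative c * f' (z + c *\<^sub>R y)) (at 0)"
    by (simp add: scaleR_add_right add.assoc mult.commute)
qed

lemma has_pderiv_powr:
  assumes d: "has_pderiv b f f'" and pos: "\<And>x. f x > 0"
  shows "has_pderiv b (\<lambda>x. f x powr p) (\<lambda>x. p * f x powr (p - 1) * f' x)"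
  unfolding has_pderiv_def
proof
  fix x
  have "((\<lambda>h. f (x + h *\<^sub>R b)) has_real_derivative f' x) (at 0)"
    using d unfolding has_pderiv_def by blast
  from DERIV_chain2[OF has_real_derivative_powr[of "f (x + 0 *\<^sub>R b)" p] this] pos
  show "((\<lambda>h. f (x + h *\<^sub>R b) powr p) has_real_derivative p * f x powr (p - 1) * f' x) (at 0)"
    by simp
qed

text \<open>Here the derivative may fall on \<open>f\<close>, because \<open>f1\<close> has
  polynomial growth. With \<alpha> = e^(-s) this is the commutation of the gradient with the
  semigroup, the dilation contributing the factor \<alpha>.\<close>

lemma ou_average_partial_deriv:
  fixes f f1 :: "'a::euclidean_space \<Rightarrow> real"
  assumes [measurable]: "f \<in> borel_measurable borel"
    and f: "\<And>z. \<bar>f z\<bar> \<le> C * jb z ^ m" and f1: "\<And>z. \<bar>f1 z\<bar> \<le> C1 * jb z ^ m1"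
    and d: "has_pderiv b f f1" and b: "b \<in> Basis"
  shows "has_pderiv b (\<lambda>x. gauss_avg c f (\<alpha> *\<^sub>R x)) (\<lambda>x. \<alpha> * gauss_avg c f1 (\<alpha> *\<^sub>R x))"
proof -
  have C1: "C1 \<ge> 0" by (rule poly_bound_nonneg[OF f1])
  have "has_pderiv b (gauss_avg c f) (gauss_avg c f1)"
    unfolding has_pderiv_def
  proof
    fix x :: 'a
    \<comment> \<open>For |h| < 1 the bracket of x + h b is at most 4 jb x, so B is uniform over the
      window.\<close>
    define B where "B = C1 * (2 * (2 * jb x * 2) * jb c) ^ m1"
    show "((\<lambda>h. gauss_avg c f (x + h *\<^sub>R b)) has_real_derivative gauss_avg c f1 x) (at 0)"
    proof -
      have der: "((\<lambda>h. f (x + h *\<^sub>R b + c *\<^sub>R y)) has_real_derivative f1 (x + h *\<^sub>R b + c *\<^sub>R y)) (at h)" for h y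
        using has_pderivD[OF d, of "x + c *\<^sub>R y" h] by (simp add: add_ac)
      have bd: "\<bar>f1 (x + h *\<^sub>R b + c *\<^sub>R y)\<bar> \<le> B * jb y ^ m1" if h: "\<bar>h - 0\<bar> < 1" for h y
      proof -
        have "h\<^sup>2 \<le> 1" using h by (simp add: abs_square_le_1)
        then have "jb (h *\<^sub>R b) \<le> 2" using b by (simp add: jb_def)
        then have "2 * jb x * jb (h *\<^sub>R b) \<le> 2 * jb x * 2"
          using jb_pos[of x] by (intro mult_left_mono) auto
        with jb_add[of x "h *\<^sub>R b"] have "jb (x + h *\<^sub>R b) \<le> 2 * jb x * 2" by linarith
        then have "(2 * jb (x + h *\<^sub>R b) * jb c) ^ m1 \<le> (2 * (2 * jb x * 2) * jb c) ^ m1"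
          by (intro power_mono mult_right_mono mult_left_mono) (auto simp: jb_nonneg)
        then have "C1 * (2 * jb (x + h *\<^sub>R b) * jb c) ^ m1 * jb y ^ m1 \<le> B * jb y ^ m1"
          unfolding B_def using C1 by (intro mult_right_mono mult_left_mono) (auto simp: jb_nonneg)
        with poly_bound_affine[OF f1, of "x + h *\<^sub>R b" c y] show ?thesis by linarith
      qed
      have int: "integrable std_gauss (\<lambda>y. f (x + h *\<^sub>R b + c *\<^sub>R y))" for h
        using integrable_gauss_avg[OF _ _ f, of "\<lambda>_. 1" 1 0] by simp
      have intB: "integrable std_gauss (\<lambda>y::'a. B * jb y ^ m1)"
        by (intro integrable_mult_right integrable_std_gauss_poly[of _ 1 m1]) (auto simp: jb_nonneg)
      show ?thesis
        using deriv_under_integral(2)[where t = 0 and e = 1 and F = "\<lambda>h y. f (x + h *\<^sub>R b + c *\<^sub>R y)"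
          and F' = "\<lambda>h y. f1 (x + h *\<^sub>R b + c *\<^sub>R y)" and B = "\<lambda>y. B * jb y ^ m1" and M = std_gauss,
          OF _ der bd int intB] by (simp add: gauss_avg_def)
    qed
  qed
  from has_pderiv_affine[OF this, of 0 \<alpha>] show ?thesis by simp
qed

text \<open>This derivative falls on the Gaussian density: in the application \<open>v\<close> is a
  first partial of \<open>U\<close>, whose own derivative has no growth bound that could dominate
  it.\<close>

lemma ou_average_second_partial_deriv:
  fixes v :: "'a::euclidean_space \<Rightarrow> real"
  assumes [measurable]: "v \<in> borel_measurable borel" and v: "\<And>z. \<bar>v z\<bar> \<le> C * jb z ^ m"
    and b: "b \<in> Basis" and c: "c > 0"
  shows "has_pderiv b (\<lambda>x. \<alpha> * gauss_avg c v (\<alpha> *\<^sub>R x))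
    (\<lambda>x. \<alpha>\<^sup>2 / c * (\<integral>y. v (\<alpha> *\<^sub>R x + c *\<^sub>R y) * (y \<bullet> b) \<partial>std_gauss))"
proof -
  have "has_pderiv b (gauss_avg c v) (\<lambda>x. (1 / c) * (\<integral>y. v (x + c *\<^sub>R y) * (y \<bullet> b) \<partial>std_gauss))"
    unfolding has_pderiv_def using gauss_avg_deriv[OF _ v b c] by simp
  from has_pderiv_mult[OF has_pderiv_const[of b \<alpha>] has_pderiv_affine[OF this, of 0 \<alpha>]]
  show ?thesis by (simp add: power2_eq_square mult.assoc)
qed

text \<open>Gaussian integration by parts for the function f (x + c y) of y, whose first and second
  partials carry c and c^2; one factor c cancels.\<close>

lemma ou_average_second_partial:
  fixes f :: "'a::euclidean_space \<Rightarrow> real" and f1 f2 :: "'a \<Rightarrow> 'a \<Rightarrow> real"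
  assumes d1: "\<And>b. b \<in> Basis \<Longrightarrow> has_pderiv b f (f1 b)"
    and d2: "\<And>b. b \<in> Basis \<Longrightarrow> has_pderiv b (f1 b) (f2 b)"
    and f: "\<And>z. \<bar>f z\<bar> \<le> C * jb z ^ m"
    and f1: "\<And>b z. b \<in> Basis \<Longrightarrow> \<bar>f1 b z\<bar> \<le> C * jb z ^ m"
    and lap: "\<And>z. \<bar>\<Sum>b\<in>Basis. f2 b z\<bar> \<le> C * jb z ^ m"
    and b: "b \<in> Basis" and c: "c > 0"
  shows "integrable std_gauss (\<lambda>y. f2 b (x + c *\<^sub>R y))"
    and "c * gauss_avg c (f2 b) x = (\<integral>y. f1 b (x + c *\<^sub>R y) * (y \<bullet> b) \<partial>std_gauss)"
proof -
  have C: "C \<ge> 0" by (rule poly_bound_nonneg[OF f])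
  define A where "A = (2 * jb x * jb c) ^ m"
  \<comment> \<open>1 + c^2 dominates the three factors 1, c and c^2 at once, so a single constant
    serves f and its derivatives.\<close>
  define K where "K = (1 + c\<^sup>2) * (C * A)"
  have CA: "C * A \<ge> 0" using C by (simp add: A_def jb_nonneg)
  have c1: "1 \<le> 1 + c\<^sup>2" "c \<le> 1 + c\<^sup>2" "c\<^sup>2 \<le> 1 + c\<^sup>2"
    using zero_le_power2[of "c - 1 / 2"] by (simp_all add: power2_diff power_divide)
  have bd: "\<bar>k * p (x + c *\<^sub>R y)\<bar> \<le> K * jb y ^ m"
    if p: "\<And>z. \<bar>p z\<bar> \<le> C * jb z ^ m" and k: "0 \<le> k" "k \<le> 1 + c\<^sup>2" for p :: "'a \<Rightarrow> real" and k y
  proof -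
    have "\<bar>k * p (x + c *\<^sub>R y)\<bar> \<le> (1 + c\<^sup>2) * (C * A * jb y ^ m)"
      unfolding abs_mult using poly_bound_affine[OF p, of x c y] k
      by (intro mult_mono) (auto simp: A_def)
    then show ?thesis by (simp add: K_def mult.assoc)
  qed
  note D1 = has_pderiv_affine[OF d1, of _ x c]
  have D2: "has_pderiv e (\<lambda>y. c * f1 e (x + c *\<^sub>R y)) (\<lambda>y. c\<^sup>2 * f2 e (x + c *\<^sub>R y))" if "e \<in> Basis" for e
    using has_pderiv_mult[OF has_pderiv_const[of e c] has_pderiv_affine[OF d2[OF that], of x c]]
    by (simp add: power2_eq_square mult.assoc)
  have B0: "\<bar>f (x + c *\<^sub>R y)\<bar> \<le> K * jb y ^ m" for y
    using bd[OF f, of 1] c1 by simp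
  have B1: "\<bar>c * f1 e (x + c *\<^sub>R y)\<bar> \<le> K * jb y ^ m" if "e \<in> Basis" for e y
    using bd[OF f1[OF that], of c] c c1 by simp
  have B2: "\<bar>\<Sum>e\<in>Basis. c\<^sup>2 * f2 e (x + c *\<^sub>R y)\<bar> \<le> K * jb y ^ m" for y
    using bd[OF lap, of "c\<^sup>2"] c1 by (simp add: sum_distrib_left)
  have "integrable std_gauss (\<lambda>y. c\<^sup>2 * f2 b (x + c *\<^sub>R y))"
    by (rule gauss_integrable_second_partial[OF D1 D2 B0 B1 B2 b])
  from integrable_mult_right[OF this, of "1 / c\<^sup>2"] show "integrable std_gauss (\<lambda>y. f2 b (x + c *\<^sub>R y))"
    using c by simp
  have "(\<integral>y. c\<^sup>2 * f2 b (x + c *\<^sub>R y) \<partial>std_gauss) = (\<integral>y. c * f1 b (x + c *\<^sub>R y) * (y \<bullet> b) \<partial>std_gauss)"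
    by (rule gauss_integral_second_partial[OF D1 D2 B0 B1 B2 b])
  then show "c * gauss_avg c (f2 b) x = (\<integral>y. f1 b (x + c *\<^sub>R y) * (y \<bullet> b) \<partial>std_gauss)"
    using c by (simp add: gauss_avg_def power2_eq_square mult.assoc)
qed

text \<open>Whole powers of \<open>jb\<close> replace the exponent N / 2: in one direction because
  jb >= 1, in the other with N = 2 m. The time interval is kept.\<close>

lemma poly_growth_iff:
  fixes F :: "real \<Rightarrow> 'a::euclidean_space \<Rightarrow> 'b::real_normed_vector"
  shows "poly_growth F \<longleftrightarrow> (\<forall>t>0. \<exists>m a b C. 0 < a \<and> a < t \<and> t < b \<and>
    (\<forall>t'\<in>{a..b}. \<forall>x. norm (F t' x) \<le> C * jb x ^ m))"
proof
  assume F: "poly_growth F"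
  show "\<forall>t>0. \<exists>m a b C. 0 < a \<and> a < t \<and> t < b \<and> (\<forall>t'\<in>{a..b}. \<forall>x. norm (F t' x) \<le> C * jb x ^ m)"
  proof (intro allI impI)
    fix t :: real assume "t > 0"
    then obtain N a b C where h: "0 < a" "a < t" "t < b"
      "\<And>t' x. t' \<in> {a..b} \<Longrightarrow> norm (F t' x) \<le> C * (1 + (norm x)\<^sup>2) powr (real N / 2)"
      using F unfolding poly_growth_def by meson
    have "norm (F t' x) \<le> \<bar>C\<bar> * jb x ^ N" if "t' \<in> {a..b}" for t' x
    proof -
      have "norm (F t' x) \<le> C * jb x powr (real N / 2)"
        using h(4)[OF that, of x] by (simp add: jb_def)
      also have "\<dots> \<le> \<bar>C\<bar> * jb x ^ N"
        by (intro mult_mono jb_powr_le_power) auto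
      finally show ?thesis .
    qed
    with h(1-3) show "\<exists>m a b C. 0 < a \<and> a < t \<and> t < b \<and> (\<forall>t'\<in>{a..b}. \<forall>x. norm (F t' x) \<le> C * jb x ^ m)"
      by blast
  qed
next
  assume F: "\<forall>t>0. \<exists>m a b C. 0 < a \<and> a < t \<and> t < b \<and> (\<forall>t'\<in>{a..b}. \<forall>x. norm (F t' x) \<le> C * jb x ^ m)"
  show "poly_growth F"
    unfolding poly_growth_def
  proof (intro allI impI)
    fix t :: real assume "t > 0"
    then obtain m a b C where h: "0 < a" "a < t" "t < b"
      "\<And>t' x. t' \<in> {a..b} \<Longrightarrow> norm (F t' x) \<le> C * jb x ^ m"
      using F by meson
    have "norm (F t' x) \<le> C * (1 + (norm x)\<^sup>2) powr (real (2 * m) / 2)" if "t' \<in> {a..b}" for t' x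
      using h(4)[OF that, of x] jb_pos[of x] by (simp add: powr_realpow jb_def)
    with h(1-3) show "\<exists>N a b C. 0 < a \<and> a < t \<and> t < b \<and>
        (\<forall>t'\<in>{a..b}. \<forall>x. norm (F t' x) \<le> C * (1 + (norm x)\<^sup>2) powr (real N / 2))"
      by blast
  qed
qed

lemma poly_growthE:
  assumes "poly_growth F" "t > 0"
  shows "\<exists>m a b C. 0 < a \<and> a < t \<and> t < b \<and> (\<forall>t'\<in>{a..b}. \<forall>x. norm (F t' x) \<le> C * jb x ^ m)"
  using assms unfolding poly_growth_iff by blast

lemma poly_growth_at:
  assumes "poly_growth F" "t > 0"
  shows "\<exists>m C. \<forall>x. norm (F t x) \<le> C * jb x ^ m"
proof -
  obtain m a b C where h: "a < t" "t < b" "\<And>t' x. t' \<in> {a..b} \<Longrightarrow> norm (F t' x) \<le> C * jb x ^ m"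
    using poly_growthE[OF assms] by metis
  then have "\<forall>x. norm (F t x) \<le> C * jb x ^ m" by simp
  then show ?thesis by blast
qed

lemma poly_growth_mono:
  fixes F :: "real \<Rightarrow> 'a::euclidean_space \<Rightarrow> 'b::real_normed_vector"
    and G :: "real \<Rightarrow> 'a \<Rightarrow> 'c::real_normed_vector"
  assumes G: "poly_growth G" and le: "\<And>t x. t > 0 \<Longrightarrow> norm (F t x) \<le> norm (G t x)"
  shows "poly_growth F"
  unfolding poly_growth_iff
proof (intro allI impI)
  fix t :: real assume "t > 0"
  then obtain m a b C where h: "0 < a" "a < t" "t < b"
    "\<And>t' x. t' \<in> {a..b} \<Longrightarrow> norm (G t' x) \<le> C * jb x ^ m"
    using poly_growthE[OF G] by metis
  have "norm (F t' x) \<le> C * jb x ^ m" if "t' \<in> {a..b}" for t' x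
    using le[of t' x] h(4)[OF that, of x] that h(1) by simp
  with h(1-3) show "\<exists>m a b C. 0 < a \<and> a < t \<and> t < b \<and> (\<forall>t'\<in>{a..b}. \<forall>x. norm (F t' x) \<le> C * jb x ^ m)"
    by blast
qed

lemma poly_growth_add:
  fixes F G :: "real \<Rightarrow> 'a::euclidean_space \<Rightarrow> 'b::real_normed_vector"
  assumes F: "poly_growth F" and G: "poly_growth G"
  shows "poly_growth (\<lambda>t x. F t x + G t x)"
  unfolding poly_growth_iff
proof (intro allI impI)
  fix t :: real assume t: "t > 0"
  obtain m a b C where h: "0 < a" "a < t" "t < b"
    "\<And>t' x. t' \<in> {a..b} \<Longrightarrow> norm (F t' x) \<le> C * jb x ^ m"
    using poly_growthE[OF F t] by metis
  obtain m' a' b' C' where h': "0 < a'" "a' < t" "t < b'"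
    "\<And>t' x. t' \<in> {a'..b'} \<Longrightarrow> norm (G t' x) \<le> C' * jb x ^ m'"
    using poly_growthE[OF G t] by metis
  have up: "C * jb x ^ m \<le> \<bar>C\<bar> * jb x ^ max m m'" "C' * jb x ^ m' \<le> \<bar>C'\<bar> * jb x ^ max m m'"
    for x :: 'a
    by (intro mult_mono power_increasing jb_ge_1; simp add: jb_nonneg)+
  have "norm (F t' x + G t' x) \<le> (\<bar>C\<bar> + \<bar>C'\<bar>) * jb x ^ max m m'"
    if t': "t' \<in> {max a a'..min b b'}" for t' x
  proof -
    have "norm (F t' x + G t' x) \<le> norm (F t' x) + norm (G t' x)" by (rule norm_triangle_ineq)
    then show ?thesis
      using h(4)[of t' x] h'(4)[of t' x] up[of x] t' by (simp add: distrib_right)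
  qed
  moreover have "0 < max a a'" "max a a' < t" "t < min b b'" using h h' by auto
  ultimately show "\<exists>m a b C. 0 < a \<and> a < t \<and> t < b \<and>
      (\<forall>t'\<in>{a..b}. \<forall>x. norm (F t' x + G t' x) \<le> C * jb x ^ m)" by blast
qed

lemma poly_growth_sum:
  fixes F :: "'i \<Rightarrow> real \<Rightarrow> 'a::euclidean_space \<Rightarrow> 'b::real_normed_vector"
  assumes "finite I" "\<And>i. i \<in> I \<Longrightarrow> poly_growth (F i)"
  shows "poly_growth (\<lambda>t x. \<Sum>i\<in>I. F i t x)"
  using assms
proof (induction I rule: finite_induct)
  case empty
  have "\<exists>m a b C. 0 < a \<and> a < t \<and> t < b \<and> (\<forall>t'\<in>{a..b}. \<forall>x::'a. norm (0::'b) \<le> C * jb x ^ m)"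
    if "t > 0" for t :: real
    using that by (intro exI[of _ 0] exI[of _ "t / 2"] exI[of _ "2 * t"]) simp
  then show ?case by (simp add: poly_growth_iff)
next
  case (insert i I)
  then show ?case using poly_growth_add[of "F i" "\<lambda>t x. \<Sum>i\<in>I. F i t x"] by simp
qed

lemma poly_growth_scaleR:
  assumes F: "poly_growth F"
  shows "poly_growth (\<lambda>t x. k *\<^sub>R F t x)"
  unfolding poly_growth_iff
proof (intro allI impI)
  fix t :: real assume t: "t > 0"
  obtain m a b C where h: "0 < a" "a < t" "t < b"
    "\<And>t' x. t' \<in> {a..b} \<Longrightarrow> norm (F t' x) \<le> C * jb x ^ m"
    using poly_growthE[OF F t] by metis
  have "norm (k *\<^sub>R F t' x) \<le> (\<bar>k\<bar> * C) * jb x ^ m" if "t' \<in> {a..b}" for t' x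
    using mult_left_mono[OF h(4)[OF that, of x], of "\<bar>k\<bar>"] by (simp add: mult.assoc)
  with h(1-3) show "\<exists>m a b C. 0 < a \<and> a < t \<and> t < b \<and>
      (\<forall>t'\<in>{a..b}. \<forall>x. norm (k *\<^sub>R F t' x) \<le> C * jb x ^ m)" by blast
qed

text \<open>The bracket of \<alpha> x + c y splits into brackets of x and y, and the latter is
  integrated out; time interval and degree in x are kept. The weight k will be 1 or a coordinate of
  y. Integrability is assumed because polynomial growth does not include measurability.\<close>

lemma poly_growth_average:
  fixes F :: "real \<Rightarrow> 'a::euclidean_space \<Rightarrow> real"
  assumes F: "poly_growth F"
    and int: "\<And>t x. t > 0 \<Longrightarrow> integrable std_gauss (\<lambda>y. F t (\<alpha> *\<^sub>R x + c *\<^sub>R y) * k y)"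
    and k: "\<And>y. \<bar>k y\<bar> \<le> jb y"
  shows "poly_growth (\<lambda>t x. \<integral>y. F t (\<alpha> *\<^sub>R x + c *\<^sub>R y) * k y \<partial>std_gauss)"
  unfolding poly_growth_iff
proof (intro allI impI)
  fix t :: real assume t: "t > 0"
  obtain m a b C where h: "0 < a" "a < t" "t < b"
    "\<And>t' x. t' \<in> {a..b} \<Longrightarrow> norm (F t' x) \<le> C * jb x ^ m"
    using poly_growthE[OF F t] by metis
  have C: "C \<ge> 0" using poly_bound_nonneg[of "F t" C m] h(4)[of t] h(2,3) by simp
  define I where "I = (\<integral>(y::'a). jb y ^ (m + 1) \<partial>std_gauss)"
  have intI: "integrable std_gauss (\<lambda>y::'a. jb y ^ (m + 1))"
    by (rule integrable_std_gauss_poly[of _ 1 "m + 1"]) (auto simp: jb_nonneg)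
  define E where "E = (2 * jb \<alpha> * jb c) ^ m"
  have "norm (\<integral>y. F t' (\<alpha> *\<^sub>R x + c *\<^sub>R y) * k y \<partial>std_gauss) \<le> (C * E * I) * jb x ^ m"
    if t': "t' \<in> {a..b}" for t' x
  proof -
    have b: "\<bar>F t' z\<bar> \<le> C * jb z ^ m" for z using h(4)[OF t'] by simp
    have le: "\<bar>F t' (\<alpha> *\<^sub>R x + c *\<^sub>R y) * k y\<bar> \<le> C * E * jb x ^ m * jb y ^ (m + 1)" for y
    proof -
      have "\<bar>F t' (\<alpha> *\<^sub>R x + c *\<^sub>R y)\<bar> \<le> C * (2 * jb (\<alpha> *\<^sub>R x) * jb c) ^ m * jb y ^ m"
        by (rule poly_bound_affine[OF b])
      also have "\<dots> \<le> C * (2 * (jb \<alpha> * jb x) * jb c) ^ m * jb y ^ m"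
        using C by (intro mult_right_mono mult_left_mono power_mono jb_scale_le)
          (auto simp: jb_nonneg)
      finally have "\<bar>F t' (\<alpha> *\<^sub>R x + c *\<^sub>R y)\<bar> * \<bar>k y\<bar> \<le> (C * (2 * (jb \<alpha> * jb x) * jb c) ^ m * jb y ^ m) * jb y"
        using k C by (intro mult_mono) (auto simp: jb_nonneg)
      then show ?thesis by (simp add: abs_mult E_def power_mult_distrib mult_ac)
    qed
    have "norm (\<integral>y. F t' (\<alpha> *\<^sub>R x + c *\<^sub>R y) * k y \<partial>std_gauss) \<le> (\<integral>y. \<bar>F t' (\<alpha> *\<^sub>R x + c *\<^sub>R y) * k y\<bar> \<partial>std_gauss)"
      unfolding real_norm_def by (rule integral_abs_bound)
    also have "\<dots> \<le> (\<integral>(y::'a). C * E * jb x ^ m * jb y ^ (m + 1) \<partial>std_gauss)"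
      using integrable_abs[OF int] t' h(1) le
      by (intro lint_mono integrable_mult_right intI) auto
    also have "\<dots> = (C * E * I) * jb x ^ m" by (simp add: I_def)
    finally show ?thesis .
  qed
  with h(1-3) show "\<exists>m a b C. 0 < a \<and> a < t \<and> t < b \<and>
      (\<forall>t'\<in>{a..b}. \<forall>x. norm (\<integral>y. F t' (\<alpha> *\<^sub>R x + c *\<^sub>R y) * k y \<partial>std_gauss) \<le> C * jb x ^ m)" by blast
qed

section \<open>Gradients in coordinates and the power substitution\<close>

lemma grad_inner_Basis:
  "b \<in> Basis \<Longrightarrow> grad f x \<bullet> b = partial b f x"
  unfolding grad_def by (simp add: inner_sum_left inner_Basis if_distrib sum.delta cong: if_cong)

text \<open>The chain rule as an identity, so that it can be read in both directions once the
  prefactor is positive: with exponent p it passes from \<open>u\<close> to \<open>U\<close>, with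
  exponent q from \<open>V\<close> back to \<open>u'\<close>.\<close>

lemma power_transform:
  fixes u U :: "real \<Rightarrow> 'a::euclidean_space \<Rightarrow> real"
  assumes U: "derivatives_exist U" and pos: "\<And>t x. t > 0 \<Longrightarrow> U t x > 0"
    and u: "\<And>t x. t > 0 \<Longrightarrow> u t x = U t x powr p" and t: "t > 0"
  shows "time_deriv u t x - ou_generator (u t) x = p * U t x powr (p - 1) *
    (time_deriv U t x - ou_generator (U t) x - (p - 1) * ((norm (grad (U t) x))\<^sup>2 / U t x))"
proof -
  have ut: "u t = (\<lambda>x. U t x powr p)" using u[OF t] by blast
  define X where "X = U t x"
  have X: "X > 0" using pos[OF t] by (simp add: X_def)
  have "((\<lambda>\<tau>. U \<tau> x) has_real_derivative time_deriv U t x) (at t)"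
    using U t unfolding derivatives_exist_def time_deriv_def
    by (auto simp: DERIV_deriv_iff_real_differentiable)
  from DERIV_chain2[OF has_real_derivative_powr[OF pos[OF t]] this]
  have "((\<lambda>\<tau>. U \<tau> x powr p) has_real_derivative p * X powr (p - 1) * time_deriv U t x) (at t)"
    by (simp add: X_def)
  moreover have "\<forall>\<^sub>F \<tau> in nhds t. u \<tau> x = U \<tau> x powr p"
    using t u eventually_nhds_in_open[of "{0<..}" t] by (auto elim: eventually_mono)
  ultimately have "((\<lambda>\<tau>. u \<tau> x) has_real_derivative p * X powr (p - 1) * time_deriv U t x) (at t)"
    by (subst DERIV_cong_ev[OF refl _ refl])
  then have time: "time_deriv u t x = p * X powr (p - 1) * time_deriv U t x"
    unfolding time_deriv_def by (rule DERIV_imp_deriv)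
  have d: "has_pderiv b (U t) (partial b (U t))"
      "has_pderiv b (partial b (U t)) (partial b (partial b (U t)))" if "b \<in> Basis" for b
    using U t that unfolding derivatives_exist_def has_pderiv_iff by auto
  have p1: "partial b (u t) = (\<lambda>x. p * U t x powr (p - 1) * partial b (U t) x)" if "b \<in> Basis" for b
    using has_pderiv_powr[OF d(1)[OF that] pos[OF t]] unfolding ut has_pderiv_iff by blast
  have p2: "partial b (partial b (u t)) x =
      p * X powr (p - 1) * (partial b (partial b (U t)) x + (p - 1) * (partial b (U t) x * partial b (U t) x) / X)"
    if b: "b \<in> Basis" for b
  proof -
    note D = has_pderiv_mult[OF has_pderiv_mult[OF has_pderiv_const[of b p]
          has_pderiv_powr[OF d(1)[OF b] pos[OF t], of "p - 1"]] d(2)[OF b]]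
    have "partial b (partial b (u t)) x = (0 * X powr (p - 1) + p * ((p - 1) * X powr (p - 1 - 1) * partial b (U t) x))
        * partial b (U t) x + p * X powr (p - 1) * partial b (partial b (U t)) x"
      using D unfolding p1[OF b] has_pderiv_iff X_def by (blast dest: fun_cong)
    also have "X powr (p - 1 - 1) = X powr (p - 1) / X"
      using X by (simp add: powr_diff power2_eq_square)
    finally show ?thesis
      using X by (simp only:) (simp add: field_simps)
  qed
  have n: "(norm (grad (U t) x))\<^sup>2 = (\<Sum>b\<in>Basis. partial b (U t) x * partial b (U t) x)"
    unfolding power2_norm_eq_inner euclidean_inner[of "grad (U t) x" "grad (U t) x"] by (simp add: grad_inner_Basis)
  have "laplacian (u t) x = p * X powr (p - 1) * (laplacian (U t) x + (p - 1) * (norm (grad (U t) x))\<^sup>2 / X)"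
    unfolding laplacian_def n
    by (simp add: p2 sum.distrib flip: sum_distrib_left sum_divide_distrib)
  moreover have "x \<bullet> grad (u t) x = p * X powr (p - 1) * (x \<bullet> grad (U t) x)"
    unfolding grad_def by (simp add: p1 inner_sum_right X_def sum_distrib_left mult_ac)
  ultimately show ?thesis
    unfolding ou_generator_def time by (simp add: X_def algebra_simps)
qed

lemma poly_growth_norm:
  shows "poly_growth F \<Longrightarrow> poly_growth (\<lambda>t x. norm (F t x))"
  by (erule poly_growth_mono) simp

lemma norm_grad_sq: "(norm (grad f x))\<^sup>2 = (\<Sum>b\<in>Basis. (partial b f x)\<^sup>2)"
  unfolding power2_norm_eq_inner euclidean_inner[of "grad f x" "grad f x"]
  by (simp add: grad_inner_Basis power2_eq_square)

lemma abs_partial_le_norm_grad: "b \<in> Basis \<Longrightarrow> \<bar>partial b f x\<bar> \<le> norm (grad f x)"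
  using Basis_le_norm[of b "grad f x"] by (simp add: grad_inner_Basis)

text \<open>\<open>u'\<close> is tied to \<open>V\<close> only at positive times. Equality there
  passes to the time derivative, since it holds in a neighbourhood of each t > 0.\<close>

lemma admissible_growth_cong:
  fixes F G :: "real \<Rightarrow> 'a::euclidean_space \<Rightarrow> real"
  assumes F: "admissible_growth F" and eq: "\<And>t x. t > 0 \<Longrightarrow> F t x = G t x"
  shows "admissible_growth G"
proof -
  have fe: "F t = G t" if "t > 0" for t using eq[OF that] by blast
  have ev: "\<forall>\<^sub>F \<tau> in nhds t. F \<tau> x = G \<tau> x" if "t > 0" for t x
    using that eq eventually_nhds_in_open[of "{0<..}" t] by (auto elim: eventually_mono)
  have te: "time_deriv F t x = time_deriv G t x" if "t > 0" for t x
    unfolding time_deriv_def by (rule deriv_cong_ev[OF ev[OF that] refl])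
  have "derivatives_exist G"
    unfolding derivatives_exist_def
  proof (intro allI impI)
    fix t :: real and x assume t: "t > 0"
    have "(\<lambda>\<tau>. F \<tau> x) differentiable (at t)" and
      b: "\<forall>b\<in>Basis. has_partial b (F t) x \<and> has_partial b (partial b (F t)) x"
      using F t unfolding admissible_growth_def derivatives_exist_def by auto
    then obtain D where "((\<lambda>\<tau>. F \<tau> x) has_real_derivative D) (at t)"
      using real_differentiable_def by blast
    then have "((\<lambda>\<tau>. G \<tau> x) has_real_derivative D) (at t)"
      using DERIV_cong_ev[OF refl ev[OF t] refl] by blast
    then show "(\<lambda>\<tau>. G \<tau> x) differentiable (at t) \<and> (\<forall>b\<in>Basis. has_partial b (G t) x \<and> has_partial b (partial b (G t)) x)"
      using b fe[OF t] real_differentiable_def by auto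
  qed
  moreover have Fg: "poly_growth F" "poly_growth (time_deriv F)" "poly_growth (\<lambda>t. grad (F t))"
    "poly_growth (\<lambda>t x. (norm (grad (F t) x))\<^sup>2 / F t x)" "poly_growth (\<lambda>t. laplacian (F t))"
    using F unfolding admissible_growth_def by auto
  moreover have "poly_growth G"
    by (rule poly_growth_mono[OF Fg(1)]) (simp add: fe)
  moreover have "poly_growth (time_deriv G)"
    by (rule poly_growth_mono[OF Fg(2)]) (simp add: te)
  moreover have "poly_growth (\<lambda>t. grad (G t))"
    by (rule poly_growth_mono[OF Fg(3)]) (simp add: fe)
  moreover have "poly_growth (\<lambda>t x. (norm (grad (G t) x))\<^sup>2 / G t x)"
    by (rule poly_growth_mono[OF Fg(4)]) (simp add: fe)
  moreover have "poly_growth (\<lambda>t. laplacian (G t))"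
    by (rule poly_growth_mono[OF Fg(5)]) (simp add: fe)
  ultimately show ?thesis by (simp add: admissible_growth_def)
qed

section \<open>The Ornstein-Uhlenbeck average \<open>V\<close> of \<open>U\<close>\<close>

context
  fixes U V :: "real \<Rightarrow> 'a::euclidean_space \<Rightarrow> real" and s \<alpha> c :: real
  assumes adm: "admissible_growth U" and pos: "\<And>t x. t > 0 \<Longrightarrow> U t x > 0" and s: "s > 0"
    and V_def: "V \<equiv> \<lambda>t x. ou_semigroup s (U t) x"
    and \<alpha>_def: "\<alpha> \<equiv> exp (- s)" and c_def: "c \<equiv> sqrt (1 - exp (- 2 * s))"
begin

abbreviation "pt x y \<equiv> \<alpha> *\<^sub>R x + c *\<^sub>R y"
abbreviation "Ubb t b \<equiv> partial b (partial b (U t))"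
abbreviation "W t z \<equiv> (norm (grad (U t) z))\<^sup>2 / U t z"

lemma c_pos: "c > 0" and \<alpha>_pos: "\<alpha> > 0" and c_sq: "c\<^sup>2 = 1 - \<alpha>\<^sup>2"
proof -
  have lt: "exp (- 2 * s) < 1" using s by simp
  have eq: "\<alpha>\<^sup>2 = exp (- 2 * s)" by (simp add: \<alpha>_def power2_eq_square flip: exp_add)
  show "c > 0" unfolding c_def using lt by simp
  show "c\<^sup>2 = 1 - \<alpha>\<^sup>2" unfolding c_def eq using lt by (intro real_sqrt_pow2) simp
  show "\<alpha> > 0" by (simp add: \<alpha>_def)
qed

lemma V_eq: "V t x = gauss_avg c (U t) (\<alpha> *\<^sub>R x)"
  by (simp add: V_def ou_semigroup_def gauss_avg_def \<alpha>_def c_def)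

lemma U_partial:
  assumes "t > 0" "b \<in> Basis"
  shows "has_pderiv b (U t) (partial b (U t))"
    and "has_pderiv b (partial b (U t)) (Ubb t b)"
  using adm assms unfolding admissible_growth_def derivatives_exist_def has_pderiv_iff by auto

lemma U_growth:
  shows "poly_growth U" "poly_growth (time_deriv U)" "poly_growth (\<lambda>t. grad (U t))"
    "poly_growth (\<lambda>t x. W t x)" "poly_growth (\<lambda>t. laplacian (U t))"
  using adm unfolding admissible_growth_def by auto

lemma U_partial_growth: "b \<in> Basis \<Longrightarrow> poly_growth (\<lambda>t. partial b (U t))"
  by (rule poly_growth_mono[OF U_growth(3)]) (simp add: abs_partial_le_norm_grad)

text \<open>One pair (C, m) serves all quantities at a fixed time, by bounding the sum of their
  norms. The second partials \<open>Ubb\<close> are bounded only in their sum.\<close>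

lemma U_bounds:
  assumes t: "t > 0"
  shows "\<exists>C m. (\<forall>z. \<bar>U t z\<bar> \<le> C * jb z ^ m) \<and>
    (\<forall>b\<in>Basis. \<forall>z. \<bar>partial b (U t) z\<bar> \<le> C * jb z ^ m) \<and>
    (\<forall>z. \<bar>\<Sum>b\<in>Basis. Ubb t b z\<bar> \<le> C * jb z ^ m) \<and>
    (\<forall>z. \<bar>W t z\<bar> \<le> C * jb z ^ m)"
proof -
  define G where "G t z = (norm (U t z) + norm (grad (U t) z)) +
    (norm (W t z) + norm (laplacian (U t) z))" for t z
  have "poly_growth G"
    unfolding G_def by (intro poly_growth_add poly_growth_norm U_growth)
  then obtain m C where G: "\<And>z. norm (G t z) \<le> C * jb z ^ m"
    using poly_growth_at[OF _ t] by blast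
  have parts: "norm (U t z) \<le> norm (G t z)" "norm (grad (U t) z) \<le> norm (G t z)"
      "norm (W t z) \<le> norm (G t z)" "norm (laplacian (U t) z) \<le> norm (G t z)" for z
  proof -
    have "norm (G t z) = (norm (U t z) + norm (grad (U t) z)) +
      (norm (W t z) + norm (laplacian (U t) z))"
      unfolding G_def real_norm_def[of "_ + _"] by (intro abs_of_nonneg add_nonneg_nonneg norm_ge_zero)
    then show "norm (U t z) \<le> norm (G t z)" "norm (grad (U t) z) \<le> norm (G t z)"
      "norm (W t z) \<le> norm (G t z)" "norm (laplacian (U t) z) \<le> norm (G t z)"
      using norm_ge_zero[of "U t z"] norm_ge_zero[of "grad (U t) z"]
        norm_ge_zero[of "W t z"] norm_ge_zero[of "laplacian (U t) z"] by linarith+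
  qed
  show ?thesis
  proof (intro exI[of _ C] exI[of _ m] conjI allI ballI)
    fix z
    show "\<bar>U t z\<bar> \<le> C * jb z ^ m"
      using order.trans[OF parts(1) G] by simp
    show "\<bar>W t z\<bar> \<le> C * jb z ^ m"
      using order.trans[OF parts(3) G] by simp
    show "\<bar>\<Sum>b\<in>Basis. Ubb t b z\<bar> \<le> C * jb z ^ m"
      using order.trans[OF parts(4) G] by (simp add: laplacian_def)
    show "\<bar>partial b (U t) z\<bar> \<le> C * jb z ^ m" if "b \<in> Basis" for b
      by (rule order.trans[OF abs_partial_le_norm_grad[OF that] order.trans[OF parts(2) G]])
  qed
qed

lemma U_continuous:
  assumes t: "t > 0"
  shows "continuous_on UNIV (U t)"
proof -
  obtain C m where B: "\<And>b z. b \<in> Basis \<Longrightarrow> \<bar>partial b (U t) z\<bar> \<le> C * jb z ^ m"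
    using U_bounds[OF t] by blast
  show ?thesis by (rule continuous_of_partial_derivs[OF U_partial(1)[OF t] B])
qed

lemma U_measurable: "t > 0 \<Longrightarrow> U t \<in> borel_measurable borel"
  by (simp add: borel_measurable_continuous_onI U_continuous)

lemma U_partial_measurable: "t > 0 \<Longrightarrow> b \<in> Basis \<Longrightarrow> partial b (U t) \<in> borel_measurable borel"
  by (rule has_pderiv_measurable[OF U_measurable U_partial(1)])

lemma W_measurable: "t > 0 \<Longrightarrow> (\<lambda>z. W t z) \<in> borel_measurable borel"
  unfolding norm_grad_sq
  by (intro borel_measurable_divide borel_measurable_sum borel_measurable_power U_partial_measurable U_measurable)

text \<open>The last two claims carry the weight: \<open>Ubb t b\<close> has no growth bound, so its
  integrability comes from the L^2 argument behind \<open>ou_average_second_partial\<close>. The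
  others follow from measurability and polynomial growth.\<close>

lemma
  assumes t: "t > 0"
  shows U_integrable: "integrable std_gauss (\<lambda>y. U t (x + c *\<^sub>R y))"
    and W_integrable: "integrable std_gauss (\<lambda>y. W t (x + c *\<^sub>R y))"
    and U_partial_integrable: "b \<in> Basis \<Longrightarrow> integrable std_gauss (\<lambda>y. partial b (U t) (x + c *\<^sub>R y))"
    and U_partial_coord_integrable: "b \<in> Basis \<Longrightarrow> integrable std_gauss (\<lambda>y. partial b (U t) (x + c *\<^sub>R y) * (y \<bullet> b))"
    and U_second_partial_integrable: "b \<in> Basis \<Longrightarrow> integrable std_gauss (\<lambda>y. Ubb t b (x + c *\<^sub>R y))"
    and U_second_partial_integral: "b \<in> Basis \<Longrightarrow>
      (\<integral>y. partial b (U t) (x + c *\<^sub>R y) * (y \<bullet> b) \<partial>std_gauss) = c * gauss_avg c (Ubb t b) x"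
proof -
  obtain C m where B: "\<And>z. \<bar>U t z\<bar> \<le> C * jb z ^ m"
    "\<And>b z. b \<in> Basis \<Longrightarrow> \<bar>partial b (U t) z\<bar> \<le> C * jb z ^ m"
    "\<And>z. \<bar>\<Sum>b\<in>Basis. Ubb t b z\<bar> \<le> C * jb z ^ m"
    "\<And>z. \<bar>W t z\<bar> \<le> C * jb z ^ m"
    using U_bounds[OF t] by blast
  show "integrable std_gauss (\<lambda>y. U t (x + c *\<^sub>R y))"
    using integrable_gauss_avg[OF U_measurable[OF t] _ B(1), of "\<lambda>_. 1" 1 0] by simp
  show "integrable std_gauss (\<lambda>y. W t (x + c *\<^sub>R y))"
    using integrable_gauss_avg[OF W_measurable[OF t] _ B(4), of "\<lambda>_. 1" 1 0] by simp
  show "integrable std_gauss (\<lambda>y. partial b (U t) (x + c *\<^sub>R y))" if b: "b \<in> Basis"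
    using integrable_gauss_avg[OF U_partial_measurable[OF t b] _ B(2)[OF b], of "\<lambda>_. 1" 1 0] by simp
  show "integrable std_gauss (\<lambda>y. partial b (U t) (x + c *\<^sub>R y) * (y \<bullet> b))" if b: "b \<in> Basis"
    using integrable_gauss_avg[OF U_partial_measurable[OF t b] _ B(2)[OF b], of "\<lambda>y. y \<bullet> b" 1 1]
      abs_inner_Basis_le_jb[OF b] by simp
  show "integrable std_gauss (\<lambda>y. Ubb t b (x + c *\<^sub>R y))" if b: "b \<in> Basis"
    by (rule ou_average_second_partial(1)[OF U_partial(1)[OF t] U_partial(2)[OF t] B(1-3) b c_pos])
  show "(\<integral>y. partial b (U t) (x + c *\<^sub>R y) * (y \<bullet> b) \<partial>std_gauss) = c * gauss_avg c (Ubb t b) x"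
    if b: "b \<in> Basis"
    by (rule ou_average_second_partial(2)[OF U_partial(1)[OF t] U_partial(2)[OF t] B(1-3) b c_pos, symmetric])
qed

text \<open>The first derivative falls on \<open>U\<close>, the second on the density;
  \<open>U_second_partial_integral\<close> then rewrites the result as an average of
  \<open>Ubb\<close>.\<close>

lemma V_partial:
  assumes t: "t > 0" and b: "b \<in> Basis"
  shows "has_pderiv b (V t) (\<lambda>x. \<alpha> * gauss_avg c (partial b (U t)) (\<alpha> *\<^sub>R x))"
    and "has_pderiv b (\<lambda>x. \<alpha> * gauss_avg c (partial b (U t)) (\<alpha> *\<^sub>R x))
      (\<lambda>x. \<alpha>\<^sup>2 * gauss_avg c (Ubb t b) (\<alpha> *\<^sub>R x))"
proof -
  obtain C m where B: "\<And>z. \<bar>U t z\<bar> \<le> C * jb z ^ m"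
    "\<And>b z. b \<in> Basis \<Longrightarrow> \<bar>partial b (U t) z\<bar> \<le> C * jb z ^ m"
    "\<And>z. \<bar>\<Sum>b\<in>Basis. Ubb t b z\<bar> \<le> C * jb z ^ m"
    "\<And>z. \<bar>W t z\<bar> \<le> C * jb z ^ m"
    using U_bounds[OF t] by blast
  have "V t = (\<lambda>x. gauss_avg c (U t) (\<alpha> *\<^sub>R x))" using V_eq by blast
  then show "has_pderiv b (V t) (\<lambda>x. \<alpha> * gauss_avg c (partial b (U t)) (\<alpha> *\<^sub>R x))"
    using ou_average_partial_deriv[OF U_measurable[OF t] B(1) B(2)[OF b] U_partial(1)[OF t b] b] by simp
  show "has_pderiv b (\<lambda>x. \<alpha> * gauss_avg c (partial b (U t)) (\<alpha> *\<^sub>R x))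
      (\<lambda>x. \<alpha>\<^sup>2 * gauss_avg c (Ubb t b) (\<alpha> *\<^sub>R x))"
    using ou_average_second_partial_deriv[OF U_partial_measurable[OF t b] B(2)[OF b] b c_pos, of \<alpha>] c_pos
    by (simp add: U_second_partial_integral[OF t b])
qed

text \<open>Growth of the time derivative, uniform over an interval around t, supplies the
  dominating function.\<close>

lemma V_time:
  assumes t: "t > 0"
  shows "integrable std_gauss (\<lambda>y. time_deriv U t (pt x y))"
    and "((\<lambda>\<tau>. V \<tau> x) has_real_derivative (\<integral>y. time_deriv U t (pt x y) \<partial>std_gauss)) (at t)"
proof -
  obtain m a b C where h: "0 < a" "a < t" "t < b"
    "\<And>t' x. t' \<in> {a..b} \<Longrightarrow> norm (time_deriv U t' x) \<le> C * jb x ^ m"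
    using poly_growthE[OF U_growth(2) t] by metis
  define e where "e = min (t - a) (b - t)"
  define B where "B = C * (2 * jb (\<alpha> *\<^sub>R x) * jb c) ^ m"
  have e: "e > 0" using h by (simp add: e_def)
  have win: "\<tau> \<in> {a..b}" "\<tau> > 0" if "\<bar>\<tau> - t\<bar> < e" for \<tau>
    using that h unfolding e_def abs_less_iff by auto
  have der: "((\<lambda>\<tau>. U \<tau> (pt x y)) has_real_derivative time_deriv U \<tau> (pt x y)) (at \<tau>)"
    if "\<bar>\<tau> - t\<bar> < e" for \<tau> y
    using adm win(2)[OF that] unfolding admissible_growth_def derivatives_exist_def time_deriv_def
    by (auto simp: DERIV_deriv_iff_real_differentiable)
  have bd: "\<bar>time_deriv U \<tau> (pt x y)\<bar> \<le> B * jb y ^ m" if "\<bar>\<tau> - t\<bar> < e" for \<tau> y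
    unfolding B_def by (rule poly_bound_affine) (use h(4)[OF win(1)[OF that]] in simp)
  have int: "integrable std_gauss (\<lambda>y. U \<tau> (pt x y))" if "\<bar>\<tau> - t\<bar> < e" for \<tau>
    by (rule U_integrable[OF win(2)[OF that]])
  have intB: "integrable std_gauss (\<lambda>y::'a. B * jb y ^ m)"
    by (intro integrable_mult_right integrable_std_gauss_poly[of _ 1 m]) (auto simp: jb_nonneg)
  show "integrable std_gauss (\<lambda>y. time_deriv U t (pt x y))"
    by (rule deriv_under_integral(1)[OF e der bd int intB])
  show "((\<lambda>\<tau>. V \<tau> x) has_real_derivative (\<integral>y. time_deriv U t (pt x y) \<partial>std_gauss)) (at t)"
    unfolding V_eq gauss_avg_def by (rule deriv_under_integral(2)[OF e der bd int intB])
qed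

lemma V_pos:
  assumes t: "t > 0"
  shows "V t x > 0"
proof -
  interpret prob_space "std_gauss :: 'a measure" by (rule prob_space_std_gauss)
  have nn: "AE y in std_gauss. 0 \<le> U t (pt x y)"
    using pos[OF t] by (intro AE_I2) (simp add: less_imp_le)
  have "V t x \<ge> 0" unfolding V_eq gauss_avg_def by (rule integral_nonneg_AE[OF nn])
  moreover have "V t x \<noteq> 0"
  proof
    assume "V t x = 0"
    then have "AE y in std_gauss. U t (pt x y) = 0"
      using integral_nonneg_eq_0_iff_AE[OF U_integrable[OF t] nn] by (simp add: V_eq gauss_avg_def)
    then have "AE y in (std_gauss :: 'a measure). False"
      by (rule AE_mp) (use pos[OF t] in \<open>auto intro!: AE_I2 simp: less_le\<close>)
    then show False by simp
  qed
  ultimately show ?thesis by simp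
qed

lemma V_derivs:
  assumes t: "t > 0"
  shows "time_deriv V t x = (\<integral>y. time_deriv U t (pt x y) \<partial>std_gauss)"
    and "b \<in> Basis \<Longrightarrow> partial b (V t) = (\<lambda>x. \<alpha> * gauss_avg c (partial b (U t)) (\<alpha> *\<^sub>R x))"
    and "laplacian (V t) x = (\<Sum>b\<in>Basis. \<alpha>\<^sup>2 * gauss_avg c (Ubb t b) (\<alpha> *\<^sub>R x))"
proof -
  show "time_deriv V t x = (\<integral>y. time_deriv U t (pt x y) \<partial>std_gauss)"
    unfolding time_deriv_def[of V] by (rule DERIV_imp_deriv[OF V_time(2)[OF t]])
  have p: "partial b (V t) = (\<lambda>x. \<alpha> * gauss_avg c (partial b (U t)) (\<alpha> *\<^sub>R x))" if "b \<in> Basis" for b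
    using V_partial(1)[OF t that] unfolding has_pderiv_iff by blast
  then show "b \<in> Basis \<Longrightarrow> partial b (V t) = (\<lambda>x. \<alpha> * gauss_avg c (partial b (U t)) (\<alpha> *\<^sub>R x))" .
  have pp: "partial b (partial b (V t)) = (\<lambda>x. \<alpha>\<^sup>2 * gauss_avg c (Ubb t b) (\<alpha> *\<^sub>R x))"
    if "b \<in> Basis" for b
    using V_partial(2)[OF t that] unfolding p[OF that] has_pderiv_iff by blast
  then show "laplacian (V t) x = (\<Sum>b\<in>Basis. \<alpha>\<^sup>2 * gauss_avg c (Ubb t b) (\<alpha> *\<^sub>R x))"
    unfolding laplacian_def by (intro sum.cong refl) (simp only:)
qed

text \<open>Cauchy-Schwarz in linearised form: with A = U / V, expanding |A \<xi> - grad U|^2 >= 0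
  gives 2 \<xi> . grad U <= A |\<xi>|^2 + |grad U|^2 / A. As A averages to 1, integration yields 2 N
  <= N + V * IW. The factor \<alpha>^2 comes from the gradient commutation.\<close>

lemma V_grad_quotient:
  assumes t: "t > 0"
  shows "(norm (grad (V t) x))\<^sup>2 / V t x \<le>
    \<alpha>\<^sup>2 * (\<integral>y. W t (pt x y) \<partial>std_gauss)"
proof -
  define z where "z y = \<alpha> *\<^sub>R x + c *\<^sub>R y" for y :: 'a
  define Wf where "Wf y = W t (z y)" for y
  define IW where "IW = (\<integral>y. Wf y \<partial>std_gauss)"
  define \<xi> where "\<xi> b = (\<integral>y. partial b (U t) (z y) \<partial>std_gauss)" for b
  define N where "N = (\<Sum>b\<in>Basis. (\<xi> b)\<^sup>2)"
  have Vp: "V t x > 0" by (rule V_pos[OF t])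
  have i: "integrable std_gauss (\<lambda>y. U t (z y))"
    "integrable std_gauss (\<lambda>y. Wf y)"
    "\<And>b. b \<in> Basis \<Longrightarrow> integrable std_gauss (\<lambda>y. partial b (U t) (z y))"
    unfolding z_def Wf_def by (intro U_integrable W_integrable U_partial_integrable t; assumption)+
  have pt: "2 * (\<Sum>b\<in>Basis. \<xi> b * partial b (U t) (z y)) \<le>
      N / V t x * U t (z y) + V t x * Wf y" for y
  proof -
    define A where "A = U t (z y) / V t x"
    have A: "A > 0" using pos[OF t] Vp by (simp add: A_def)
    have "0 \<le> (\<Sum>b\<in>Basis. (A * \<xi> b - partial b (U t) (z y))\<^sup>2)" by (intro sum_nonneg) simp
    also have "\<dots> = A\<^sup>2 * N - 2 * A * (\<Sum>b\<in>Basis. \<xi> b * partial b (U t) (z y)) + (norm (grad (U t) (z y)))\<^sup>2"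
      by (simp add: N_def norm_grad_sq power2_diff power_mult_distrib sum.distrib sum_subtractf
          sum_distrib_left mult_ac)
    finally have "A * (2 * (\<Sum>b\<in>Basis. \<xi> b * partial b (U t) (z y))) \<le> A * (A * N + (norm (grad (U t) (z y)))\<^sup>2 / A)"
      using A by (simp add: power2_eq_square distrib_left mult_ac)
    then have "2 * (\<Sum>b\<in>Basis. \<xi> b * partial b (U t) (z y)) \<le> A * N + (norm (grad (U t) (z y)))\<^sup>2 / A"
      using A by (simp only: mult_le_cancel_left_pos)
    then show ?thesis by (simp add: A_def Wf_def mult.commute)
  qed
  have "2 * N = (\<integral>y. 2 * (\<Sum>b\<in>Basis. \<xi> b * partial b (U t) (z y)) \<partial>std_gauss)"
    using i(3) by (simp add: N_def power2_eq_square \<xi>_def)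
  also have "\<dots> \<le> (\<integral>y. N / V t x * U t (z y) + V t x * Wf y \<partial>std_gauss)"
    using pt i by (intro lint_mono Bochner_Integration.integrable_add
        integrable_mult_right Bochner_Integration.integrable_sum) auto
  also have "\<dots> = N / V t x * (\<integral>y. U t (z y) \<partial>std_gauss) + V t x * IW"
    unfolding IW_def by (subst Bochner_Integration.integral_add) (use i(1,2) in simp_all)
  also have "(\<integral>y. U t (z y) \<partial>std_gauss) = V t x" by (simp add: V_eq gauss_avg_def z_def)
  finally have "N \<le> V t x * IW" using Vp by simp
  then have "N / V t x \<le> IW" using Vp by (simp add: field_simps)
  then have "\<alpha>\<^sup>2 * (N / V t x) \<le> \<alpha>\<^sup>2 * IW" by (rule mult_left_mono) simp
  moreover have "(norm (grad (V t) x))\<^sup>2 = \<alpha>\<^sup>2 * N"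
    by (simp add: norm_grad_sq N_def V_derivs[OF t] \<xi>_def z_def gauss_avg_def power_mult_distrib sum_distrib_left)
  ultimately show ?thesis by (simp add: IW_def Wf_def z_def)
qed

lemma V_admissible: "admissible_growth V"
  unfolding admissible_growth_def
proof (intro conjI)
  show "derivatives_exist V"
    unfolding derivatives_exist_def
  proof (intro allI impI conjI ballI)
    fix t :: real and x b :: 'a assume t: "t > 0"
    show "(\<lambda>\<tau>. V \<tau> x) differentiable (at t)"
      using V_time(2)[OF t] real_differentiable_def by blast
    assume b: "b \<in> Basis"
    show "has_partial b (V t) x" "has_partial b (partial b (V t)) x"
      using V_partial[OF t b] unfolding V_derivs(2)[OF t b, symmetric] has_pderiv_iff by auto
  qed
  have J: "\<bar>1\<bar> \<le> jb y" for y :: 'a using jb_ge_1[of y] by simp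
  have avg1: "poly_growth (\<lambda>t x. \<integral>y. F t (pt x y) \<partial>std_gauss)"
    if "poly_growth F" "\<And>t x. t > 0 \<Longrightarrow> integrable std_gauss (\<lambda>y. F t (pt x y))" for F :: "real \<Rightarrow> 'a \<Rightarrow> real"
    using poly_growth_average[OF that(1) _ J] that(2) by simp
  show "poly_growth V"
    by (rule poly_growth_mono[OF avg1[OF U_growth(1) U_integrable]]) (simp_all add: V_eq gauss_avg_def)
  show "poly_growth (time_deriv V)"
    by (rule poly_growth_mono[OF avg1[OF U_growth(2) V_time(1)]]) (simp_all add: V_derivs)
  have gr: "poly_growth (\<lambda>t x. \<Sum>b\<in>Basis. \<alpha> *\<^sub>R ((\<integral>y. partial b (U t) (pt x y) \<partial>std_gauss) *\<^sub>R b))"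
  proof (intro poly_growth_sum poly_growth_scaleR finite_Basis)
    fix b :: 'a assume b: "b \<in> Basis"
    show "poly_growth (\<lambda>t x. (\<integral>y. partial b (U t) (pt x y) \<partial>std_gauss) *\<^sub>R b)"
      by (rule poly_growth_mono[OF avg1[OF U_partial_growth[OF b] U_partial_integrable[OF _ b]]]) (use b in simp_all)
  qed
  show "poly_growth (\<lambda>t. grad (V t))"
    by (rule poly_growth_mono[OF gr]) (simp add: grad_def V_derivs gauss_avg_def)
  \<comment> \<open>\<open>poly_growth_sum\<close> asks for growth of every summand, and a single
    \<open>Ubb\<close> has no bound; each summand is therefore written with a first partial against
    y_b.\<close>
  have la: "poly_growth (\<lambda>t x. \<Sum>b\<in>Basis. (\<alpha>\<^sup>2 / c) *\<^sub>R (\<integral>y. partial b (U t) (pt x y) * (y \<bullet> b) \<partial>std_gauss))"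
  proof (intro poly_growth_sum poly_growth_scaleR finite_Basis)
    fix b :: 'a assume b: "b \<in> Basis"
    show "poly_growth (\<lambda>t x. \<integral>y. partial b (U t) (pt x y) * (y \<bullet> b) \<partial>std_gauss)"
      by (rule poly_growth_average[OF U_partial_growth[OF b] U_partial_coord_integrable[OF _ b] abs_inner_Basis_le_jb[OF b]])
  qed
  show "poly_growth (\<lambda>t. laplacian (V t))"
    by (rule poly_growth_mono[OF la]) (use c_pos in \<open>simp add: V_derivs(3) U_second_partial_integral\<close>)
  have qu: "poly_growth (\<lambda>t x. \<alpha>\<^sup>2 *\<^sub>R (\<integral>y. W t (pt x y) \<partial>std_gauss))"
    by (intro poly_growth_scaleR avg1[OF U_growth(4)] W_integrable)
  show "poly_growth (\<lambda>t x. (norm (grad (V t) x))\<^sup>2 / V t x)"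
  proof (rule poly_growth_mono[OF qu])
    fix t :: real and x :: 'a assume t: "t > 0"
    have "0 \<le> (norm (grad (V t) x))\<^sup>2 / V t x" using V_pos[OF t, of x] by simp
    then show "norm ((norm (grad (V t) x))\<^sup>2 / V t x) \<le>
        norm (\<alpha>\<^sup>2 *\<^sub>R (\<integral>y. W t (pt x y) \<partial>std_gauss))"
      using V_grad_quotient[OF t, of x] by simp
  qed
qed

text \<open>The drift (\<alpha> x + c y) . grad U splits. Its x part averages to x . grad V; its y
  part becomes c^2 times the averaged Laplacian by Gaussian integration by parts. The remaining
  coefficient 1 - c^2 = \<alpha>^2 is the one in the Laplacian of \<open>V\<close>.\<close>

lemma ou_generator_average:
  assumes t: "t > 0"
  shows "integrable std_gauss (\<lambda>y. ou_generator (U t) (pt x y))"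
    and "(\<integral>y. ou_generator (U t) (pt x y) \<partial>std_gauss) = ou_generator (V t) x"
proof -
  define z where "z y = \<alpha> *\<^sub>R x + c *\<^sub>R y" for y :: 'a
  have eq: "ou_generator (U t) (z y) = (\<Sum>b\<in>Basis. Ubb t b (z y)) -
      (\<Sum>b\<in>Basis. \<alpha> * (x \<bullet> b) * partial b (U t) (z y)) - (\<Sum>b\<in>Basis. c * (partial b (U t) (z y) * (y \<bullet> b)))" for y
  proof -
    have "z y \<bullet> grad (U t) (z y) = (\<Sum>b\<in>Basis. (z y \<bullet> b) * partial b (U t) (z y))"
      unfolding grad_def by (simp add: inner_sum_right mult.commute)
    also have "\<dots> = (\<Sum>b\<in>Basis. \<alpha> * (x \<bullet> b) * partial b (U t) (z y)) + (\<Sum>b\<in>Basis. c * (partial b (U t) (z y) * (y \<bullet> b)))"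
      by (simp add: z_def inner_add_left distrib_left distrib_right sum.distrib mult_ac)
    finally show ?thesis by (simp add: ou_generator_def laplacian_def)
  qed
  have i: "integrable std_gauss (\<lambda>y. \<Sum>b\<in>Basis. Ubb t b (z y))"
    "integrable std_gauss (\<lambda>y. \<Sum>b\<in>Basis. \<alpha> * (x \<bullet> b) * partial b (U t) (z y))"
    "integrable std_gauss (\<lambda>y. \<Sum>b\<in>Basis. c * (partial b (U t) (z y) * (y \<bullet> b)))"
    unfolding z_def
    by (intro Bochner_Integration.integrable_sum integrable_mult_right U_second_partial_integrable
        U_partial_integrable U_partial_coord_integrable t; assumption)+
  show "integrable std_gauss (\<lambda>y. ou_generator (U t) (pt x y))"
    unfolding z_def[symmetric] eq by (intro Bochner_Integration.integrable_diff i)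
  define \<Lambda> where "\<Lambda> b = gauss_avg c (Ubb t b) (\<alpha> *\<^sub>R x)" for b
  have "(\<integral>y. ou_generator (U t) (z y) \<partial>std_gauss) =
      (\<integral>y. (\<Sum>b\<in>Basis. Ubb t b (z y)) \<partial>std_gauss) -
      (\<integral>y. (\<Sum>b\<in>Basis. \<alpha> * (x \<bullet> b) * partial b (U t) (z y)) \<partial>std_gauss) -
      (\<integral>y. (\<Sum>b\<in>Basis. c * (partial b (U t) (z y) * (y \<bullet> b))) \<partial>std_gauss)"
    unfolding eq using i by simp
  also have "(\<integral>y. (\<Sum>b\<in>Basis. Ubb t b (z y)) \<partial>std_gauss) = (\<Sum>b\<in>Basis. \<Lambda> b)"
    unfolding \<Lambda>_def gauss_avg_def z_def
    by (rule Bochner_Integration.integral_sum) (rule U_second_partial_integrable[OF t])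
  also have "(\<integral>y. (\<Sum>b\<in>Basis. \<alpha> * (x \<bullet> b) * partial b (U t) (z y)) \<partial>std_gauss) = x \<bullet> grad (V t) x"
  proof -
    have "(\<integral>y. (\<Sum>b\<in>Basis. \<alpha> * (x \<bullet> b) * partial b (U t) (z y)) \<partial>std_gauss) =
        (\<Sum>b\<in>Basis. \<integral>y. \<alpha> * (x \<bullet> b) * partial b (U t) (z y) \<partial>std_gauss)"
      unfolding z_def
      by (rule Bochner_Integration.integral_sum) (intro integrable_mult_right U_partial_integrable[OF t])
    also have "\<dots> = x \<bullet> grad (V t) x"
      unfolding grad_def by (simp add: inner_sum_right V_derivs[OF t] gauss_avg_def z_def mult_ac)
    finally show ?thesis .
  qed
  also have "(\<integral>y. (\<Sum>b\<in>Basis. c * (partial b (U t) (z y) * (y \<bullet> b))) \<partial>std_gauss) = c\<^sup>2 * (\<Sum>b\<in>Basis. \<Lambda> b)"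
  proof -
    have "(\<integral>y. (\<Sum>b\<in>Basis. c * (partial b (U t) (z y) * (y \<bullet> b))) \<partial>std_gauss) =
        (\<Sum>b\<in>Basis. \<integral>y. c * (partial b (U t) (z y) * (y \<bullet> b)) \<partial>std_gauss)"
      unfolding z_def
      by (rule Bochner_Integration.integral_sum) (intro integrable_mult_right U_partial_coord_integrable[OF t])
    also have "\<dots> = c\<^sup>2 * (\<Sum>b\<in>Basis. \<Lambda> b)"
      by (simp add: z_def \<Lambda>_def U_second_partial_integral[OF t] sum_distrib_left power2_eq_square mult.assoc)
    finally show ?thesis .
  qed
  also have "(\<Sum>b\<in>Basis. \<Lambda> b) - x \<bullet> grad (V t) x - c\<^sup>2 * (\<Sum>b\<in>Basis. \<Lambda> b) = \<alpha>\<^sup>2 * (\<Sum>b\<in>Basis. \<Lambda> b) - x \<bullet> grad (V t) x"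
    unfolding c_sq by (simp add: algebra_simps)
  also have "\<dots> = ou_generator (V t) x"
    by (simp add: ou_generator_def V_derivs(3)[OF t] \<Lambda>_def sum_distrib_left)
  finally show "(\<integral>y. ou_generator (U t) (pt x y) \<partial>std_gauss) = ou_generator (V t) x"
    by (simp add: z_def)
qed

lemma V_inequality:
  fixes p q :: real
  assumes p: "p > 1" and q: "q > 1" and pq: "(q - 1) * \<alpha>\<^sup>2 = p - 1"
    and U: "\<And>t x. t > 0 \<Longrightarrow> 0 \<le> time_deriv U t x - ou_generator (U t) x - (p - 1) * (W t x)"
    and t: "t > 0"
  shows "0 \<le> time_deriv V t x - ou_generator (V t) x - (q - 1) * ((norm (grad (V t) x))\<^sup>2 / V t x)"
proof -
  define z where "z y = \<alpha> *\<^sub>R x + c *\<^sub>R y" for y :: 'a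
  define Wf where "Wf y = W t (z y)" for y
  define IW where "IW = (\<integral>y. Wf y \<partial>std_gauss)"
  have i: "integrable std_gauss (\<lambda>y. time_deriv U t (z y))" "integrable std_gauss (\<lambda>y. ou_generator (U t) (z y))"
    "integrable std_gauss (\<lambda>y. (p - 1) * Wf y)"
    unfolding z_def Wf_def using V_time(1)[OF t] ou_generator_average(1)[OF t]
      integrable_mult_right[OF W_integrable[OF t]] by auto
  have "0 \<le> (\<integral>y. time_deriv U t (z y) - ou_generator (U t) (z y) -
      (p - 1) * Wf y \<partial>std_gauss)"
    unfolding Wf_def by (intro integral_nonneg_AE AE_I2 U t)
  also have "\<dots> = time_deriv V t x - ou_generator (V t) x - (p - 1) * IW"
    using i ou_generator_average(2)[OF t, of x] V_derivs(1)[OF t, of x]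
    by (simp add: IW_def flip: z_def)
  finally have "(p - 1) * IW \<le> time_deriv V t x - ou_generator (V t) x" by simp
  moreover have "(q - 1) * ((norm (grad (V t) x))\<^sup>2 / V t x) \<le> (q - 1) * (\<alpha>\<^sup>2 * IW)"
    using q V_grad_quotient[OF t, of x] by (intro mult_left_mono) (auto simp: IW_def Wf_def z_def)
  moreover have "(q - 1) * (\<alpha>\<^sup>2 * IW) = (p - 1) * IW" by (simp add: pq flip: mult.assoc)
  ultimately show ?thesis by linarith
qed

end

section \<open>Transport of the supersolution property from \<open>u\<close> through
  \<open>U\<close> and \<open>V\<close> to \<open>u'\<close>\<close>

theorem theorem1:
  fixes u u' :: "real \<Rightarrow> real ^ 'd \<Rightarrow> real" and p q s :: real
  assumes "1 < p" and "p < q"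
    and "0 < s" and "exp (2 * s) = (q - 1) / (p - 1)"
    and "\<forall>t>0. \<forall>x. u t x > 0"
    and "admissible_growth (\<lambda>t x. u t x powr (1 / p))"
    and "ou_supersolution u"
    and "\<forall>t>0. \<forall>x. u' t x = (ou_semigroup s (\<lambda>y. u t y powr (1 / p)) x) powr q"
  shows "(\<forall>t>0. \<forall>x. u' t x > 0 \<and>
            u' t x powr (1 / q) = ou_semigroup s (\<lambda>y. u t y powr (1 / p)) x)
       \<and> admissible_growth (\<lambda>t x. u' t x powr (1 / q))
       \<and> ou_supersolution u'"
proof -
  define U where "U t x = u t x powr (1 / p)" for t x
  define V where "V t x = ou_semigroup s (U t) x" for t x
  have adm: "admissible_growth U" using assms(6) by (simp add: U_def[abs_def])
  have Upos: "U t x > 0" if "t > 0" for t x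
    using assms(5) that by (simp add: U_def less_imp_neq[symmetric])
  have uU: "u t x = U t x powr p" if "t > 0" for t x
    using assms(1,5) that by (simp add: U_def powr_powr less_imp_le)
  have Vdef: "V \<equiv> \<lambda>t x. ou_semigroup s (U t) x" by (simp add: V_def[abs_def])
  \<comment> \<open>The two copies of \<open>reflexive\<close> instantiate \<alpha> and c by their
    defining expressions.\<close>
  note facts = adm Upos assms(3) Vdef reflexive reflexive
  have Vpos: "V t x > 0" if "t > 0" for t x using V_pos[OF facts that] .
  have Vadm: "admissible_growth V" using V_admissible[OF facts] .
  have u'V: "u' t x = V t x powr q" if "t > 0" for t x
    using assms(8) that by (simp add: V_def U_def[abs_def])
  have u'pos: "u' t x > 0" if "t > 0" for t x
    using Vpos[OF that, of x] u'V[OF that, of x] by simp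
  have Vu': "V t x = u' t x powr (1 / q)" if "t > 0" for t x
    using assms(1,2) Vpos[OF that, of x] u'V[OF that, of x] by (simp add: powr_powr)
  have pq: "(q - 1) * (exp (- s))\<^sup>2 = p - 1"
  proof -
    have "(exp (- s))\<^sup>2 * exp (2 * s) = 1"
      by (simp add: power2_eq_square flip: exp_add)
    moreover have "q - 1 = exp (2 * s) * (p - 1)" using assms(1,4) by simp
    ultimately show ?thesis by (metis mult.assoc mult.commute mult_1)
  qed
  have exU: "derivatives_exist U" and exV: "derivatives_exist V"
    using adm Vadm by (simp_all add: admissible_growth_def)
  have Uineq: "0 \<le> time_deriv U t x - ou_generator (U t) x - (p - 1) * ((norm (grad (U t) x))\<^sup>2 / U t x)"
    if t: "t > 0" for t x
  proof -
    have "0 \<le> time_deriv u t x - ou_generator (u t) x"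
      using assms(7) t by (simp add: ou_supersolution_def)
    also have "\<dots> = p * U t x powr (p - 1) *
        (time_deriv U t x - ou_generator (U t) x - (p - 1) * ((norm (grad (U t) x))\<^sup>2 / U t x))"
      by (rule power_transform[OF exU Upos uU t])
    finally have "0 \<le> p * U t x powr (p - 1) *
        (time_deriv U t x - ou_generator (U t) x - (p - 1) * ((norm (grad (U t) x))\<^sup>2 / U t x))" .
    moreover have "0 < p * U t x powr (p - 1)"
      using assms(1) Upos[OF t, of x] by simp
    ultimately show ?thesis by (metis mult_pos_neg not_le)
  qed
  have "ou_supersolution u'"
    unfolding ou_supersolution_def
  proof (intro allI impI)
    fix t :: real and x assume t: "t > 0"
    have "0 \<le> time_deriv V t x - ou_generator (V t) x - (q - 1) * ((norm (grad (V t) x))\<^sup>2 / V t x)"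
      using V_inequality[OF facts assms(1) _ pq Uineq t] assms(1,2) by simp
    then have "0 \<le> q * V t x powr (q - 1) *
        (time_deriv V t x - ou_generator (V t) x - (q - 1) * ((norm (grad (V t) x))\<^sup>2 / V t x))"
      using assms(1,2) by simp
    also have "\<dots> = time_deriv u' t x - ou_generator (u' t) x"
      by (rule power_transform[OF exV Vpos u'V t, symmetric])
    finally show "ou_generator (u' t) x \<le> time_deriv u' t x" by simp
  qed
  moreover have "admissible_growth (\<lambda>t x. u' t x powr (1 / q))"
    by (rule admissible_growth_cong[OF Vadm Vu'])
  moreover have "\<forall>t>0. \<forall>x. u' t x > 0 \<and> u' t x powr (1 / q) = ou_semigroup s (\<lambda>y. u t y powr (1 / p)) x"
    using u'pos Vu' by (simp add: V_def U_def[abs_def])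
  ultimately show ?thesis by blast
qed

end
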